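(* Let $1\le p\le 2$, let $v\in L^p([0,\pi])$ be a complex-valued potential, and let $bc\in\{Per^+,Per^-,Dir\}$. Let $1\le a\le 2\le b\le\infty$ with $1/a-1/b<1$. Define $r$ by $$\frac1r=\frac12\left(\frac1p+\frac1a-\frac1b\right).$$ Then $1/r<1$, and there exist $N_*=N_*(\|v\|_p)$ and a constant $C>0$ independent of $N$ such that for all $N\ge N_*$ $$\|S_N-S_N^0: L^a\to L^b\|\le C\cdot\begin{cases}\dfrac1N & \text{if } r>2,\\[2mm] \dfrac{\log N}{N} & \text{if } r=2,\\[2mm] N^{-\gamma} & \text{if } r<2,\end{cases}\qquad \gamma=\left(1-\frac1p\right)+\left(1-\left(\frac1a-\frac1b\right)\right).$$
   Context: $L^a=L^a([0,\pi])$ with normalized Lebesgue measure: $\|f\|_a=\left(\frac1\pi\int_0^\pi|f(x)|^a\,dx\right)^{1/a}$ (and the essential sup norm for exponent $\infty$). For complex-valued $v\in L^1([0,\pi])$ and $bc\in\{Per^+,Per^-,Dir\}$, $L=L_{bc}(v)$ is the closed operator in $L^2([0,\pi])$ given by $Ly=-y''+v\,y$ on the domain of all $y$ such that $y,y'$ are absolutely continuous on $[0,\pi]$, $-y''+vy\in L^2([0,\pi])$, and the boundary conditions hold: $Per^{\pm}$: $y(\pi)=\pm y(0)$, $y'(\pi)=\pm y'(0)$; $Dir$: $y(0)=y(\pi)=0$. $L^0=L_{bc}(0)$ is the free operator. Their spectra are discrete. Let $R_\lambda=(\lambda-L)^{-1}$, $R^0_\lambda=(\lambda-L^0)^{-1}$.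 For $\omega,h>0$ let $\Pi_N=\{x+iy:\ -\omega\le x\le N^2+N,\ |y|\le h\}$ and $$S_N=\frac1{2\pi i}\int_{\partial\Pi_N}R_\lambda\,d\lambda,\qquad S_N^0=\frac1{2\pi i}\int_{\partial\Pi_N}R^0_\lambda\,d\lambda,$$ where $\omega,h$ are taken large enough that the interior of $\Pi_N$ contains all eigenvalues of $L$ and $L^0$ with real part at most $N^2+N$, and $N$ is large enough that no eigenvalue lies on the line $\mathrm{Re}\,\lambda=N^2+N$ ($S_N$, $S_N^0$ do not depend on the choice of such $\omega,h$). Operators defined on $L^2$ are regarded as operators from $L^a$, $a<2$, by extension by continuity from the dense subspace $L^2$. *)

theory Defs
  imports "HOL-Analysis.Analysis" "HOL-Probability.Essential_Supremum"
begin

section \<open>The spaces \<open>L^p([0,\<pi>])\<close> with normalized Lebesgue measure\<close>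

text \<open>
  Elements of \<open>L^p([0,\<pi>])\<close> are represented by functions on the real line; only the values on
  \<open>[0,\<pi>]\<close> matter, and only up to null sets. Exponents range over \<open>[1,\<infinity>]\<close>.
\<close>

definition lp_norm :: "ereal \<Rightarrow> (real \<Rightarrow> complex) \<Rightarrow> ennreal" where
  "lp_norm p f =
     (if p = \<infinity> then esssup (lebesgue_on {0..pi}) (\<lambda>x. ennreal (norm (f x)))
      else let J = (\<integral>\<^sup>+x. ennreal (norm (f x) powr real_of_ereal p) \<partial>lebesgue_on {0..pi})
           in if J = top then top
              else ennreal ((1 / pi * enn2real J) powr (1 / real_of_ereal p)))"

definition Lp :: "ereal \<Rightarrow> (real \<Rightarrow> complex) set" where
  "Lp p = {f \<in> borel_measurable (lebesgue_on {0..pi}). lp_norm p f < top}"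

section \<open>Operators between these spaces\<close>

type_synonym fop = "(real \<Rightarrow> complex) \<Rightarrow> (real \<Rightarrow> complex)"

definition opnorm :: "ereal \<Rightarrow> ereal \<Rightarrow> fop \<Rightarrow> ennreal" where
  "opnorm a b T = Inf {K. \<forall>f\<in>Lp a. lp_norm b (T f) \<le> K * lp_norm a f}"

text \<open>
  \<open>T'\<close> is a continuous map from \<open>L^a\<close> to \<open>L^b\<close> that agrees with \<open>T\<close> on \<open>L^2\<close>. Continuity
  with respect to the seminorms also makes \<open>T'\<close> respect equality almost everywhere.
\<close>

definition extends_by_continuity :: "ereal \<Rightarrow> ereal \<Rightarrow> fop \<Rightarrow> fop \<Rightarrow> bool" where
  "extends_by_continuity a b T T' \<longleftrightarrow>
     (\<forall>f\<in>Lp a. T' f \<in> Lp b) \<and>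
     (\<forall>f\<in>Lp 2. AE x in lebesgue_on {0..pi}. T' f x = T f x) \<and>
     (\<forall>u f. (\<forall>n. u n \<in> Lp a) \<and> f \<in> Lp a \<and>
            (\<lambda>n::nat. lp_norm a (\<lambda>x. u n x - f x)) \<longlonglongrightarrow> 0 \<longrightarrow>
            (\<lambda>n. lp_norm b (\<lambda>x. T' (u n) x - T' f x)) \<longlonglongrightarrow> 0)"

text \<open>
  The norm \<open>L^a \<rightarrow> L^b\<close> of an operator given on \<open>L^2\<close>, for \<open>a \<le> 2\<close>. By density of \<open>L^2\<close> in \<open>L^a\<close>
  there is at most one extension up to equality almost everywhere, so the infimum is over at most
  one value; it is \<open>\<infinity>\<close> if the operator has no extension.
\<close>

definition ext_opnorm :: "ereal \<Rightarrow> ereal \<Rightarrow> fop \<Rightarrow> ennreal" where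
  "ext_opnorm a b T = Inf {opnorm a b T' | T'. extends_by_continuity a b T T'}"

text \<open>
  Contour integrals of functions with values in the operators on \<open>L^2\<close>: this is the usual
  gauge integral of \<open>F (g t) g'(t)\<close> over \<open>[0,1]\<close> (cf. \<^const>\<open>has_integral\<close>), with
  convergence of the Riemann sums in the operator norm of \<open>L^2\<close>.
\<close>

definition has_op_contour_integral ::
    "(complex \<Rightarrow> fop) \<Rightarrow> fop \<Rightarrow> (real \<Rightarrow> complex) \<Rightarrow> bool"
  where
  "has_op_contour_integral F S g \<longleftrightarrow>
     (\<forall>f\<in>Lp 2. S f \<in> Lp 2) \<and>
     ((\<lambda>D. opnorm 2 2 (\<lambda>f x.
          (\<Sum>(t, K)\<in>D. measure lborel K *\<^sub>R (vector_derivative g (at t within {0..1}) * F (g t) f x))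
            - S f x))
       \<longlongrightarrow> 0) (division_filter {0..1})"

definition op_contour_integral :: "(real \<Rightarrow> complex) \<Rightarrow> (complex \<Rightarrow> fop) \<Rightarrow> fop" where
  "op_contour_integral g F = (SOME S. has_op_contour_integral F S g)"

section \<open>Hill--Schroedinger operators\<close>

text \<open>
  Absolute continuity on \<open>[a,b]\<close>: the members of the division are finitely many nonoverlapping
  compact intervals \<open>[Inf k, Sup k]\<close>.
\<close>

definition abs_continuous_on :: "real \<Rightarrow> real \<Rightarrow> (real \<Rightarrow> complex) \<Rightarrow> bool" where
  "abs_continuous_on a b f \<longleftrightarrow>
     (\<forall>\<epsilon>>0. \<exists>\<delta>>0. \<forall>d t. d division_of t \<and> t \<subseteq> {a..b} \<and> (\<Sum>k\<in>d. measure lborel k) < \<delta> \<longrightarrow>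
        (\<Sum>k\<in>d. norm (f (Sup k) - f (Inf k))) < \<epsilon>)"

datatype boundary_condition = Per_plus | Per_minus | Dir

fun satisfies_bc ::
    "boundary_condition \<Rightarrow> (real \<Rightarrow> complex) \<Rightarrow> (real \<Rightarrow> complex) \<Rightarrow> bool" where
  "satisfies_bc Per_plus y y' \<longleftrightarrow> y pi = y 0 \<and> y' pi = y' 0"
| "satisfies_bc Per_minus y y' \<longleftrightarrow> y pi = - y 0 \<and> y' pi = - y' 0"
| "satisfies_bc Dir y y' \<longleftrightarrow> y 0 = 0 \<and> y pi = 0"

text \<open>
  The graph of \<open>L = L\<^sub>b\<^sub>c(v)\<close>: \<open>y\<close> is in the domain and \<open>L y = g\<close>, that is, \<open>- y'' + v y = g\<close> almost
  everywhere on \<open>[0,\<pi>]\<close>, with \<open>g\<close> in \<open>L^2\<close>.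
\<close>

definition hill_graph ::
    "boundary_condition \<Rightarrow> (real \<Rightarrow> complex) \<Rightarrow> (real \<Rightarrow> complex) \<Rightarrow> (real \<Rightarrow> complex) \<Rightarrow> bool"
  where
  "hill_graph bc v y g \<longleftrightarrow>
     g \<in> Lp 2 \<and>
     (\<exists>y' y''.
        (\<forall>x\<in>{0..pi}. (y has_vector_derivative y' x) (at x within {0..pi})) \<and>
        abs_continuous_on 0 pi y \<and> abs_continuous_on 0 pi y' \<and>
        satisfies_bc bc y y' \<and>
        (AE x in lebesgue_on {0..pi}.
           (y' has_vector_derivative y'' x) (at x within {0..pi}) \<and> - y'' x + v x * y x = g x))"

definition hill_eigenvalue :: "boundary_condition \<Rightarrow> (real \<Rightarrow> complex) \<Rightarrow> complex \<Rightarrow> bool" where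
  "hill_eigenvalue bc v \<mu> \<longleftrightarrow>
     (\<exists>y. hill_graph bc v y (\<lambda>x. \<mu> * y x) \<and> (\<exists>x\<in>{0..pi}. y x \<noteq> 0))"

text \<open>
  \<open>(\<mu> - L)\<inverse> f\<close>. Elements of the domain of \<open>L\<close> are continuous, hence determined on all of \<open>[0,\<pi>]\<close>;
  extending them by zero makes the description unique.
\<close>

definition hill_resolvent :: "boundary_condition \<Rightarrow> (real \<Rightarrow> complex) \<Rightarrow> complex \<Rightarrow> fop" where
  "hill_resolvent bc v \<mu> f =
     (THE y. hill_graph bc v y (\<lambda>x. \<mu> * y x - f x) \<and> (\<forall>x. x \<notin> {0..pi} \<longrightarrow> y x = 0))"

section \<open>Spectral projections\<close>

definition corner_ll :: "real \<Rightarrow> real \<Rightarrow> complex" where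
  "corner_ll \<omega> h = Complex (- \<omega>) (- h)"

definition corner_ur :: "nat \<Rightarrow> real \<Rightarrow> complex" where
  "corner_ur N h = Complex (real N ^ 2 + real N) h"

text \<open>
  The rectangle \<open>\<Pi>\<^sub>N\<close> contains in its interior all eigenvalues with real part at most \<open>N\<^sup>2 + N\<close>;
  in particular, none of them lies on the line \<open>Re \<lambda> = N\<^sup>2 + N\<close>.
\<close>

definition encloses_low_eigenvalues ::
    "boundary_condition \<Rightarrow> (real \<Rightarrow> complex) \<Rightarrow> nat \<Rightarrow> real \<Rightarrow> real \<Rightarrow> bool" where
  "encloses_low_eigenvalues bc v N \<omega> h \<longleftrightarrow>
     (\<forall>\<mu>. hill_eigenvalue bc v \<mu> \<and> Re \<mu> \<le> real N ^ 2 + real N \<longrightarrow>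
        \<mu> \<in> interior (cbox (corner_ll \<omega> h) (corner_ur N h)))"

definition admissible ::
    "boundary_condition \<Rightarrow> (real \<Rightarrow> complex) \<Rightarrow> nat \<Rightarrow> real \<Rightarrow> real \<Rightarrow> bool" where
  "admissible bc v N \<omega> h \<longleftrightarrow>
     \<omega> > 0 \<and> h > 0 \<and>
     encloses_low_eigenvalues bc v N \<omega> h \<and> encloses_low_eigenvalues bc (\<lambda>_. 0) N \<omega> h"

definition spectral_proj ::
    "boundary_condition \<Rightarrow> (real \<Rightarrow> complex) \<Rightarrow> nat \<Rightarrow> real \<Rightarrow> real \<Rightarrow> fop" where
  "spectral_proj bc v N \<omega> h f x =
     1 / (2 * of_real pi * \<i>) *
     op_contour_integral (rectpath (corner_ll \<omega> h) (corner_ur N h)) (hill_resolvent bc v) f x"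

end

theory Submission
  imports Defs "HOL-Complex_Analysis.Complex_Analysis"
begin

text \<open>
  Write \<open>\<mu> = \<surd>\<lambda>\<close> with \<open>\<tau> = Im \<mu> \<ge> 0\<close>. Factoring \<open>y'' + \<mu>\<^sup>2 y\<close> into two first-order operators shows that, away from
  the free spectrum, every solution of \<open>y'' + \<mu>\<^sup>2 y = f + v y\<close> with the boundary conditions satisfies
  \<open>2 \<bar>\<mu>\<bar> \<bar>y(x)\<bar> \<le> \<integral> k(x,t) \<bar>f + v y\<bar>(t) dt\<close> with a kernel \<open>k\<close> that decays like
  \<open>exp(- \<tau> \<bar>x - t\<bar>)\<close>, up to reflections at the end points. If \<open>\<bar>\<mu>\<bar>\<close> is large compared
  with the \<open>L\<^sup>1\<close> norm of \<open>v\<close>, this gives that \<open>\<lambda>\<close> is not an eigenvalue and that \<open>R\<^sub>\<lambda> - R\<^sup>0\<^sub>\<lambda>\<close> is dominated by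
  \<open>\<bar>\<lambda>\<bar>\<^sup>-\<^sup>1 k \<bar>v\<bar> k\<close>, which maps \<open>L\<^sup>a\<close> to \<open>L\<^sup>b\<close> with norm of order \<open>\<bar>\<lambda>\<bar>\<^sup>-\<^sup>1 (1 + \<tau>)\<^sup>-\<^sup>\<gamma>\<close>.
  By Cauchy's theorem the rectangle may be enlarged at will; the integral of this bound over the dyadic
  pieces of the line \<open>Re \<lambda> = N\<^sup>2 + N\<close>, where \<open>\<tau>\<close> grows geometrically, is a geometric series, and the other
  three sides are negligible.
\<close>

section \<open>Absolutely continuous functions\<close>

text \<open>The potential is merely integrable and no Green's function is ever written down: each
  bound is an a priori inequality for a given solution, while existence comes separately from a
  Fredholm alternative. The spectral projections are integrals in the operator norm, selected by
  \<open>SOME\<close>; they are identified almost everywhere with scalar contour integrals of the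
  resolvent at a fixed \<open>x\<close>. Only in that form do Cauchy's theorem and pointwise bounds
  apply. Since the scalar formula makes sense for every integrable \<open>f\<close>, it is itself
  the continuous extension to \<open>L^a\<close>. The exponent \<gamma> = (1 - 1/a) + (1 - 1/p +
  1/b) has two sources, with \<open>k\<close> read as an integral operator: the first summand is the
  decay in \<tau> of the sup norm of \<open>k |f|\<close>, the second that of the \<open>L^b\<close>
  norm of \<open>k |v|\<close>. The three regimes come from the pieces with
  \<open>|Im \<lambda>|\<close> about \<open>2^i N\<close>, up to \<open>N^2\<close>: there are
  about \<open>log N\<close> of them, and the i-th contributes
  \<open>(1/N) 2^(i (1 - \<gamma>))\<close>.\<close>

lemma division_interval_mem:
  fixes a b :: real
  assumes "d division_of t" "t \<subseteq> {a..b}" "k \<in> d"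
  shows "Inf k \<in> {a..b}" "Sup k \<in> {a..b}" "Inf k \<le> Sup k" "k = {Inf k..Sup k}"
proof -
  obtain u v where k: "k = cbox u v" "k \<noteq> {}" "k \<subseteq> t"
    using assms division_ofD by metis
  then have "u \<le> v" by simp
  moreover have "{u..v} \<subseteq> {a..b}"
    using k assms(2) by (metis cbox_interval order.trans)
  ultimately have "u \<le> v" "u \<in> {a..b}" "v \<in> {a..b}"
    by (simp_all add: subset_iff)
  then show "Inf k \<in> {a..b}" "Sup k \<in> {a..b}" "Inf k \<le> Sup k" "k = {Inf k..Sup k}"
    using k by auto
qed

text \<open>Products, exponentials and linear combinations of absolutely continuous functions all
  reduce to one estimate of increments by those of two such functions.\<close>

lemma abs_continuous_on_dominated:
  assumes f: "abs_continuous_on a b f" and g: "abs_continuous_on a b g"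
    and h: "\<And>x y. x \<in> {a..b} \<Longrightarrow> y \<in> {a..b} \<Longrightarrow>
              norm (h x - h y) \<le> L * (norm (f x - f y) + norm (g x - g y))"
  shows "abs_continuous_on a b h"
  unfolding abs_continuous_on_def
proof (intro allI impI)
  fix e :: real assume "e > 0"
  \<comment> \<open>\<open>L\<close> carries no sign, so a positive bound above it takes its place;
    \<open>e'\<close> then leaves half of \<open>e\<close> to each of the two functions.\<close>
  define L' where "L' = \<bar>L\<bar> + 1"
  have L': "L' > 0" "L \<le> L'" by (auto simp: L'_def)
  define e' where "e' = e / (2 * L')"
  have "e' > 0" using \<open>e > 0\<close> L' by (simp add: e'_def)
  obtain d1 where d1: "d1 > 0" "\<And>d t. d division_of t \<and> t \<subseteq> {a..b} \<and> (\<Sum>k\<in>d. measure lborel k) < d1 \<Longrightarrow>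
        (\<Sum>k\<in>d. norm (f (Sup k) - f (Inf k))) < e'"
    using f \<open>e' > 0\<close> unfolding abs_continuous_on_def by meson
  obtain d2 where d2: "d2 > 0" "\<And>d t. d division_of t \<and> t \<subseteq> {a..b} \<and> (\<Sum>k\<in>d. measure lborel k) < d2 \<Longrightarrow>
        (\<Sum>k\<in>d. norm (g (Sup k) - g (Inf k))) < e'"
    using g \<open>e' > 0\<close> unfolding abs_continuous_on_def by meson
  show "\<exists>\<delta>>0. \<forall>d t. d division_of t \<and> t \<subseteq> {a..b} \<and> (\<Sum>k\<in>d. measure lborel k) < \<delta> \<longrightarrow>
        (\<Sum>k\<in>d. norm (h (Sup k) - h (Inf k))) < e"
  proof (intro exI[of _ "min d1 d2"] conjI allI impI)
    fix d t assume d: "d division_of t \<and> t \<subseteq> {a..b} \<and> (\<Sum>k\<in>d. measure lborel k) < min d1 d2"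
    have "(\<Sum>k\<in>d. norm (h (Sup k) - h (Inf k)))
        \<le> (\<Sum>k\<in>d. L' * (norm (f (Sup k) - f (Inf k)) + norm (g (Sup k) - g (Inf k))))"
    proof (rule sum_mono)
      fix k assume "k \<in> d"
      then have "norm (h (Sup k) - h (Inf k)) \<le> L * (norm (f (Sup k) - f (Inf k)) + norm (g (Sup k) - g (Inf k)))"
        using h division_interval_mem d by blast
      also have "\<dots> \<le> L' * (norm (f (Sup k) - f (Inf k)) + norm (g (Sup k) - g (Inf k)))"
        using L' by (intro mult_right_mono) auto
      finally show "norm (h (Sup k) - h (Inf k)) \<le> L' * (norm (f (Sup k) - f (Inf k)) + norm (g (Sup k) - g (Inf k)))" .
    qed
    also have "\<dots> = L' * ((\<Sum>k\<in>d. norm (f (Sup k) - f (Inf k))) + (\<Sum>k\<in>d. norm (g (Sup k) - g (Inf k))))"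
      by (simp only: sum_distrib_left [symmetric] sum.distrib)
    also have "\<dots> < L' * (e' + e')"
      using d1(2)[of d t] d2(2)[of d t] d L' by (intro mult_strict_left_mono add_strict_mono) auto
    also have "\<dots> = e"
      using L' by (simp add: e'_def field_simps)
    finally show "(\<Sum>k\<in>d. norm (h (Sup k) - h (Inf k))) < e" .
  qed (use d1 d2 in auto)
qed

lemma abs_continuous_on_mult:
  assumes f: "abs_continuous_on a b f" and g: "abs_continuous_on a b g"
    and "bounded (f ` {a..b})" "bounded (g ` {a..b})"
  shows "abs_continuous_on a b (\<lambda>x. f x * g x)"
proof -
  obtain A B where AB: "A > 0" "B > 0" "\<And>x. x \<in> {a..b} \<Longrightarrow> norm (f x) \<le> A" "\<And>x. x \<in> {a..b} \<Longrightarrow> norm (g x) \<le> B"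
    using assms(3,4) unfolding bounded_pos by auto
  show ?thesis
  proof (rule abs_continuous_on_dominated[OF f g, where L = "A + B"])
    fix x y assume xy: "x \<in> {a..b}" "y \<in> {a..b}"
    have "norm (f x * g x - f y * g y) = norm (f x * (g x - g y) + (f x - f y) * g y)"
      by (simp add: algebra_simps)
    also have "\<dots> \<le> norm (f x) * norm (g x - g y) + norm (f x - f y) * norm (g y)"
      by (metis norm_mult norm_triangle_ineq)
    also have "\<dots> \<le> A * norm (g x - g y) + norm (f x - f y) * B"
      using AB xy by (intro add_mono mult_mono) auto
    also have "\<dots> \<le> (A + B) * (norm (f x - f y) + norm (g x - g y))"
      using AB by (simp add: algebra_simps)
    finally show "norm (f x * g x - f y * g y) \<le> (A + B) * (norm (f x - f y) + norm (g x - g y))" .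
  qed
qed

text \<open>The gauge is fine at the points of differentiability, and forces the intervals tagged in
  the exceptional null set into an open set of small measure.\<close>

lemma has_integral_abs_continuous:
  fixes f f' :: "real \<Rightarrow> complex"
  assumes "a \<le> b" and ac: "abs_continuous_on a b f" and Z: "negligible Z"
    and deriv: "\<And>x. x \<in> {a..b} - Z \<Longrightarrow> (f has_vector_derivative f' x) (at x within {a..b})"
  shows "(f' has_integral (f b - f a)) {a..b}"
proof -
  \<comment> \<open>The values of \<open>f'\<close> on \<open>Z\<close> are uncontrolled. With 0 in
    their place, an interval tagged in \<open>Z\<close> contributes only the increment of
    \<open>f\<close>.\<close>
  define g where "g x = (if x \<in> Z then 0 else f' x)" for x
  have "(g has_integral (f b - f a)) (cbox a b)"
    unfolding has_integral
  proof (intro allI impI)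
    fix e :: real assume "e > 0"
    define e1 where "e1 = e / 4 / (b - a + 1)"
    have e1: "e1 > 0" "e1 * (b - a) \<le> e / 4"
      using \<open>e > 0\<close> \<open>a \<le> b\<close> by (auto simp: e1_def field_simps)
    have "e / 4 > 0" using \<open>e > 0\<close> by simp
    then obtain \<delta> where \<delta>: "\<delta> > 0" "\<And>d t. d division_of t \<and> t \<subseteq> {a..b} \<and> (\<Sum>k\<in>d. measure lborel k) < \<delta> \<Longrightarrow>
        (\<Sum>k\<in>d. norm (f (Sup k) - f (Inf k))) < e / 4"
      using ac unfolding abs_continuous_on_def by meson
    obtain G where G: "open G" "Z \<subseteq> G" "G - Z \<in> lmeasurable" "emeasure lebesgue (G - Z) < ennreal \<delta>"
      using sets_lebesgue_outer_open[OF negligible_imp_sets[OF Z] \<open>\<delta> > 0\<close>] by metis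
    have "(G - Z) \<union> Z = G" using G by auto
    then have mG: "G \<in> lmeasurable"
      using G(3) Z by (metis fmeasurable.Un negligible_imp_measurable)
    have "measure lebesgue G = measure lebesgue (G - Z)"
      using Z mG by (simp add: measure_Diff_null_set negligible_iff_null_sets fmeasurableD)
    then have mG': "measure lebesgue G < \<delta>"
      using G(3,4) by (metis emeasure_eq_measure2 ennreal_less_iff measure_nonneg)
    have "\<exists>r>0. (x \<in> Z \<longrightarrow> ball x r \<subseteq> G) \<and> (x \<in> {a..b} - Z \<longrightarrow>
        (\<forall>y\<in>{a..b}. \<bar>y - x\<bar> < r \<longrightarrow> norm (f y - f x - (y - x) *\<^sub>R f' x) \<le> e1 * \<bar>y - x\<bar>))" for x
    proof (cases "x \<in> Z")
      case True
      then show ?thesis using G(1,2) open_contains_ball by blast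
    next
      case False
      show ?thesis
      proof (cases "x \<in> {a..b}")
        case True
        then show ?thesis
          using deriv[of x] e1(1) False
          unfolding has_vector_derivative_def has_derivative_within_alt by fastforce
      qed (auto intro: exI[of _ 1] simp: False)
    qed
    then obtain r where r: "\<And>x. r x > 0" "\<And>x. x \<in> Z \<Longrightarrow> ball x (r x) \<subseteq> G"
      "\<And>x y. x \<in> {a..b} - Z \<Longrightarrow> y \<in> {a..b} \<Longrightarrow> \<bar>y - x\<bar> < r x \<Longrightarrow>
         norm (f y - f x - (y - x) *\<^sub>R f' x) \<le> e1 * \<bar>y - x\<bar>"
      by metis
    have gauge: "gauge (\<lambda>x. ball x (r x))"
      using r(1) by (simp add: gauge_def)
    show "\<exists>\<gamma>. gauge \<gamma> \<and> (\<forall>D. D tagged_division_of cbox a b \<and> \<gamma> fine D \<longrightarrow>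
        norm ((\<Sum>(x,k)\<in>D. measure lborel k *\<^sub>R g x) - (f b - f a)) < e)"
    proof (intro exI[of _ "\<lambda>x. ball x (r x)"] conjI allI impI gauge)
      fix D assume "D tagged_division_of cbox a b \<and> (\<lambda>x. ball x (r x)) fine D"
      then have D: "D tagged_division_of cbox a b" and fine: "(\<lambda>x. ball x (r x)) fine D" by auto
      note DD = tagged_division_ofD[OF D]
      \<comment> \<open>Passing from tags to intervals requires the value 0 on every interval
        without interior; the guard covers the empty one, whose \<open>Sup\<close> and
        \<open>Inf\<close> are unspecified.\<close>
      define \<phi> where "\<phi> k = (if k = {} then 0 else norm (f (Sup k) - f (Inf k)))" for k
      define D2 where "D2 = {(x,k). (x,k) \<in> D \<and> x \<in> Z}"
      have "D2 \<subseteq> D" by (auto simp: D2_def)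
      have tele: "(\<Sum>(x,k)\<in>D. f (Sup k) - f (Inf k)) = f b - f a"
        using additive_tagged_division_1[OF \<open>a \<le> b\<close>, of D f] D by simp
      have "norm ((\<Sum>(x,k)\<in>D. measure lborel k *\<^sub>R g x) - (f b - f a))
          = norm (\<Sum>(x,k)\<in>D. measure lborel k *\<^sub>R g x - (f (Sup k) - f (Inf k)))"
        unfolding tele[symmetric] by (simp add: sum_subtractf split_def)
      also have "\<dots> \<le> (\<Sum>(x,k)\<in>D. norm (measure lborel k *\<^sub>R g x - (f (Sup k) - f (Inf k))))"
        by (rule order.trans[OF norm_sum]) (simp add: split_def)
      also have "\<dots> \<le> (\<Sum>(x,k)\<in>D. e1 * measure lborel k + (if x \<in> Z then \<phi> k else 0))"
      proof (rule sum_mono, clarify)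
        fix x k assume xk: "(x, k) \<in> D"
        then obtain u v where k: "k = cbox u v" "x \<in> k" "k \<subseteq> {a..b}"
          using DD by (metis cbox_interval)
        then have uv: "u \<le> x" "x \<le> v" "u \<in> {a..b}" "v \<in> {a..b}" "x \<in> {a..b}" by auto
        have kb: "k \<subseteq> ball x (r x)" using fine xk by (auto simp: fine_def)
        show "norm (measure lborel k *\<^sub>R g x - (f (Sup k) - f (Inf k))) \<le> e1 * measure lborel k + (if x \<in> Z then \<phi> k else 0)"
        proof (cases "x \<in> Z")
          case True
          then show ?thesis using e1 k by (auto simp: g_def \<phi>_def norm_minus_commute)
        next
          case False
          \<comment> \<open>Both end points are compared with the tag, which lies between them, so
            the two errors add up to \<open>e1\<close> times the length of \<open>k\<close>.\<close>
          have "u \<in> k" "v \<in> k" using uv k by auto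
          then have "u \<in> ball x (r x)" "v \<in> ball x (r x)" using kb by blast+
          then have "norm (f v - f x - (v - x) *\<^sub>R f' x) \<le> e1 * \<bar>v - x\<bar>"
            "norm (f u - f x - (u - x) *\<^sub>R f' x) \<le> e1 * \<bar>u - x\<bar>"
            using uv False r(3)[of x u] r(3)[of x v] unfolding mem_ball dist_real_def
            by (metis DiffI abs_minus_commute)+
          then have "norm ((f v - f x - (v - x) *\<^sub>R f' x) - (f u - f x - (u - x) *\<^sub>R f' x)) \<le> e1 * (v - x) + e1 * (x - u)"
            using uv norm_triangle_ineq4[of "f v - f x - (v - x) *\<^sub>R f' x" "f u - f x - (u - x) *\<^sub>R f' x"] by simp
          also have "(f v - f x - (v - x) *\<^sub>R f' x) - (f u - f x - (u - x) *\<^sub>R f' x) = - ((v - u) *\<^sub>R f' x - (f v - f u))"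
            by (simp add: algebra_simps)
          also have "e1 * (v - x) + e1 * (x - u) = e1 * (v - u)" by (simp add: algebra_simps)
          finally have "norm ((v - u) *\<^sub>R f' x - (f v - f u)) \<le> e1 * (v - u)"
            unfolding norm_minus_cancel .
          then show ?thesis
            using uv k False by (simp add: g_def)
        qed
      qed
      also have "\<dots> = e1 * (\<Sum>(x,k)\<in>D. measure lborel k) + (\<Sum>(x,k)\<in>D. if x \<in> Z then \<phi> k else 0)"
        by (simp add: sum.distrib sum_distrib_left split_def)
      also have "(\<Sum>(x,k)\<in>D. measure lborel k) = b - a"
        using additive_content_tagged_division[OF D] \<open>a \<le> b\<close> by simp
      also have "(\<Sum>(x,k)\<in>D. if x \<in> Z then \<phi> k else 0) = (\<Sum>(x,k)\<in>D2. \<phi> k)"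
        by (rule sum.mono_neutral_cong_right) (use DD(1) in \<open>auto simp: D2_def split: if_splits\<close>)
      also have "\<dots> = (\<Sum>k\<in>snd ` D2. \<phi> k)"
      proof (rule sum.over_tagged_division_lemma)
        show "D2 tagged_division_of \<Union>(snd ` D2)"
          using D \<open>D2 \<subseteq> D\<close> 
          by (meson tagged_division_of_def tagged_partial_division_of_Union_self tagged_partial_division_subset)
        fix u v :: real assume "box u v = {}"
        then show "\<phi> (cbox u v) = 0"
          by (auto simp: \<phi>_def)
      qed
      also have "\<dots> < e / 4"
      proof -
        have D2: "D2 tagged_division_of \<Union>(snd ` D2)"
          using D \<open>D2 \<subseteq> D\<close> 
          by (meson tagged_division_of_def tagged_partial_division_of_Union_self tagged_partial_division_subset)
        have div: "snd ` D2 division_of \<Union>(snd ` D2)"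
          using D2 by (rule division_of_tagged_division)
        have sub: "\<Union>(snd ` D2) \<subseteq> {a..b}" "\<Union>(snd ` D2) \<subseteq> G"
          using DD(3) \<open>D2 \<subseteq> D\<close> fine r(2) by (fastforce simp: D2_def fine_def)+
        have "(\<Sum>k\<in>snd ` D2. measure lborel k) = measure lebesgue (\<Union>(snd ` D2))"
          unfolding content_division[OF div, symmetric]
          by (intro sum.cong refl) (use division_ofD(4)[OF div] in fastforce)
        also have "\<dots> \<le> measure lebesgue G"
          using sub(2) mG lmeasurable_division[OF div] by (intro measure_mono_fmeasurable) auto
        finally have "(\<Sum>k\<in>snd ` D2. norm (f (Sup k) - f (Inf k))) < e / 4"
          using \<delta>(2)[of "snd ` D2"] div sub mG' by force
        moreover have "(\<Sum>k\<in>snd ` D2. \<phi> k) = (\<Sum>k\<in>snd ` D2. norm (f (Sup k) - f (Inf k)))"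
          using division_ofD(3)[OF div] by (intro sum.cong) (auto simp: \<phi>_def)
        ultimately show ?thesis by simp
      qed
      finally show "norm ((\<Sum>(x,k)\<in>D. measure lborel k *\<^sub>R g x) - (f b - f a)) < e"
        using e1 \<open>e > 0\<close> by simp
    qed
  qed
  then have "(f' has_integral (f b - f a)) (cbox a b)"
    by (rule has_integral_spike[OF Z, rotated]) (auto simp: g_def)
  then show ?thesis by simp
qed

text \<open>Cutting at height \<open>n\<close> splits the increments: the part of \<open>|f|\<close>
  where it exceeds \<open>n\<close> has small integral by dominated convergence, and the rest costs
  at most \<open>n\<close> times the total length.\<close>

lemma abs_continuous_on_integral:
  fixes f :: "real \<Rightarrow> complex"
  assumes f: "f absolutely_integrable_on {a..b}"
  shows "abs_continuous_on a b (\<lambda>x. c + integral {a..x} f)"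
  unfolding abs_continuous_on_def
proof (intro allI impI)
  fix e :: real assume "e > 0"
  define g where "g n x = (if norm (f x) > real n then norm (f x) else 0)" for n x
  have nf: "(\<lambda>x. norm (f x)) integrable_on {a..b}"
    using f by (simp add: absolutely_integrable_on_def)
  have mf [measurable]: "f \<in> borel_measurable (lebesgue_on {a..b})"
    using f absolutely_integrable_measurable[of "{a..b}" f] by simp
  have g: "g n integrable_on {a..b}" for n
  proof -
    have "g n \<in> borel_measurable (lebesgue_on {a..b})" unfolding g_def by measurable
    then show ?thesis
      by (rule measurable_bounded_by_integrable_imp_integrable[OF _ nf]) (auto simp: g_def)
  qed
  have "(\<lambda>n. integral {a..b} (g n)) \<longlonglongrightarrow> integral {a..b} (\<lambda>x. 0)"
  proof (rule dominated_convergence(2)[OF g nf])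
    fix x
    obtain m where "norm (f x) \<le> real m" using real_arch_simple by blast
    then have "\<forall>\<^sub>F n in sequentially. g n x = 0"
      by (intro eventually_sequentiallyI[of m]) (auto simp: g_def)
    then show "(\<lambda>n. g n x) \<longlonglongrightarrow> 0" by (simp add: tendsto_eventually)
  qed (auto simp: g_def)
  then have "\<forall>\<^sub>F n in sequentially. integral {a..b} (g n) < e / 2"
    using \<open>e > 0\<close> by (intro order_tendstoD(2)) auto
  then obtain n where n: "integral {a..b} (g n) < e / 2"
    by (auto simp: eventually_sequentially)
  define \<delta> where "\<delta> = e / (2 * (real n + 1))"
  have \<delta>: "\<delta> > 0" "real n * \<delta> \<le> e / 2" using \<open>e > 0\<close> by (auto simp: \<delta>_def field_simps)
  show "\<exists>\<delta>>0. \<forall>d t. d division_of t \<and> t \<subseteq> {a..b} \<and> (\<Sum>k\<in>d. measure lborel k) < \<delta> \<longrightarrow>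
        (\<Sum>k\<in>d. norm (c + integral {a..Sup k} f - (c + integral {a..Inf k} f))) < e"
  proof (intro exI[of _ \<delta>] conjI allI impI \<delta>)
    fix d t assume "d division_of t \<and> t \<subseteq> {a..b} \<and> (\<Sum>k\<in>d. measure lborel k) < \<delta>"
    then have d: "d division_of t" and t: "t \<subseteq> {a..b}" and m: "(\<Sum>k\<in>d. measure lborel k) < \<delta>" by auto
    have fi: "f integrable_on {u..v}" if "{u..v} \<subseteq> {a..b}" for u v
      using f that by (meson absolutely_integrable_on_def integrable_on_subinterval)
    have nfi: "(\<lambda>x. norm (f x)) integrable_on {u..v}" if "{u..v} \<subseteq> {a..b}" for u v
      using nf that by (meson integrable_on_subinterval)
    have gi: "g n integrable_on {u..v}" if "{u..v} \<subseteq> {a..b}" for u v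
      using g that by (meson integrable_on_subinterval)
    have gt: "g n integrable_on t"
      using d g t by (rule integrable_on_subdivision)
    have "(\<Sum>k\<in>d. norm (c + integral {a..Sup k} f - (c + integral {a..Inf k} f)))
        \<le> (\<Sum>k\<in>d. integral k (g n) + real n * measure lborel k)"
    proof (rule sum_mono)
      fix k assume k: "k \<in> d"
      define u v where "u = Inf k" and "v = Sup k"
      have uv: "u \<in> {a..b}" "v \<in> {a..b}" "u \<le> v" "k = {u..v}"
        using division_interval_mem[OF d t k] by (auto simp: u_def v_def)
      then have sub: "{u..v} \<subseteq> {a..b}" "{a..v} \<subseteq> {a..b}" by auto
      have "integral {a..v} f = integral {a..u} f + integral {u..v} f"
        using uv fi[OF sub(2)] by (simp add: Henstock_Kurzweil_Integration.integral_combine)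
      then have "norm (c + integral {a..v} f - (c + integral {a..u} f)) = norm (integral {u..v} f)" by simp
      also have "\<dots> \<le> integral {u..v} (\<lambda>x. norm (f x))"
        using fi nfi sub by (intro integral_norm_bound_integral) auto
      also have "\<dots> \<le> integral {u..v} (\<lambda>x. g n x + real n)"
      proof (intro integral_le nfi[OF sub(1)] integrable_add gi[OF sub(1)] integrable_const_ivl)
        show "norm (f x) \<le> g n x + real n" for x by (simp add: g_def)
      qed
      also have "\<dots> = integral {u..v} (g n) + real n * measure lborel {u..v}"
        using Henstock_Kurzweil_Integration.integral_add[OF gi[OF sub(1)] integrable_const_ivl, of "real n"] uv(3)
        by simp
      finally show "norm (c + integral {a..Sup k} f - (c + integral {a..Inf k} f)) \<le> integral k (g n) + real n * measure lborel k"
        using uv(4) unfolding u_def v_def by metis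
    qed
    also have "\<dots> = (\<Sum>k\<in>d. integral k (g n)) + real n * (\<Sum>k\<in>d. measure lborel k)"
      by (subst sum_distrib_left, subst sum.distrib, rule refl)
    also have "(\<Sum>k\<in>d. integral k (g n)) = integral t (g n)"
      by (rule integral_combine_division_topdown[OF gt d, symmetric])
    also have "\<dots> \<le> integral {a..b} (g n)"
      using t g gt by (intro integral_subset_le) (simp_all add: g_def)
    also have "integral {a..b} (g n) + real n * (\<Sum>k\<in>d. measure lborel k) \<le> integral {a..b} (g n) + real n * \<delta>"
      using m by (intro add_left_mono mult_left_mono) auto
    also have "\<dots> < e" using n \<delta> by simp
    finally show "(\<Sum>k\<in>d. norm (c + integral {a..Sup k} f - (c + integral {a..Inf k} f))) < e" by simp
  qed
qed

text \<open>The Lebesgue differentiation theorem is available for averages over intervals to the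
  right of a point. Applied also to the reflected function \<open>g (- x)\<close>, it yields the
  averages to the left; the second exceptional set has to be reflected back.\<close>

lemma integral_has_vector_derivative_ae:
  fixes f :: "real \<Rightarrow> complex"
  assumes f: "f integrable_on {a..b}"
  obtains N where "negligible N"
    "\<And>x. x \<in> {a..b} - N \<Longrightarrow> ((\<lambda>x. c + integral {a..x} f) has_vector_derivative f x) (at x within {a..b})"
proof -
  define g where "g x = (if x \<in> {a..b} then f x else 0)" for x
  have gU: "g integrable_on UNIV"
    using f unfolding g_def by (subst integrable_restrict_UNIV)
  then have g: "g integrable_on cbox u v" for u v
    by (rule integrable_on_subcbox) auto
  have gm: "(\<lambda>x. g (- x)) integrable_on cbox u v" for u v
    using integrable_reflect[of g "- u" "- v"] g[of "-v" "-u"] by simp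
  obtain N1 where N1: "negligible N1" "\<And>x e. \<lbrakk>x \<notin> N1; 0 < e\<rbrakk> \<Longrightarrow>
     \<exists>d>0. \<forall>h. 0 < h \<and> h < d \<longrightarrow> norm (integral (cbox x (x + h *\<^sub>R One)) g /\<^sub>R h ^ DIM(real) - g x) < e"
    using integrable_ccontinuous_explicit[OF g] by metis
  obtain N2 where N2: "negligible N2" "\<And>x e. \<lbrakk>x \<notin> N2; 0 < e\<rbrakk> \<Longrightarrow>
     \<exists>d>0. \<forall>h. 0 < h \<and> h < d \<longrightarrow> norm (integral (cbox x (x + h *\<^sub>R One)) (\<lambda>x. g (- x)) /\<^sub>R h ^ DIM(real) - g (- x)) < e"
    using integrable_ccontinuous_explicit[OF gm] by metis
  have "negligible (uminus ` N2)"
    using N2(1) by (intro negligible_differentiable_image_negligible) (auto simp: differentiable_on_def)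
  then have neg: "negligible (N1 \<union> uminus ` N2)"
    using N1(1) by simp
  have "((\<lambda>x. c + integral {a..x} f) has_vector_derivative f x) (at x within {a..b})"
    if x: "x \<in> {a..b} - (N1 \<union> uminus ` N2)" for x
    unfolding has_vector_derivative_def has_derivative_within_alt
  proof (intro conjI allI impI bounded_linear_scaleR_left)
    fix e :: real assume "e > 0"
    have x1: "x \<notin> N1" "- x \<notin> N2" "x \<in> {a..b}"
      using x by (auto simp: image_iff)
    obtain d1 where d1: "d1 > 0" "\<And>h. 0 < h \<Longrightarrow> h < d1 \<Longrightarrow> norm (integral {x..x + h} g /\<^sub>R h - g x) < e"
      using N1(2)[OF x1(1) \<open>e > 0\<close>] by auto
    obtain d2 where d2: "d2 > 0" "\<And>h. 0 < h \<Longrightarrow> h < d2 \<Longrightarrow> norm (integral {-x..-x + h} (\<lambda>x. g (- x)) /\<^sub>R h - g x) < e"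
      using N2(2)[OF x1(2) \<open>e > 0\<close>] by auto
    have gf: "integral {u..v} g = integral {u..v} f" if "{u..v} \<subseteq> {a..b}" for u v
      using that by (intro integral_cong) (auto simp: g_def)
    have key: "norm (w - h *\<^sub>R z) \<le> e * h" if "h > 0" "norm (w /\<^sub>R h - z) < e" for w z :: complex and h
    proof -
      have "w - h *\<^sub>R z = h *\<^sub>R (w /\<^sub>R h - z)" using that by (simp add: algebra_simps)
      then have "norm (w - h *\<^sub>R z) = h * norm (w /\<^sub>R h - z)" using that by (metis abs_of_pos norm_scaleR)
      then show ?thesis using that by (simp add: mult.commute less_imp_le)
    qed
    show "\<exists>d>0. \<forall>y\<in>{a..b}. norm (y - x) < d \<longrightarrow>
        norm (c + integral {a..y} f - (c + integral {a..x} f) - (y - x) *\<^sub>R f x) \<le> e * norm (y - x)"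
    proof (intro exI[of _ "min d1 d2"] conjI ballI impI)
      fix y assume y: "y \<in> {a..b}" "norm (y - x) < min d1 d2"
      have fi: "f integrable_on {a..z}" if "z \<in> {a..b}" for z
        using f by (rule integrable_on_subinterval) (use that in auto)
      consider "y = x" | "x < y" | "y < x" by linarith
      then show "norm (c + integral {a..y} f - (c + integral {a..x} f) - (y - x) *\<^sub>R f x) \<le> e * norm (y - x)"
      proof cases
        case 2
        have "integral {a..y} f = integral {a..x} f + integral {x..y} f"
          using 2 fi[OF y(1)] x1 by (simp add: Henstock_Kurzweil_Integration.integral_combine)
        moreover have "norm (integral {x..y} f - (y - x) *\<^sub>R f x) \<le> e * (y - x)"
          using d1(2)[of "y - x"] gf[of x y] 2 y x1 by (intro key) (auto simp: g_def)
        ultimately show ?thesis using 2 by (simp add: norm_minus_commute)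
      next
        case 3
        have "integral {a..x} f = integral {a..y} f + integral {y..x} f"
          using 3 fi[OF x1(3)] y by (simp add: Henstock_Kurzweil_Integration.integral_combine)
        moreover have "integral {-x..-y} (\<lambda>x. g (- x)) = integral {y..x} f"
          using gf[of y x] y x1 by simp
        then have "norm (integral {y..x} f - (x - y) *\<^sub>R f x) \<le> e * (x - y)"
          using d2(2)[of "x - y"] 3 y x1 by (intro key) (auto simp: g_def)
        moreover have "norm (integral {y..x} f - (x - y) *\<^sub>R f x) = norm (- integral {y..x} f - (y - x) *\<^sub>R f x)"
          by (subst norm_minus_cancel[symmetric]) (simp add: algebra_simps)
        ultimately show ?thesis using 3 by simp
      qed (auto)
    qed (use d1 d2 in auto)
  qed
  then show ?thesis using neg that by blast
qed

lemma absolutely_integrable_continuous_mult: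
  fixes q g :: "real \<Rightarrow> 'a :: {real_normed_field, euclidean_space}"
  assumes q: "q absolutely_integrable_on {a..b}" and g: "continuous_on {a..b} g"
  shows "(\<lambda>t. q t * g t) absolutely_integrable_on {a..b}"
proof -
  have "(\<lambda>t. g t * q t) absolutely_integrable_on {a..b}"
    by (rule absolutely_integrable_bounded_measurable_product[where h = "(*)" and f = g and g = q])
      (use q in \<open>auto intro!: bilinear_times continuous_imp_measurable_on_sets_lebesgue[OF g]
        compact_imp_bounded compact_continuous_image[OF g]\<close>)
  then show ?thesis by (simp add: mult.commute)
qed

lemma AE_lebesgue_on_iff_negligible:
  assumes "S \<in> sets lebesgue"
  shows "(AE x in lebesgue_on S. P x) \<longleftrightarrow> (\<exists>N. negligible N \<and> (\<forall>x\<in>S - N. P x))"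
proof -
  have "(AE x in lebesgue_on S. P x) \<longleftrightarrow> (AE x in lebesgue. x \<in> S \<longrightarrow> P x)"
    using assms by (subst AE_restrict_space_iff) auto
  also have "\<dots> \<longleftrightarrow> (\<exists>N. negligible N \<and> (\<forall>x\<in>S - N. P x))"
    unfolding eventually_ae_filter negligible_iff_null_sets by (auto simp: subset_iff)
  finally show ?thesis .
qed

section \<open>The initial value problem\<close>

text \<open>The equation \<open>y'' = q y + f\<close> with its second derivative integrated once, so
  that no exceptional null set appears. For \<open>q = v - \<lambda>\<close> it says
  \<open>(\<lambda> - L) y = f\<close>, boundary conditions aside.\<close>

definition ivp_solution ::
    "(real \<Rightarrow> complex) \<Rightarrow> (real \<Rightarrow> complex) \<Rightarrow> (real \<Rightarrow> complex) \<Rightarrow> (real \<Rightarrow> complex) \<Rightarrow> bool" where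
  "ivp_solution q f y y' \<longleftrightarrow>
     (\<forall>x\<in>{0..pi}. (y has_vector_derivative y' x) (at x within {0..pi})) \<and>
     (\<forall>x\<in>{0..pi}. y' x = y' 0 + integral {0..x} (\<lambda>t. q t * y t + f t))"

lemma ivp_solutionD:
  assumes "ivp_solution q f y y'" "x \<in> {0..pi}"
  shows "(y has_vector_derivative y' x) (at x within {0..pi})"
    and "y' x = y' 0 + integral {0..x} (\<lambda>t. q t * y t + f t)"
  using assms unfolding ivp_solution_def by blast+

lemma ivp_solution_continuous: "ivp_solution q f y y' \<Longrightarrow> continuous_on {0..pi} y"
  by (meson continuous_on_eq_continuous_within has_vector_derivative_continuous ivp_solutionD(1))

lemma ivp_solution_rhs:
  fixes q f y :: "real \<Rightarrow> complex"
  assumes "q absolutely_integrable_on {0..pi}" "f absolutely_integrable_on {0..pi}" "continuous_on {0..pi} y"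
  shows "(\<lambda>t. q t * y t + f t) absolutely_integrable_on {0..pi}"
  by (rule set_integral_add(1)[OF absolutely_integrable_continuous_mult[OF assms(1,3)] assms(2)])

lemma integrable_on_initial:
  fixes f :: "real \<Rightarrow> 'b::euclidean_space"
  assumes "f absolutely_integrable_on {0..pi}" "0 \<le> u" "v \<le> pi"
  shows "f integrable_on {u..v}"
proof -
  have "f absolutely_integrable_on {u..v}"
    by (rule absolutely_integrable_on_subinterval[OF assms(1)]) (use assms in auto)
  then show ?thesis by (rule set_lebesgue_integral_eq_integral(1))
qed

lemma ivp_solution_continuous':
  assumes "ivp_solution q f y y'" "q absolutely_integrable_on {0..pi}" "f absolutely_integrable_on {0..pi}"
  shows "continuous_on {0..pi} y'"
proof -
  have "continuous_on {0..pi} (\<lambda>x. y' 0 + integral {0..x} (\<lambda>t. q t * y t + f t))"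
    by (intro continuous_intros indefinite_integral_continuous_1 set_lebesgue_integral_eq_integral(1)
        ivp_solution_rhs assms ivp_solution_continuous[OF assms(1)])
  then show ?thesis
    by (rule iffD2[OF continuous_on_cong[OF refl ivp_solutionD(2)[OF assms(1)]], rotated])
qed

lemma ivp_solution_integral:
  assumes "ivp_solution q f y y'" "x \<in> {0..pi}"
  shows "(y' has_integral (y x - y 0)) {0..x}"
proof (rule fundamental_theorem_of_calculus)
  fix t assume "t \<in> {0..x}"
  then show "(y has_vector_derivative y' t) (at t within {0..x})"
    using assms by (intro has_vector_derivative_within_subset[OF ivp_solutionD(1)[OF assms(1)]]) auto
qed (use assms in auto)

lemma ivp_solution_linear:
  assumes y: "ivp_solution q f y y'" and z: "ivp_solution q g z z'"
    and q: "q absolutely_integrable_on {0..pi}" 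
    and f: "f absolutely_integrable_on {0..pi}" and g: "g absolutely_integrable_on {0..pi}"
  shows "ivp_solution q (\<lambda>t. f t + c * g t) (\<lambda>t. y t + c * z t) (\<lambda>t. y' t + c * z' t)"
  unfolding ivp_solution_def
proof (intro conjI ballI)
  fix x :: real assume x: "x \<in> {0..pi}"
  show "((\<lambda>t. y t + c * z t) has_vector_derivative y' x + c * z' x) (at x within {0..pi})"
    by (intro derivative_intros has_vector_derivative_mult_right ivp_solutionD(1)[OF y x] ivp_solutionD(1)[OF z x])
  have i1: "(\<lambda>t. q t * y t + f t) integrable_on {0..x}"
    by (rule integrable_on_initial[OF ivp_solution_rhs[OF q f ivp_solution_continuous[OF y]]]) (use x in auto)
  have i2: "(\<lambda>t. q t * z t + g t) integrable_on {0..x}"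
    by (rule integrable_on_initial[OF ivp_solution_rhs[OF q g ivp_solution_continuous[OF z]]]) (use x in auto)
  have "integral {0..x} (\<lambda>t. q t * (y t + c * z t) + (f t + c * g t))
      = integral {0..x} (\<lambda>t. (q t * y t + f t) + c * (q t * z t + g t))"
    by (simp add: algebra_simps)
  also have "\<dots> = integral {0..x} (\<lambda>t. q t * y t + f t) + c * integral {0..x} (\<lambda>t. q t * z t + g t)"
    using i1 i2 integrable_on_mult_right[OF i2, of c]
    by (simp add: Henstock_Kurzweil_Integration.integral_add)
  finally show "y' x + c * z' x = y' 0 + c * z' 0 + integral {0..x} (\<lambda>t. q t * (y t + c * z t) + (f t + c * g t))"
    by (subst ivp_solutionD(2)[OF y x], subst ivp_solutionD(2)[OF z x]) (simp add: algebra_simps)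
qed

text \<open>The weight \<open>W(x) = exp(c \<integral>\<^sub>0\<^sup>x \<bar>q\<bar>)\<close> of Bielecki's norm: it turns the Volterra operator
  of the initial value problem into a contraction.\<close>

lemma bielecki_weight:
  fixes q :: "real \<Rightarrow> complex"
  assumes q: "q absolutely_integrable_on {0..pi}" and c: "c > 0"
  obtains W :: "real \<Rightarrow> real" where "continuous_on {0..pi} W" "\<And>x. x \<in> {0..pi} \<Longrightarrow> 1 \<le> W x"
    "\<And>x y. 0 \<le> x \<Longrightarrow> x \<le> y \<Longrightarrow> y \<le> pi \<Longrightarrow> W x \<le> W y"
    "\<And>x. x \<in> {0..pi} \<Longrightarrow> ((\<lambda>t. norm (q t) * W t) has_integral (W x - 1) / c) {0..x}"
proof -
  define A where "A x = integral {0..x} (\<lambda>t. norm (q t))" for x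
  have nq: "(\<lambda>t. norm (q t)) absolutely_integrable_on {0..pi}"
    using q by (rule absolutely_integrable_norm[unfolded o_def])
  have nqi: "(\<lambda>t. norm (q t)) integrable_on {0..x}" if "x \<le> pi" for x
    using integrable_on_initial[OF nq order.refl that] .
  have mono: "A x \<le> A y" if "0 \<le> x" "x \<le> y" "y \<le> pi" for x y
    unfolding A_def using that nqi by (intro integral_subset_le) auto
  have A0: "0 \<le> A x" if "x \<le> pi" for x
    unfolding A_def using nqi[OF that] by (rule Henstock_Kurzweil_Integration.integral_nonneg) auto
  have contA: "continuous_on {0..pi} A"
    unfolding A_def by (intro indefinite_integral_continuous_1 nqi) auto
  define W where "W x = exp (c * A x)" for x
  \<comment> \<open>Absolute continuity and the fundamental theorem are set up for complex values,
    hence the complex copies \<open>qc\<close> of \<open>|q|\<close> and \<open>E\<close> of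
    \<open>W\<close>.\<close>
  define qc where "qc t = complex_of_real (norm (q t))" for t
  have qc: "qc absolutely_integrable_on {0..pi}"
    using absolutely_integrable_linear[OF nq bounded_linear_of_real] by (simp add: qc_def[abs_def] o_def)
  have Ac: "integral {0..x} qc = complex_of_real (A x)" if "x \<le> pi" for x
    unfolding qc_def A_def using nqi[OF that]
    by (intro integral_unique has_integral_of_real integrable_integral)
  have acA: "abs_continuous_on 0 pi (\<lambda>x. 0 + integral {0..x} qc)"
    using qc by (rule abs_continuous_on_integral)
  obtain N where N: "negligible N" "\<And>x. x \<in> {0..pi} - N \<Longrightarrow>
      ((\<lambda>x. 0 + integral {0..x} qc) has_vector_derivative qc x) (at x within {0..pi})"
    using integral_has_vector_derivative_ae[of qc 0 pi 0] qc set_lebesgue_integral_eq_integral(1) by metis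
  define E where "E x = exp (of_real c * integral {0..x} qc)" for x
  have EW: "E x = of_real (W x)" if "x \<le> pi" for x
    by (simp add: E_def W_def Ac[OF that] exp_of_real flip: of_real_mult)
  have acE: "abs_continuous_on 0 pi E"
  proof (rule abs_continuous_on_dominated[OF acA acA, where L = "c * exp (c * A pi)"])
    \<comment> \<open>The inequality \<open>1 - s \<le> exp (- s)\<close> bounds increments of
      \<open>W\<close> by increments of \<open>A\<close>, so \<open>E\<close> inherits absolute
      continuity from the integral of \<open>qc\<close>.\<close>
    have le: "\<bar>W x - W y\<bar> \<le> c * exp (c * A pi) * \<bar>A x - A y\<bar>" if "0 \<le> x" "x \<le> y" "y \<le> pi" for x y
    proof -
      have "1 - c * (A y - A x) \<le> exp (- (c * (A y - A x)))"
        using exp_ge_add_one_self[of "- (c * (A y - A x))"] by simp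
      then have "exp (c * A y) * (1 - c * (A y - A x)) \<le> exp (c * A y) * exp (- (c * (A y - A x)))"
        by (intro mult_left_mono) auto
      also have "\<dots> = W x" by (simp add: W_def algebra_simps flip: exp_add)
      finally have "W y - W x \<le> exp (c * A y) * (c * (A y - A x))" by (simp add: W_def algebra_simps)
      also have "\<dots> \<le> exp (c * A pi) * (c * (A y - A x))"
        using mono[of y pi] mono[of x y] that c by (intro mult_right_mono) auto
      finally have "W y - W x \<le> c * exp (c * A pi) * (A y - A x)" by (simp add: algebra_simps)
      moreover have "W x \<le> W y" using mono[of x y] that c by (simp add: W_def)
      ultimately show ?thesis using mono[of x y] that by simp
    qed
    fix x y :: real assume xy: "x \<in> {0..pi}" "y \<in> {0..pi}"
    have "\<bar>W x - W y\<bar> \<le> c * exp (c * A pi) * \<bar>A x - A y\<bar>"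
      using le[of x y] le[of y x] xy by (cases "x \<le> y") (auto simp: abs_minus_commute)
    also have "\<dots> \<le> c * exp (c * A pi) * (\<bar>A x - A y\<bar> + \<bar>A x - A y\<bar>)"
      using c by (intro mult_left_mono) auto
    finally show "norm (E x - E y) \<le> c * exp (c * A pi) *
        (norm (0 + integral {0..x} qc - (0 + integral {0..y} qc)) + norm (0 + integral {0..x} qc - (0 + integral {0..y} qc)))"
      using xy by (simp add: EW Ac flip: of_real_diff)
  qed
  have W: "((\<lambda>t. norm (q t) * W t) has_integral (W x - 1) / c) {0..x}" if x: "x \<in> {0..pi}" for x
  proof -
    have ac: "abs_continuous_on 0 x E"
      using acE x unfolding abs_continuous_on_def by (meson atLeastAtMost_iff atLeastatMost_subset_iff order.refl order.trans)
    have "((\<lambda>t. of_real c * qc t * E t) has_integral (E x - E 0)) {0..x}"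
    proof (rule has_integral_abs_continuous[OF _ ac N(1)])
      fix t assume t: "t \<in> {0..x} - N"
      have "((\<lambda>x. 0 + integral {0..x} qc) has_vector_derivative qc t) (at t within {0..pi})"
        using N(2)[of t] t x by auto
      then have "((\<lambda>x. integral {0..x} qc) has_vector_derivative qc t) (at t within {0..x})"
        using x by (auto intro: has_vector_derivative_within_subset)
      then have G: "((\<lambda>x. of_real c * integral {0..x} qc) has_vector_derivative of_real c * qc t) (at t within {0..x})"
        by (rule has_vector_derivative_mult_right)
      have "(exp has_field_derivative exp (of_real c * integral {0..t} qc))
          (at (of_real c * integral {0..t} qc) within (\<lambda>x. of_real c * integral {0..x} qc) ` {0..x})"
        by (rule DERIV_subset[OF DERIV_exp]) simp
      from field_vector_diff_chain_within[OF G this]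
      have "((\<lambda>x. exp (of_real c * integral {0..x} qc)) has_vector_derivative
          (of_real c * qc t) * exp (of_real c * integral {0..t} qc)) (at t within {0..x})"
        by (simp only: o_def)
      then show "(E has_vector_derivative of_real c * qc t * E t) (at t within {0..x})"
        by (simp only: E_def[abs_def])
    qed (use x in auto)
    then have "((\<lambda>t. Re (of_real c * qc t * E t)) has_integral Re (E x - E 0)) {0..x}"
      by (rule has_integral_linear[OF _ bounded_linear_Re, unfolded o_def])
    then have "((\<lambda>t. c * (norm (q t) * W t)) has_integral (W x - 1)) {0..x}"
      using x by (subst has_integral_cong[where g = "\<lambda>t. Re (of_real c * qc t * E t)"])
        (auto simp: EW qc_def W_def A_def)
    then show ?thesis
      using has_integral_divide[of "\<lambda>t. c * (norm (q t) * W t)" "W x - 1" "{0..x}" c] c by simp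
  qed
  show thesis
  proof (rule that[of W])
    show "continuous_on {0..pi} W" unfolding W_def using contA by (intro continuous_intros)
    show "1 \<le> W x" if "x \<in> {0..pi}" for x using A0[of x] c that by (simp add: W_def)
    show "W x \<le> W y" if "0 \<le> x" "x \<le> y" "y \<le> pi" for x y
      using mono[OF that] c by (simp add: W_def)
  qed (fact W)
qed

text \<open>One estimate serves twice: with \<open>f = 0\<close> for the contraction in the
  existence proof, and in full for the Gronwall-type bound on solutions.\<close>

lemma norm_integral_le_weight:
  fixes q y f :: "real \<Rightarrow> complex"
  assumes q: "q absolutely_integrable_on {0..pi}" and f: "f absolutely_integrable_on {0..pi}"
    and y: "continuous_on {0..pi} y" and x: "x \<in> {0..pi}"
    and W: "((\<lambda>t. norm (q t) * W t) has_integral w) {0..x}"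
    and m: "\<And>t. t \<in> {0..pi} \<Longrightarrow> norm (y t) \<le> m * W t"
  shows "norm (integral {0..x} (\<lambda>t. q t * y t + f t)) \<le> m * w + integral {0..pi} (\<lambda>t. norm (f t))"
proof -
  have nf: "(\<lambda>t. norm (f t)) absolutely_integrable_on {0..pi}"
    using f by (rule absolutely_integrable_norm[unfolded o_def])
  have nfx: "(\<lambda>t. norm (f t)) integrable_on {0..x}"
    by (rule integrable_on_initial[OF nf]) (use x in auto)
  have i: "((\<lambda>t. m * (norm (q t) * W t) + norm (f t)) has_integral m * w + integral {0..x} (\<lambda>t. norm (f t))) {0..x}"
    by (intro has_integral_add has_integral_mult_right W integrable_integral nfx)
  have "norm (integral {0..x} (\<lambda>t. q t * y t + f t)) \<le> integral {0..x} (\<lambda>t. m * (norm (q t) * W t) + norm (f t))"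
  proof (rule integral_norm_bound_integral)
    show "(\<lambda>t. q t * y t + f t) integrable_on {0..x}"
      by (rule integrable_on_initial[OF ivp_solution_rhs[OF q f y]]) (use x in auto)
    show "(\<lambda>t. m * (norm (q t) * W t) + norm (f t)) integrable_on {0..x}" using i by blast
    fix t assume "t \<in> {0..x}"
    then have "norm (q t) * norm (y t) \<le> norm (q t) * (m * W t)"
      using m[of t] x by (intro mult_left_mono) auto
    then show "norm (q t * y t + f t) \<le> m * (norm (q t) * W t) + norm (f t)"
      by (intro order.trans[OF norm_triangle_ineq]) (simp add: norm_mult algebra_simps)
  qed
  also have "\<dots> = m * w + integral {0..x} (\<lambda>t. norm (f t))" using i by (rule integral_unique)
  also have "\<dots> \<le> m * w + integral {0..pi} (\<lambda>t. norm (f t))"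
    using x nfx integrable_on_initial[OF nf] by (intro add_left_mono integral_subset_le) auto
  finally show ?thesis .
qed

text \<open>The unknown is \<open>z = y / W\<close>, for which Bielecki's norm of \<open>y\<close>
  becomes the plain sup norm. The inner integration against \<open>|q| W\<close> gains
  \<open>1 / (2 \<pi>)\<close>, the outer one over a length at most \<pi> loses \<pi>, and the
  contraction constant is 1/2.\<close>

lemma ivp_solution_exists:
  fixes q f :: "real \<Rightarrow> complex"
  assumes q: "q absolutely_integrable_on {0..pi}" and f: "f absolutely_integrable_on {0..pi}"
  obtains y y' where "ivp_solution q f y y'" "y 0 = \<alpha>" "y' 0 = \<beta>"
proof -
  have c: "2 * pi > 0" by simp
  obtain W where W: "continuous_on {0..pi} W" "\<And>x. x \<in> {0..pi} \<Longrightarrow> 1 \<le> W x"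
    "\<And>x y. 0 \<le> x \<Longrightarrow> x \<le> y \<Longrightarrow> y \<le> pi \<Longrightarrow> W x \<le> W y"
    "\<And>x. x \<in> {0..pi} \<Longrightarrow> ((\<lambda>t. norm (q t) * W t) has_integral (W x - 1) / (2 * pi)) {0..x}"
    by (rule bielecki_weight[OF q c]) (rule that)
  define H where "H z s = integral {0..s} (\<lambda>t. q t * (W t * apply_bcontfun z t) + f t)" for z :: "real \<Rightarrow>\<^sub>C complex" and s
  define Y where "Y z x = \<alpha> + \<beta> * of_real x + integral {0..x} (H z)" for z x
  \<comment> \<open>The complete space of bounded continuous functions lives on the whole line;
    composition with this retraction onto \<open>[0,\<pi>]\<close> carries functions on the interval
    into it.\<close>
  define \<kappa> where "\<kappa> x = max 0 (min pi x)" for x :: real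
  have \<kappa>: "\<kappa> x \<in> {0..pi}" "x \<in> {0..pi} \<Longrightarrow> \<kappa> x = x" for x by (auto simp: \<kappa>_def)
  have contz: "continuous_on {0..pi} (\<lambda>t. of_real (W t) * apply_bcontfun z t)" for z :: "real \<Rightarrow>\<^sub>C complex"
    by (intro continuous_intros W(1)) (auto intro: continuous_on_subset)
  have contH: "continuous_on {0..pi} (H z)" for z
    unfolding H_def
    by (intro indefinite_integral_continuous_1 set_lebesgue_integral_eq_integral(1) ivp_solution_rhs q f contz)
  have contY: "continuous_on {0..pi} (Y z)" for z
    unfolding Y_def
    by (intro continuous_intros indefinite_integral_continuous_1 integrable_continuous_interval contH)
  have "\<exists>h :: real \<Rightarrow>\<^sub>C complex. \<forall>x. apply_bcontfun h x = Y z (\<kappa> x) / W (\<kappa> x)" for z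
  proof -
    have "continuous_on {0..pi} (\<lambda>x. Y z x / W x)"
      using W(2) by (intro continuous_intros contY W(1)) force
    then have 1: "continuous_on UNIV (\<lambda>x. Y z (\<kappa> x) / W (\<kappa> x))"
      by (rule continuous_on_compose2) (auto simp: \<kappa>_def intro!: continuous_intros)
    have "bounded ((\<lambda>x. Y z x / W x) ` {0..pi})"
      using \<open>continuous_on {0..pi} (\<lambda>x. Y z x / W x)\<close> by (intro compact_imp_bounded compact_continuous_image) auto
    then have "bounded (range (\<lambda>x. Y z (\<kappa> x) / W (\<kappa> x)))"
      by (rule bounded_subset) (use \<kappa>(1) in auto)
    with 1 have "(\<lambda>x. Y z (\<kappa> x) / W (\<kappa> x)) \<in> bcontfun"
      unfolding bcontfun_def by (intro CollectI conjI)
    then have "apply_bcontfun (Bcontfun (\<lambda>x. Y z (\<kappa> x) / W (\<kappa> x))) = (\<lambda>x. Y z (\<kappa> x) / W (\<kappa> x))"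
      by (rule Bcontfun_inverse)
    then show ?thesis
      by (intro exI allI) (rule fun_cong)
  qed
  then obtain T where T: "\<And>z x. apply_bcontfun (T z :: real \<Rightarrow>\<^sub>C complex) x = Y z (\<kappa> x) / W (\<kappa> x)"
    by metis
  have "\<exists>!z. T z = z"
  proof (rule banach_fix_type[where c = "1/2"]; (intro allI)?)
    fix z1 z2 :: "real \<Rightarrow>\<^sub>C complex"
    define D where "D = dist z1 z2"
    have D: "norm (apply_bcontfun z1 t - apply_bcontfun z2 t) \<le> D" for t
      using dist_bounded[of z1 t z2] by (simp add: D_def dist_norm)
    have "D \<ge> 0" by (simp add: D_def)
    have zero: "(\<lambda>t. 0 :: complex) absolutely_integrable_on {0..pi}" by simp
    have Hd: "norm (H z1 s - H z2 s) \<le> D * W s / (2 * pi)" if s: "s \<in> {0..pi}" for s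
    proof -
      have "H z1 s - H z2 s = integral {0..s} (\<lambda>t. (q t * (W t * apply_bcontfun z1 t) + f t) - (q t * (W t * apply_bcontfun z2 t) + f t))"
        unfolding H_def
        by (intro Henstock_Kurzweil_Integration.integral_diff[symmetric] integrable_on_initial[OF ivp_solution_rhs[OF q f contz]])
           (use s in auto)
      also have "\<dots> = integral {0..s} (\<lambda>t. q t * (W t * (apply_bcontfun z1 t - apply_bcontfun z2 t)) + 0)"
        by (simp add: algebra_simps)
      finally have "norm (H z1 s - H z2 s) = norm (integral {0..s} (\<lambda>t. q t * (W t * (apply_bcontfun z1 t - apply_bcontfun z2 t)) + 0))"
        by simp
      also have "\<dots> \<le> D * ((W s - 1) / (2 * pi)) + integral {0..pi} (\<lambda>t. norm (0 :: complex))"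
      proof (rule norm_integral_le_weight[OF q zero _ s W(4)[OF s]])
        show "continuous_on {0..pi} (\<lambda>t. of_real (W t) * (apply_bcontfun z1 t - apply_bcontfun z2 t))"
          using contz[of "z1"] contz[of z2] by (auto simp: right_diff_distrib intro: continuous_on_diff)
        fix t :: real assume "t \<in> {0..pi}"
        then show "norm (of_real (W t) * (apply_bcontfun z1 t - apply_bcontfun z2 t)) \<le> D * W t"
          using D[of t] W(2)[of t] by (simp add: norm_mult mult.commute mult_left_mono)
      qed
      also have "\<dots> \<le> D * W s / (2 * pi)"
        using \<open>D \<ge> 0\<close> by (simp add: field_simps)
      finally show ?thesis .
    qed
    show "dist (T z1) (T z2) \<le> 1 / 2 * dist z1 z2"
    proof (rule dist_bound)
      fix x0
      define x where "x = \<kappa> x0"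
      have x: "x \<in> {0..pi}" "W x > 0" using \<kappa> W(2) by (auto simp: x_def intro: less_le_trans[OF zero_less_one])
      have iH: "H z integrable_on {0..x}" for z
        using x by (intro integrable_continuous_interval continuous_on_subset[OF contH]) auto
      have "norm (Y z1 x - Y z2 x) = norm (integral {0..x} (\<lambda>s. H z1 s - H z2 s))"
        by (simp add: Y_def Henstock_Kurzweil_Integration.integral_diff iH)
      also have "\<dots> \<le> (D * W x / (2 * pi)) * (x - 0)"
      proof (rule integral_bound)
        show "continuous_on {0..x} (\<lambda>s. H z1 s - H z2 s)"
          using x by (intro continuous_intros continuous_on_subset[OF contH]) auto
        fix s assume s: "s \<in> {0..x}"
        then have "D * W s / (2 * pi) \<le> D * W x / (2 * pi)"
          using x W(3)[of s x] \<open>D \<ge> 0\<close> by (intro divide_right_mono mult_left_mono) auto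
        then show "norm (H z1 s - H z2 s) \<le> D * W x / (2 * pi)"
          using Hd[of s] s x by auto
      qed (use x in auto)
      also have "\<dots> \<le> (D * W x / (2 * pi)) * pi"
        using x \<open>D \<ge> 0\<close> by (intro mult_left_mono) auto
      also have "\<dots> = D / 2 * W x" by simp
      finally have "norm (Y z1 x - Y z2 x) / W x \<le> D / 2"
        using x by (simp add: pos_divide_le_eq)
      then have "norm ((Y z1 x - Y z2 x) / W x) \<le> D / 2"
        using x by (simp add: norm_divide)
      then show "dist (apply_bcontfun (T z1) x0) (apply_bcontfun (T z2) x0) \<le> 1 / 2 * dist z1 z2"
        by (simp add: T dist_norm D_def x_def diff_divide_distrib)
    qed
  qed auto
  then obtain z where z: "T z = z" by blast
  have Yz: "Y z x = of_real (W x) * apply_bcontfun z x" if "x \<in> {0..pi}" for x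
    using T[of z x] W(2)[OF that] \<kappa>(2)[OF that] by (simp add: z)
  define y' where "y' x = \<beta> + H z x" for x
  show thesis
  proof (rule that[of "Y z" y'])
    show "ivp_solution q f (Y z) y'"
      unfolding ivp_solution_def
    proof (intro conjI ballI)
      fix x :: real assume x: "x \<in> {0..pi}"
      have "((\<lambda>x. \<alpha> + \<beta> * of_real x + integral {0..x} (H z)) has_vector_derivative 0 + \<beta> * of_real 1 + H z x) (at x within {0..pi})"
        by (intro derivative_intros integral_has_vector_derivative contH x has_vector_derivative_mult_right has_vector_derivative_of_real)
      then show "(Y z has_vector_derivative y' x) (at x within {0..pi})"
        by (simp add: Y_def[abs_def] y'_def)
      have "H z x = integral {0..x} (\<lambda>t. q t * Y z t + f t)"
        unfolding H_def using x by (intro integral_cong) (simp add: Yz)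
      then show "y' x = y' 0 + integral {0..x} (\<lambda>t. q t * Y z t + f t)"
        by (simp add: y'_def H_def)
    qed
  qed (simp_all add: Y_def y'_def H_def)
qed

text \<open>A Gronwall bound by the same weight: at a maximum point of \<open>|y| / W\<close> the
  integral term is at most half of the left side and is absorbed.\<close>

lemma ivp_solution_bound:
  fixes q :: "real \<Rightarrow> complex"
  assumes q: "q absolutely_integrable_on {0..pi}"
  obtains K where "K > 0" "\<And>f y y' x. f absolutely_integrable_on {0..pi} \<Longrightarrow> ivp_solution q f y y' \<Longrightarrow> x \<in> {0..pi} \<Longrightarrow>
     norm (y x) \<le> K * (norm (y 0) + norm (y' 0) + integral {0..pi} (\<lambda>t. norm (f t))) \<and>
     norm (y' x) \<le> K * (norm (y 0) + norm (y' 0) + integral {0..pi} (\<lambda>t. norm (f t)))"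
proof -
  have c: "2 * pi > 0" by simp
  obtain W where W: "continuous_on {0..pi} W" "\<And>x. x \<in> {0..pi} \<Longrightarrow> 1 \<le> W x"
    "\<And>x y. 0 \<le> x \<Longrightarrow> x \<le> y \<Longrightarrow> y \<le> pi \<Longrightarrow> W x \<le> W y"
    "\<And>x. x \<in> {0..pi} \<Longrightarrow> ((\<lambda>t. norm (q t) * W t) has_integral (W x - 1) / (2 * pi)) {0..x}"
    by (rule bielecki_weight[OF q c]) (rule that)
  \<comment> \<open>The 8 is 2, from absorbing half of the left side, times 4 as a bound for \<pi>;
    \<open>W pi\<close> is the maximum of the weight.\<close>
  define K where "K = 8 * W pi"
  have Wpi: "1 \<le> W pi" using W(2) by auto
  have main: "norm (y x) \<le> K * (norm (y 0) + norm (y' 0) + integral {0..pi} (\<lambda>t. norm (f t))) \<and>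
     norm (y' x) \<le> K * (norm (y 0) + norm (y' 0) + integral {0..pi} (\<lambda>t. norm (f t)))"
    if f: "f absolutely_integrable_on {0..pi}" and y: "ivp_solution q f y y'" and x: "x \<in> {0..pi}" for f y y' x
  proof -
    define F where "F = integral {0..pi} (\<lambda>t. norm (f t))"
    have "F \<ge> 0"
      unfolding F_def using absolutely_integrable_norm[OF f, unfolded o_def]
      by (intro Henstock_Kurzweil_Integration.integral_nonneg set_lebesgue_integral_eq_integral(1)) auto
    define S where "S = norm (y 0) + norm (y' 0) + F"
    have contr: "continuous_on {0..pi} (\<lambda>x. norm (y x) / W x)"
      using W(2) by (intro continuous_intros ivp_solution_continuous[OF y] W(1)) force
    obtain x1 where x1: "x1 \<in> {0..pi}" "\<And>x. x \<in> {0..pi} \<Longrightarrow> norm (y x) / W x \<le> norm (y x1) / W x1"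
      using continuous_attains_sup[OF _ _ contr] by auto
    define m where "m = norm (y x1) / W x1"
    have m: "norm (y t) \<le> m * W t" if "t \<in> {0..pi}" for t
      using x1(2)[OF that] W(2)[OF that] by (simp add: m_def[symmetric] pos_divide_le_eq)
    have "m \<ge> 0" using W(2)[OF x1(1)] by (simp add: m_def)
    have y'b: "norm (y' s) \<le> norm (y' 0) + (m * ((W s - 1) / (2 * pi)) + F)" if s: "s \<in> {0..pi}" for s
    proof -
      have "norm (y' s) \<le> norm (y' 0) + norm (integral {0..s} (\<lambda>t. q t * y t + f t))"
        by (subst ivp_solutionD(2)[OF y s]) (rule norm_triangle_ineq)
      then show ?thesis
        using norm_integral_le_weight[OF q f ivp_solution_continuous[OF y] s W(4)[OF s] m]
        unfolding F_def by linarith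
    qed
    have yb: "norm (y s) \<le> norm (y 0) + (norm (y' 0) + (m * (W s / (2 * pi)) + F)) * pi" if s: "s \<in> {0..pi}" for s
    proof -
      have eq: "y s = y 0 + integral {0..s} y'"
        using integral_unique[OF ivp_solution_integral[OF y s]] by simp
      have "norm (integral {0..s} y') \<le> (norm (y' 0) + (m * (W s / (2 * pi)) + F)) * (s - 0)"
      proof (rule integral_bound)
        show "continuous_on {0..s} y'"
          using s by (intro continuous_on_subset[OF ivp_solution_continuous'[OF y q f]]) auto
        fix t assume t: "t \<in> {0..s}"
        then have "(W t - 1) / (2 * pi) \<le> W s / (2 * pi)"
          using s W(3)[of t s] by (intro divide_right_mono) auto
        then have "m * ((W t - 1) / (2 * pi)) \<le> m * (W s / (2 * pi))"
          using \<open>m \<ge> 0\<close> by (rule mult_left_mono)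
        then show "norm (y' t) \<le> norm (y' 0) + (m * (W s / (2 * pi)) + F)"
          using y'b[of t] t s by auto
      qed (use s in auto)
      moreover have "(norm (y' 0) + (m * (W s / (2 * pi)) + F)) * (s - 0) \<le> (norm (y' 0) + (m * (W s / (2 * pi)) + F)) * pi"
        using s \<open>m \<ge> 0\<close> \<open>F \<ge> 0\<close> W(2)[OF s] by (intro mult_left_mono add_nonneg_nonneg mult_nonneg_nonneg) auto
      moreover have "norm (y 0 + integral {0..s} y') \<le> norm (y 0) + norm (integral {0..s} y')"
        by (rule norm_triangle_ineq)
      ultimately show ?thesis unfolding eq by linarith
    qed
    have "m * W x1 = norm (y x1)" using W(2)[OF x1(1)] by (simp add: m_def)
    also have "\<dots> \<le> norm (y 0) + (norm (y' 0) + F) * pi + m * W x1 / 2"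
      using yb[OF x1(1)] by (simp add: algebra_simps)
    finally have "m * W x1 \<le> 2 * (norm (y 0) + (norm (y' 0) + F) * pi)" by simp
    moreover have "m * 1 \<le> m * W x1" using W(2)[OF x1(1)] \<open>m \<ge> 0\<close> by (intro mult_left_mono) auto
    moreover have "norm (y 0) + (norm (y' 0) + F) * pi \<le> S * 4"
    proof -
      have "(norm (y' 0) + F) * pi \<le> (norm (y' 0) + F) * 4"
        using pi_less_4 \<open>F \<ge> 0\<close> by (intro mult_left_mono) auto
      then show ?thesis
        unfolding S_def distrib_right using norm_ge_zero[of "y 0"] by linarith
    qed
    ultimately have mS: "m \<le> 8 * S" by simp
    have "S \<ge> 0" using \<open>F \<ge> 0\<close> by (simp add: S_def)
    have "W x \<le> W pi" using W(3)[of x pi] x by auto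
    have "norm (y x) \<le> m * W x" using m x by blast
    also have "\<dots> \<le> (8 * S) * W pi"
      using mS \<open>W x \<le> W pi\<close> \<open>S \<ge> 0\<close> W(2)[OF x] by (intro mult_mono) auto
    finally have 1: "norm (y x) \<le> K * S" by (simp add: K_def algebra_simps)
    have "(W x - 1) / (2 * pi) \<le> (W x - 1) / 1"
      using W(2)[OF x] pi_gt3 by (intro divide_left_mono) auto
    then have "m * ((W x - 1) / (2 * pi)) \<le> (8 * S) * (W x - 1)"
      using mS \<open>S \<ge> 0\<close> W(2)[OF x] by (intro mult_mono) auto
    then have "norm (y' x) \<le> norm (y' 0) + F + 8 * S * (W x - 1)" using y'b[OF x] by simp
    also have "\<dots> \<le> 8 * S + 8 * S * (W x - 1)" using \<open>S \<ge> 0\<close> \<open>F \<ge> 0\<close> by (simp add: S_def)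
    also have "\<dots> = 8 * S * W x" by (simp add: algebra_simps)
    also have "\<dots> \<le> 8 * S * W pi" using \<open>W x \<le> W pi\<close> \<open>S \<ge> 0\<close> by (intro mult_left_mono) auto
    finally show ?thesis using 1 by (simp add: K_def S_def F_def algebra_simps)
  qed
  show thesis
    by (rule that[of K]) (use main Wpi in \<open>auto simp: K_def\<close>)
qed

section \<open>The spaces \<open>L\<^sup>p\<close>\<close>

lemma sets_interval_lebesgue [simp]: "{0..pi} \<in> sets lebesgue"
  by simp

lemma Lp_iff:
  assumes "p > 0"
  shows "f \<in> Lp (ereal p) \<longleftrightarrow> f \<in> borel_measurable (lebesgue_on {0..pi}) \<and>
           integrable (lebesgue_on {0..pi}) (\<lambda>x. norm (f x) powr p)"
proof (cases "f \<in> borel_measurable (lebesgue_on {0..pi})")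
  case True
  note [measurable] = True
  show ?thesis
    using True by (auto simp: Lp_def lp_norm_def Let_def integrable_iff_bounded less_top)
qed (simp add: Lp_def)

lemma lp_norm_eq:
  assumes "p > 0" "f \<in> Lp (ereal p)"
  shows "lp_norm (ereal p) f = ennreal ((1 / pi * integral {0..pi} (\<lambda>x. norm (f x) powr p)) powr (1 / p))"
proof -
  have i: "integrable (lebesgue_on {0..pi}) (\<lambda>x. norm (f x) powr p)"
    using assms Lp_iff by blast
  have "(\<integral>\<^sup>+x. ennreal (norm (f x) powr p) \<partial>lebesgue_on {0..pi}) = ennreal (integral {0..pi} (\<lambda>x. norm (f x) powr p))"
    using nn_integral_eq_integral[OF i] lebesgue_integral_eq_integral[OF i] by simp
  moreover have "0 \<le> integral {0..pi} (\<lambda>x. norm (f x) powr p)"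
    by (rule Henstock_Kurzweil_Integration.integral_nonneg)
      (use integrable_on_lebesgue_on[OF i] in auto)
  ultimately show ?thesis
    by (simp add: lp_norm_def Let_def)
qed

lemma absolutely_integrable_onI_Lp:
  assumes "1 \<le> p" "f \<in> Lp (ereal p)"
  shows "f absolutely_integrable_on {0..pi}"
proof (rule measurable_bounded_by_integrable_imp_absolutely_integrable)
  have f: "f \<in> borel_measurable (lebesgue_on {0..pi})" "integrable (lebesgue_on {0..pi}) (\<lambda>x. norm (f x) powr p)"
    using assms Lp_iff[of p f] by auto
  show "f \<in> borel_measurable (lebesgue_on {0..pi})" by (fact f)
  show "(\<lambda>x. norm (f x) powr p + 1) integrable_on {0..pi}"
    using integrable_on_lebesgue_on[OF f(2)] by (intro integrable_add integrable_const_ivl) auto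
  show "norm (f x) \<le> norm (f x) powr p + 1" for x
  proof (cases "norm (f x) \<le> 1")
    case False
    then have "norm (f x) powr 1 \<le> norm (f x) powr p" using assms by (intro powr_mono) auto
    then show ?thesis using False by simp
  qed (simp add: add_increasing)
qed auto

text \<open>The normalised measure gives a constant function its own value as norm, so no factor
  depending on \<open>b\<close> appears.\<close>

lemma lp_norm_le_bound:
  assumes [measurable]: "f \<in> borel_measurable (lebesgue_on {0..pi})" and K: "0 \<le> K"
    and b: "1 \<le> b" and f: "\<And>x. x \<in> {0..pi} \<Longrightarrow> norm (f x) \<le> K"
  shows "f \<in> Lp b" "lp_norm b f \<le> ennreal K"
proof -
  show le: "lp_norm b f \<le> ennreal K"
  proof (cases "b = \<infinity>")
    case True
    have "esssup (lebesgue_on {0..pi}) (\<lambda>x. ennreal (norm (f x))) \<le> ennreal K"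
      using f by (intro esssup_I) (auto intro!: AE_I2 ennreal_leI)
    then show ?thesis by (simp add: lp_norm_def True)
  next
    case False
    then obtain p where p: "b = ereal p" "1 \<le> p" using b by (cases b) auto
    have fin: "finite_measure (lebesgue_on {0..pi})" by (intro finite_measure_lebesgue_on) simp
    have i: "integrable (lebesgue_on {0..pi}) (\<lambda>x. norm (f x) powr p)"
      by (rule finite_measure.integrable_const_bound[OF fin, of _ "K powr p"])
         (use f p in \<open>auto intro!: AE_I2 powr_mono2\<close>)
    then have Lp: "f \<in> Lp (ereal p)" using p Lp_iff[of p f] by simp
    have ii: "(\<lambda>x. norm (f x) powr p) integrable_on {0..pi}"
      using integrable_on_lebesgue_on[OF i] by auto
    have "integral {0..pi} (\<lambda>x. norm (f x) powr p) \<le> integral {0..pi} (\<lambda>x. K powr p)"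
      using f p by (intro integral_le ii integrable_const_ivl powr_mono2) auto
    then have "1 / pi * integral {0..pi} (\<lambda>x. norm (f x) powr p) \<le> K powr p"
      by (simp add: field_simps)
    moreover have "0 \<le> integral {0..pi} (\<lambda>x. norm (f x) powr p)"
      using ii by (intro Henstock_Kurzweil_Integration.integral_nonneg) auto
    ultimately have "(1 / pi * integral {0..pi} (\<lambda>x. norm (f x) powr p)) powr (1 / p) \<le> (K powr p) powr (1 / p)"
      using p by (intro powr_mono2) auto
    also have "\<dots> = K" using p K by (simp add: powr_powr)
    finally show ?thesis using p lp_norm_eq[of p f] Lp by (simp add: ennreal_leI)
  qed
  then show "f \<in> Lp b"
    using assms(1) le_less_trans[OF le ennreal_less_top] by (simp add: Lp_def)
qed

lemma Lp_continuous:
  assumes "continuous_on {0..pi} f" "1 \<le> b"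
  shows "f \<in> Lp b"
proof -
  obtain K where "K > 0" "\<And>x. x \<in> {0..pi} \<Longrightarrow> norm (f x) \<le> K"
    using compact_imp_bounded[OF compact_continuous_image[OF assms(1)]] unfolding bounded_pos by auto
  then show ?thesis
    using assms by (intro lp_norm_le_bound(1)[where K = K] continuous_imp_measurable_on_sets_lebesgue) auto
qed

lemma Lp2_iff: "f \<in> Lp 2 \<longleftrightarrow> f \<in> borel_measurable (lebesgue_on {0..pi}) \<and>
           integrable (lebesgue_on {0..pi}) (\<lambda>x. norm (f x) ^ 2)"
proof -
  have "(\<lambda>x. norm (f x) powr 2) = (\<lambda>x. norm (f x) ^ 2)"
    by (auto simp: powr_numeral)
  then show ?thesis using Lp_iff[of 2 f] by simp
qed

lemma Lp2_diff:
  assumes "f \<in> Lp 2" "g \<in> Lp 2"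
  shows "(\<lambda>x. f x - g x) \<in> Lp 2"
proof -
  have [measurable]: "f \<in> borel_measurable (lebesgue_on {0..pi})" "g \<in> borel_measurable (lebesgue_on {0..pi})"
    using assms Lp2_iff by auto
  have "integrable (lebesgue_on {0..pi}) (\<lambda>x. norm (f x - g x) ^ 2)"
  proof (rule Bochner_Integration.integrable_bound)
    show "integrable (lebesgue_on {0..pi}) (\<lambda>x. 2 * norm (f x) ^ 2 + 2 * norm (g x) ^ 2)"
      using assms Lp2_iff by auto
    have "norm (f x - g x) ^ 2 \<le> 2 * norm (f x) ^ 2 + 2 * norm (g x) ^ 2" for x
    proof -
      have "norm (f x - g x) ^ 2 \<le> (norm (f x) + norm (g x)) ^ 2"
        by (intro power_mono norm_triangle_ineq4) auto
      also have "\<dots> \<le> 2 * norm (f x) ^ 2 + 2 * norm (g x) ^ 2"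
        using zero_le_power2[of "norm (f x) - norm (g x)"] by (simp add: power2_eq_square algebra_simps)
      finally show ?thesis .
    qed
    then show "AE x in lebesgue_on {0..pi}. norm (norm (f x - g x) ^ 2) \<le> norm (2 * norm (f x) ^ 2 + 2 * norm (g x) ^ 2)"
      by (intro AE_I2) simp
  qed measurable
  then show ?thesis using Lp2_iff by simp
qed

lemma Lp2_absolutely_integrable: "f \<in> Lp 2 \<Longrightarrow> f absolutely_integrable_on {0..pi}"
  using absolutely_integrable_onI_Lp[of 2 f] by simp

section \<open>The boundary value problem\<close>

definition hill_bvp ::
    "boundary_condition \<Rightarrow> (real \<Rightarrow> complex) \<Rightarrow> (real \<Rightarrow> complex) \<Rightarrow> (real \<Rightarrow> complex) \<Rightarrow> bool" where
  "hill_bvp bc q f y \<longleftrightarrow> (\<exists>y'. ivp_solution q f y y' \<and> satisfies_bc bc y y')"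

lemma hill_bvp_continuous: "hill_bvp bc q f y \<Longrightarrow> continuous_on {0..pi} y"
  unfolding hill_bvp_def using ivp_solution_continuous by blast

text \<open>The equation sees \<open>q\<close> and \<open>f\<close> only through
  \<open>q y + f\<close> on the interval. Terms can therefore move between the potential and the
  right-hand side, which is the source of the resolvent identity and of the perturbation by
  \<open>v\<close>.\<close>

lemma hill_bvp_cong_imp:
  assumes "hill_bvp bc q f y" "\<And>x. x \<in> {0..pi} \<Longrightarrow> q x * y x + f x = p x * z x + g x" 
    "\<And>x. x \<in> {0..pi} \<Longrightarrow> y x = z x"
  shows "hill_bvp bc p g z"
proof -
  obtain y' where y': "ivp_solution q f y y'" "satisfies_bc bc y y'"
    using assms(1) unfolding hill_bvp_def by blast
  have "ivp_solution p g z y'"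
    unfolding ivp_solution_def
  proof (intro conjI ballI)
    fix x :: real assume x: "x \<in> {0..pi}"
    show "(z has_vector_derivative y' x) (at x within {0..pi})"
      by (rule has_vector_derivative_transform[OF x _ ivp_solutionD(1)[OF y'(1) x]]) (simp add: assms(3))
    show "y' x = y' 0 + integral {0..x} (\<lambda>t. p t * z t + g t)"
    proof -
      have "integral {0..x} (\<lambda>t. q t * y t + f t) = integral {0..x} (\<lambda>t. p t * z t + g t)"
        by (rule integral_cong, rule assms(2)) (use x in auto)
      then show ?thesis using ivp_solutionD(2)[OF y'(1) x] by (rule subst)
    qed
  qed
  moreover have "satisfies_bc bc z y'"
    using y'(2) assms(3)[of 0] assms(3)[of pi] by (cases bc) auto
  ultimately show ?thesis unfolding hill_bvp_def by blast
qed

lemma satisfies_bc_linear: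
  "satisfies_bc bc y y' \<Longrightarrow> satisfies_bc bc z z' \<Longrightarrow>
     satisfies_bc bc (\<lambda>t. y t + c * z t) (\<lambda>t. y' t + c * z' t)"
  by (cases bc) (auto simp: algebra_simps)

lemma hill_bvp_linear:
  assumes "hill_bvp bc q f y" "hill_bvp bc q g z" "q absolutely_integrable_on {0..pi}"
    "f absolutely_integrable_on {0..pi}" "g absolutely_integrable_on {0..pi}"
  shows "hill_bvp bc q (\<lambda>t. f t + c * g t) (\<lambda>t. y t + c * z t)"
  using assms ivp_solution_linear satisfies_bc_linear unfolding hill_bvp_def by blast

lemma ivp_solution_regularity:
  assumes y: "ivp_solution q f y y'" and q: "q absolutely_integrable_on {0..pi}" and fa: "f absolutely_integrable_on {0..pi}"
  obtains N where "negligible N"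
    "\<And>x. x \<in> {0..pi} - N \<Longrightarrow> (y' has_vector_derivative q x * y x + f x) (at x within {0..pi})"
    "abs_continuous_on 0 pi y" "abs_continuous_on 0 pi y'"
proof -
  note yc = ivp_solution_continuous[OF y]
  define h where "h t = q t * y t + f t" for t
  have h: "h absolutely_integrable_on {0..pi}"
    unfolding h_def by (rule ivp_solution_rhs[OF q fa yc])
  have y'h: "y' x = y' 0 + integral {0..x} h" if "x \<in> {0..pi}" for x
    using ivp_solutionD(2)[OF y that] by (simp add: h_def[abs_def])
  obtain N where N: "negligible N" "\<And>x. x \<in> {0..pi} - N \<Longrightarrow>
      ((\<lambda>x. y' 0 + integral {0..x} h) has_vector_derivative h x) (at x within {0..pi})"
    by (rule integral_has_vector_derivative_ae[OF set_lebesgue_integral_eq_integral(1)[OF h], of "y' 0"]) (rule that)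
  have N': "(y' has_vector_derivative h x) (at x within {0..pi})" if "x \<in> {0..pi} - N" for x
    by (rule has_vector_derivative_transform[OF _ y'h N(2)[OF that]]) (use that in auto)
  have ac': "abs_continuous_on 0 pi y'"
  proof (rule abs_continuous_on_dominated[where L = 1])
    fix r s :: real assume "r \<in> {0..pi}" "s \<in> {0..pi}"
    from y'h[OF this(1)] y'h[OF this(2)]
    show "norm (y' r - y' s) \<le> 1 * (norm (y' 0 + integral {0..r} h - (y' 0 + integral {0..s} h))
        + norm (y' 0 + integral {0..r} h - (y' 0 + integral {0..s} h)))"
      by simp
  qed (rule abs_continuous_on_integral[OF h])+
  have y'c: "y' absolutely_integrable_on {0..pi}"
    by (rule absolutely_integrable_continuous_real[OF ivp_solution_continuous'[OF y q fa]])
  have yi: "y x = y 0 + integral {0..x} y'" if "x \<in> {0..pi}" for x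
    using integral_unique[OF ivp_solution_integral[OF y that]] by simp
  have ac: "abs_continuous_on 0 pi y"
  proof (rule abs_continuous_on_dominated[where L = 1])
    fix r s :: real assume "r \<in> {0..pi}" "s \<in> {0..pi}"
    from yi[OF this(1)] yi[OF this(2)]
    show "norm (y r - y s) \<le> 1 * (norm (y 0 + integral {0..r} y' - (y 0 + integral {0..s} y'))
        + norm (y 0 + integral {0..r} y' - (y 0 + integral {0..s} y')))"
      by simp
  qed (rule abs_continuous_on_integral[OF y'c])+
  show thesis
    by (rule that[OF N(1) _ ac ac']) (use N' in \<open>simp add: h_def\<close>)
qed

text \<open>From the almost-everywhere equation to the integrated one by the fundamental theorem for
  absolutely continuous functions, and back by Lebesgue differentiation. Since \<open>y\<close> is
  continuous, \<open>\<mu> y - f\<close> lies in \<open>L^2\<close> together with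
  \<open>f\<close>.\<close>

lemma hill_graph_iff:
  assumes v: "v absolutely_integrable_on {0..pi}" and f: "f \<in> Lp 2"
  shows "hill_graph bc v y (\<lambda>x. \<mu> * y x - f x) \<longleftrightarrow> hill_bvp bc (\<lambda>x. v x - \<mu>) f y"
proof
  assume "hill_graph bc v y (\<lambda>x. \<mu> * y x - f x)"
  then obtain y' y'' where y: "\<And>x. x\<in>{0..pi} \<Longrightarrow> (y has_vector_derivative y' x) (at x within {0..pi})"
    "abs_continuous_on 0 pi y'" "satisfies_bc bc y y'"
    "AE x in lebesgue_on {0..pi}.
           (y' has_vector_derivative y'' x) (at x within {0..pi}) \<and> - y'' x + v x * y x = \<mu> * y x - f x"
    unfolding hill_graph_def by blast
  obtain N where N: "negligible N" "\<And>x. x \<in> {0..pi} - N \<Longrightarrow>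
      (y' has_vector_derivative y'' x) (at x within {0..pi}) \<and> - y'' x + v x * y x = \<mu> * y x - f x"
    using y(4) by (subst (asm) AE_lebesgue_on_iff_negligible) auto
  have "ivp_solution (\<lambda>x. v x - \<mu>) f y y'"
    unfolding ivp_solution_def
  proof (intro conjI ballI y(1))
    fix x :: real assume x: "x \<in> {0..pi}"
    have ac: "abs_continuous_on 0 x y'"
      using y(2) x unfolding abs_continuous_on_def by (meson atLeastAtMost_iff atLeastatMost_subset_iff order.refl order.trans)
    have "((\<lambda>t. (v t - \<mu>) * y t + f t) has_integral (y' x - y' 0)) {0..x}"
    proof (rule has_integral_abs_continuous[OF _ ac N(1)])
      fix t assume t: "t \<in> {0..x} - N"
      then have t': "(y' has_vector_derivative y'' t) (at t within {0..pi})" "- y'' t + v t * y t = \<mu> * y t - f t"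
        using N(2)[of t] x by auto
      from t'(2) have "y'' t = (v t - \<mu>) * y t + f t"
        by (simp add: algebra_simps)
      then show "(y' has_vector_derivative (v t - \<mu>) * y t + f t) (at t within {0..x})"
        using t'(1) x by (metis atLeastAtMost_iff atLeastatMost_subset_iff has_vector_derivative_within_subset order.refl)
    qed (use x in auto)
    then show "y' x = y' 0 + integral {0..x} (\<lambda>t. (v t - \<mu>) * y t + f t)"
      by (simp add: integral_unique)
  qed
  then show "hill_bvp bc (\<lambda>x. v x - \<mu>) f y" using y(3) unfolding hill_bvp_def by blast
next
  assume "hill_bvp bc (\<lambda>x. v x - \<mu>) f y"
  then obtain y' where y: "ivp_solution (\<lambda>x. v x - \<mu>) f y y'" "satisfies_bc bc y y'"
    unfolding hill_bvp_def by blast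
  have fa: "f absolutely_integrable_on {0..pi}" using f by (rule Lp2_absolutely_integrable)
  have q: "(\<lambda>x. v x - \<mu>) absolutely_integrable_on {0..pi}"
    using v by (intro set_integral_diff(1)) auto
  note yc = ivp_solution_continuous[OF y(1)]
  obtain N where N: "negligible N"
    "\<And>x. x \<in> {0..pi} - N \<Longrightarrow> (y' has_vector_derivative (v x - \<mu>) * y x + f x) (at x within {0..pi})"
    and ac: "abs_continuous_on 0 pi y" and ac': "abs_continuous_on 0 pi y'"
    by (rule ivp_solution_regularity[OF y(1) q fa]) (rule that)
  have g: "(\<lambda>x. \<mu> * y x - f x) \<in> Lp 2"
    by (rule Lp2_diff[OF Lp_continuous f]) (auto intro!: continuous_intros yc)
  have "AE x in lebesgue_on {0..pi}.
      (y' has_vector_derivative (v x - \<mu>) * y x + f x) (at x within {0..pi}) \<and>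
      - ((v x - \<mu>) * y x + f x) + v x * y x = \<mu> * y x - f x"
    unfolding AE_lebesgue_on_iff_negligible[OF sets_interval_lebesgue]
  proof (intro exI[of _ N] conjI ballI)
    show "negligible N" by (rule N(1))
    fix x assume "x \<in> {0..pi} - N"
    then show "(y' has_vector_derivative (v x - \<mu>) * y x + f x) (at x within {0..pi})"
      by (rule N(2))
    show "- ((v x - \<mu>) * y x + f x) + v x * y x = \<mu> * y x - f x"
      by (simp only: algebra_simps) simp
  qed
  then show "hill_graph bc v y (\<lambda>x. \<mu> * y x - f x)"
    unfolding hill_graph_def
    by (intro conjI exI[of _ y'] exI[of _ "\<lambda>x. (v x - \<mu>) * y x + f x"] g ac ac' y(2))
      (blast intro: ivp_solutionD(1)[OF y(1)])+
qed

section \<open>Boundary values as two linear functionals, and solvability\<close>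

fun bc1 :: "boundary_condition \<Rightarrow> (real \<Rightarrow> complex) \<Rightarrow> (real \<Rightarrow> complex) \<Rightarrow> complex" where
  "bc1 Per_plus y y' = y pi - y 0"
| "bc1 Per_minus y y' = y pi + y 0"
| "bc1 Dir y y' = y 0"

fun bc2 :: "boundary_condition \<Rightarrow> (real \<Rightarrow> complex) \<Rightarrow> (real \<Rightarrow> complex) \<Rightarrow> complex" where
  "bc2 Per_plus y y' = y' pi - y' 0"
| "bc2 Per_minus y y' = y' pi + y' 0"
| "bc2 Dir y y' = y pi"

lemma satisfies_bc_iff: "satisfies_bc bc y y' \<longleftrightarrow> bc1 bc y y' = 0 \<and> bc2 bc y y' = 0"
  by (cases bc; simp add: eq_neg_iff_add_eq_0)

lemma bc12_linear:
  "bc1 bc (\<lambda>t. y t + c * z t) (\<lambda>t. y' t + c * z' t) = bc1 bc y y' + c * bc1 bc z z'"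
  "bc2 bc (\<lambda>t. y t + c * z t) (\<lambda>t. y' t + c * z' t) = bc2 bc y y' + c * bc2 bc z z'"
  by (cases bc; simp add: algebra_simps)+

lemma norm_bc12_le:
  assumes "\<And>x. x \<in> {0..pi} \<Longrightarrow> norm (y x) \<le> B" "\<And>x. x \<in> {0..pi} \<Longrightarrow> norm (y' x) \<le> B"
  shows "norm (bc1 bc y y') \<le> 2 * B" "norm (bc2 bc y y') \<le> 2 * B"
proof -
  have "norm (y 0) \<le> B" "norm (y pi) \<le> B" "norm (y' 0) \<le> B" "norm (y' pi) \<le> B"
    using assms by auto
  moreover from this(1) have "0 \<le> B" using norm_ge_zero order.trans by blast
  ultimately show "norm (bc1 bc y y') \<le> 2 * B" "norm (bc2 bc y y') \<le> 2 * B"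
    using norm_triangle_ineq[of "y pi" "y 0"] norm_triangle_ineq4[of "y pi" "y 0"]
      norm_triangle_ineq[of "y' pi" "y' 0"] norm_triangle_ineq4[of "y' pi" "y' 0"]
    by (cases bc; simp)+
qed

text \<open>The right-hand side ranges over all of \<open>L^1\<close>, which lets the solution
  operator act on every \<open>L^a\<close>. The Lipschitz clause later makes contour integrals of
  solutions continuous in \<open>x\<close>.\<close>

definition solvable_with :: "boundary_condition \<Rightarrow> (real \<Rightarrow> complex) \<Rightarrow> real \<Rightarrow> bool" where
  "solvable_with bc q M \<longleftrightarrow> (\<forall>f. f absolutely_integrable_on {0..pi} \<longrightarrow> (\<exists>y. hill_bvp bc q f y \<and>
     (\<forall>x\<in>{0..pi}. norm (y x) \<le> M * integral {0..pi} (\<lambda>t. norm (f t))) \<and>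
     (\<forall>x\<in>{0..pi}. \<forall>x'\<in>{0..pi}. norm (y x - y x') \<le> M * integral {0..pi} (\<lambda>t. norm (f t)) * \<bar>x - x'\<bar>)))"

text \<open>The Fredholm alternative: the homogeneous solutions form a two-dimensional space, on which the
  boundary conditions are a \<open>2 \<times> 2\<close> linear system.\<close>

lemma hill_bvp_solvable:
  fixes q :: "real \<Rightarrow> complex"
  assumes q: "q absolutely_integrable_on {0..pi}"
    and triv: "\<And>y x. hill_bvp bc q (\<lambda>_. 0) y \<Longrightarrow> x \<in> {0..pi} \<Longrightarrow> y x = 0"
  obtains M where "M > 0" "solvable_with bc q M"
proof -
  obtain K where K: "K > 0" "\<And>f y y' x. f absolutely_integrable_on {0..pi} \<Longrightarrow> ivp_solution q f y y' \<Longrightarrow> x \<in> {0..pi} \<Longrightarrow>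
     norm (y x) \<le> K * (norm (y 0) + norm (y' 0) + integral {0..pi} (\<lambda>t. norm (f t))) \<and>
     norm (y' x) \<le> K * (norm (y 0) + norm (y' 0) + integral {0..pi} (\<lambda>t. norm (f t)))"
    by (rule ivp_solution_bound[OF q]) (rule that)
  have z: "(\<lambda>t. 0 :: complex) absolutely_integrable_on {0..pi}" by simp
  obtain u1 u1' where u1: "ivp_solution q (\<lambda>t. 0) u1 u1'" "u1 0 = 1" "u1' 0 = 0"
    by (rule ivp_solution_exists[OF q z, of 1 0])
  obtain u2 u2' where u2: "ivp_solution q (\<lambda>t. 0) u2 u2'" "u2 0 = 0" "u2' 0 = 1"
    by (rule ivp_solution_exists[OF q z, of 0 1])
  define a b c d where "a = bc1 bc u1 u1'" and "b = bc1 bc u2 u2'" and "c = bc2 bc u1 u1'" and "d = bc2 bc u2 u2'"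
  define D where "D = a * d - b * c"
  have D: "D \<noteq> 0"
  proof
    assume "D = 0"
    \<comment> \<open>A singular boundary matrix has a nonzero kernel vector, and the corresponding
      combination of \<open>u1\<close> and \<open>u2\<close> solves the homogeneous problem, hence
      vanishes by \<open>triv\<close>.\<close>
    have "\<exists>\<alpha> \<beta>. (\<alpha> \<noteq> 0 \<or> \<beta> \<noteq> 0) \<and> \<alpha> * a + \<beta> * b = 0 \<and> \<alpha> * c + \<beta> * d = 0"
    proof (cases "a = 0 \<and> b = 0")
      case True
      show ?thesis
      proof (cases "c = 0 \<and> d = 0")
        case False
        with True show ?thesis by (intro exI[of _ d] exI[of _ "- c"]) auto
      qed (use True in auto)
    next
      case False
      then show ?thesis
        using \<open>D = 0\<close> unfolding D_def by (intro exI[of _ b] exI[of _ "- a"]) (auto simp: algebra_simps)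
    qed
    then obtain \<alpha> \<beta> where ab: "\<alpha> \<noteq> 0 \<or> \<beta> \<noteq> 0" "\<alpha> * a + \<beta> * b = 0" "\<alpha> * c + \<beta> * d = 0" by blast
    define y y' where "y t = (0 + \<alpha> * u1 t) + \<beta> * u2 t" and "y' t = (0 + \<alpha> * u1' t) + \<beta> * u2' t" for t
    have zz: "ivp_solution q (\<lambda>t. 0) (\<lambda>t. 0) (\<lambda>t. 0)" by (simp add: ivp_solution_def)
    have y: "ivp_solution q (\<lambda>t. (0 + \<alpha> * 0) + \<beta> * 0) y y'"
      unfolding y_def y'_def by (intro ivp_solution_linear zz u1 u2 q) (simp_all add: z)
    have "bc1 bc y y' = 0" "bc2 bc y y' = 0"
      using ab unfolding y_def y'_def bc12_linear a_def b_def c_def d_def by (cases bc; simp)+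
    then have "hill_bvp bc q (\<lambda>_. 0) y"
      using y unfolding hill_bvp_def satisfies_bc_iff by auto
    then have y0: "y x = 0" if "x \<in> {0..pi}" for x using triv that by blast
    then have "y 0 = 0" by simp
    then have "\<alpha> = 0" by (simp add: y_def u1 u2)
    \<comment> \<open>The first coefficient is the value at 0; the second is the derivative at 0,
      which vanishes because \<open>y\<close> is zero on the interval.\<close>
    have "(y has_vector_derivative y' 0) (at 0 within {0..pi})"
      using ivp_solutionD(1)[OF y, of 0] by simp
    then have "((\<lambda>x. 0) has_vector_derivative y' 0) (at 0 within {0..pi})"
      by (rule has_vector_derivative_transform[rotated 2]) (use y0 in auto)
    then have "y' 0 = 0"
      using vector_derivative_unique_within_closed_interval[of 0 pi 0 "\<lambda>x. 0" "y' 0" 0] by simp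
    then have "\<beta> = 0" by (simp add: y'_def u1 u2)
    with \<open>\<alpha> = 0\<close> ab show False by simp
  qed
  define S where "S = (norm a + norm b + norm c + norm d) / norm D"
  have "S \<ge> 0" by (simp add: S_def)
  define M where "M = K * (4 * K * S + 1)"
  have "M > 0" using K(1) \<open>S \<ge> 0\<close> unfolding M_def by (intro mult_pos_pos add_nonneg_pos mult_nonneg_nonneg) auto
  moreover have "\<exists>y. hill_bvp bc q f y \<and>
     (\<forall>x\<in>{0..pi}. norm (y x) \<le> M * integral {0..pi} (\<lambda>t. norm (f t))) \<and>
     (\<forall>x\<in>{0..pi}. \<forall>x'\<in>{0..pi}. norm (y x - y x') \<le> M * integral {0..pi} (\<lambda>t. norm (f t)) * \<bar>x - x'\<bar>)"
    if f: "f absolutely_integrable_on {0..pi}" for f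
  proof -
    define F where "F = integral {0..pi} (\<lambda>t. norm (f t))"
    have "F \<ge> 0"
      unfolding F_def using absolutely_integrable_norm[OF f, unfolded o_def]
      by (intro Henstock_Kurzweil_Integration.integral_nonneg set_lebesgue_integral_eq_integral(1)) auto
    obtain u u' where u: "ivp_solution q f u u'" "u 0 = 0" "u' 0 = 0"
      by (rule ivp_solution_exists[OF q f, of 0 0])
    define g1 g2 where "g1 = bc1 bc u u'" and "g2 = bc2 bc u u'"
    have g: "norm g1 \<le> 2 * (K * F)" "norm g2 \<le> 2 * (K * F)"
      unfolding g1_def g2_def using K(2)[OF f u(1)] u by (intro norm_bc12_le; simp add: F_def)+
    \<comment> \<open>Cramer's rule for the combination of \<open>u1\<close> and \<open>u2\<close>
      that cancels the boundary values \<open>g1\<close>, \<open>g2\<close> of the solution with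
      zero initial data.\<close>
    define \<alpha> \<beta> where "\<alpha> = (b * g2 - d * g1) / D" and "\<beta> = (c * g1 - a * g2) / D"
    have nd: "norm (x * s - y * r) \<le> (norm x + norm y) * (2 * (K * F))"
      if "norm s \<le> 2 * (K * F)" "norm r \<le> 2 * (K * F)" for x y s r :: complex
    proof -
      have "norm (x * s - y * r) \<le> norm x * norm s + norm y * norm r"
        by (metis norm_mult norm_triangle_ineq4)
      also have "\<dots> \<le> norm x * (2 * (K * F)) + norm y * (2 * (K * F))"
        using that by (intro add_mono mult_left_mono) auto
      finally show ?thesis by (simp add: algebra_simps)
    qed
    have "norm \<alpha> + norm \<beta> \<le> ((norm b + norm d) * (2 * (K * F)) + (norm c + norm a) * (2 * (K * F))) / norm D"
      unfolding \<alpha>_def \<beta>_def norm_divide add_divide_distrib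
      using g by (intro add_mono divide_right_mono nd) auto
    also have "\<dots> = S * (2 * (K * F))" by (simp add: S_def field_simps)
    also have "\<dots> \<le> S * (4 * (K * F))"
      using \<open>S \<ge> 0\<close> K(1) \<open>F \<ge> 0\<close> by (intro mult_left_mono) auto
    finally have ab: "norm \<alpha> + norm \<beta> \<le> S * (4 * (K * F))" .
    define y y' where "y t = (u t + \<alpha> * u1 t) + \<beta> * u2 t" and "y' t = (u' t + \<alpha> * u1' t) + \<beta> * u2' t" for t
    have "ivp_solution q (\<lambda>t. (f t + \<alpha> * 0) + \<beta> * 0) y y'"
      unfolding y_def y'_def by (intro ivp_solution_linear u u1 u2 q f) (simp_all add: z f)
    then have y: "ivp_solution q f y y'" by simp
    have "bc1 bc y y' = 0" "bc2 bc y y' = 0"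
      unfolding y_def y'_def bc12_linear 
      unfolding g1_def[symmetric] g2_def[symmetric] a_def[symmetric] b_def[symmetric] c_def[symmetric] d_def[symmetric] \<alpha>_def \<beta>_def
      using D by (simp_all add: field_simps) (simp_all add: D_def algebra_simps)
    then have bvp: "hill_bvp bc q f y"
      using y unfolding hill_bvp_def satisfies_bc_iff by blast
    have "K * (norm (y 0) + norm (y' 0) + F) \<le> K * (S * (4 * (K * F)) + F)"
      using ab K(1) by (intro mult_left_mono) (auto simp: y_def y'_def u u1 u2)
    also have "\<dots> = M * F" by (simp add: M_def algebra_simps)
    finally have KM: "K * (norm (y 0) + norm (y' 0) + F) \<le> M * F" .
    have b: "norm (y x) \<le> M * F" "norm (y' x) \<le> M * F" if "x \<in> {0..pi}" for x
      using K(2)[OF f y that] KM by (auto simp: F_def)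
    have lip: "norm (y x - y x') \<le> M * F * \<bar>x - x'\<bar>" if "x \<in> {0..pi}" "x' \<in> {0..pi}" for x x'
    proof -
      have "norm (y x - y x') \<le> (M * F) * norm (x - x')"
      proof (rule differentiable_bound[OF _ _ _ that])
        fix t :: real assume t: "t \<in> {0..pi}"
        show "(y has_derivative (\<lambda>h. h *\<^sub>R y' t)) (at t within {0..pi})"
          using ivp_solutionD(1)[OF y t] by (simp add: has_vector_derivative_def)
        show "onorm (\<lambda>h. h *\<^sub>R y' t) \<le> M * F"
          using b(2)[OF t] \<open>M > 0\<close> \<open>F \<ge> 0\<close> by (intro onorm_bound) (auto simp: mult.commute mult_left_mono)
      qed simp
      then show ?thesis by simp
    qed
    show ?thesis using bvp b(1) lip unfolding F_def by blast
  qed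
  ultimately show thesis using that unfolding solvable_with_def by blast
qed

section \<open>The \<open>L^1\<close> norm on the interval, without normalisation\<close>

abbreviation L1_norm :: "(real \<Rightarrow> complex) \<Rightarrow> real" where
  "L1_norm f \<equiv> integral {0..pi} (\<lambda>t. norm (f t))"

lemma integrable_on_norm:
  fixes f :: "real \<Rightarrow> complex"
  assumes "f absolutely_integrable_on {0..pi}"
  shows "(\<lambda>t. norm (f t)) integrable_on {0..pi}"
  using assms by (simp add: absolutely_integrable_on_def)

lemma L1_norm_nonneg: "f absolutely_integrable_on {0..pi} \<Longrightarrow> 0 \<le> L1_norm f"
  by (rule Henstock_Kurzweil_Integration.integral_nonneg) (auto intro: integrable_on_norm)

lemma L1_norm_le_bound:
  assumes "continuous_on {0..pi} y" "\<And>x. x \<in> {0..pi} \<Longrightarrow> norm (y x) \<le> B"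
  shows "L1_norm y \<le> pi * B"
proof -
  have "L1_norm y \<le> integral {0..pi} (\<lambda>t. B)"
    using assms by (intro integral_le integrable_continuous_interval continuous_intros) auto
  then show ?thesis by simp
qed

lemma L1_norm_linear_le:
  assumes "f absolutely_integrable_on {0..pi}" "g absolutely_integrable_on {0..pi}"
  shows "L1_norm (\<lambda>t. f t + c * g t) \<le> L1_norm f + norm c * L1_norm g"
proof -
  have cg: "(\<lambda>t. c * g t) absolutely_integrable_on {0..pi}"
    using assms(2) by simp
  have "L1_norm (\<lambda>t. f t + c * g t) \<le> integral {0..pi} (\<lambda>t. norm (f t) + norm c * norm (g t))"
  proof (rule integral_le)
    show "(\<lambda>t. norm (f t + c * g t)) integrable_on {0..pi}"
      by (rule integrable_on_norm[OF set_integral_add(1)[OF assms(1) cg]])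
    show "(\<lambda>t. norm (f t) + norm c * norm (g t)) integrable_on {0..pi}"
      by (intro integrable_add integrable_on_mult_right integrable_on_norm assms)
  qed (metis norm_mult norm_triangle_ineq)
  also have "\<dots> = L1_norm f + integral {0..pi} (\<lambda>t. norm c * norm (g t))"
    by (intro Henstock_Kurzweil_Integration.integral_add integrable_on_mult_right integrable_on_norm assms)
  finally show ?thesis by simp
qed

section \<open>The resolvent\<close>

text \<open>The resolvent at \<open>\<mu>\<close> is the case \<open>q = v - \<mu>\<close>; here the right-hand side is only required to be in \<open>L\<^sup>1\<close>.\<close>

definition hill_sol ::
    "boundary_condition \<Rightarrow> (real \<Rightarrow> complex) \<Rightarrow> complex \<Rightarrow> (real \<Rightarrow> complex) \<Rightarrow> real \<Rightarrow> complex" where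
  "hill_sol bc v \<mu> f = (THE y. hill_bvp bc (\<lambda>x. v x - \<mu>) f y \<and> (\<forall>x. x \<notin> {0..pi} \<longrightarrow> y x = 0))"

lemma hill_resolvent_eq_hill_sol:
  assumes "v absolutely_integrable_on {0..pi}" "f \<in> Lp 2"
  shows "hill_resolvent bc v \<mu> f = hill_sol bc v \<mu> f"
  unfolding hill_resolvent_def hill_sol_def hill_graph_iff[OF assms] ..

lemma hill_eigenvalue_iff:
  assumes "v absolutely_integrable_on {0..pi}"
  shows "hill_eigenvalue bc v \<mu> \<longleftrightarrow> (\<exists>y. hill_bvp bc (\<lambda>x. v x - \<mu>) (\<lambda>_. 0) y \<and> (\<exists>x\<in>{0..pi}. y x \<noteq> 0))"
proof -
  have "(\<lambda>_. 0) \<in> Lp 2" by (rule Lp_continuous) auto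
  from hill_graph_iff[OF assms this] show ?thesis
    unfolding hill_eigenvalue_def by simp
qed

lemma solvable_with_mono:
  assumes "solvable_with bc q M" "M \<le> M'"
  shows "solvable_with bc q M'"
  unfolding solvable_with_def
proof (intro allI impI)
  fix f :: "real \<Rightarrow> complex" assume f: "f absolutely_integrable_on {0..pi}"
  then obtain y where y: "hill_bvp bc q f y" "\<forall>x\<in>{0..pi}. norm (y x) \<le> M * L1_norm f"
    "\<forall>x\<in>{0..pi}. \<forall>x'\<in>{0..pi}. norm (y x - y x') \<le> M * L1_norm f * \<bar>x - x'\<bar>"
    using assms(1) unfolding solvable_with_def by blast
  have le: "M * L1_norm f \<le> M' * L1_norm f"
    using assms(2) L1_norm_nonneg[OF f] by (rule mult_right_mono)
  then have "M * L1_norm f * \<bar>x - x'\<bar> \<le> M' * L1_norm f * \<bar>x - x'\<bar>" for x x' :: real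
    by (rule mult_right_mono) simp
  then have "\<forall>x\<in>{0..pi}. \<forall>x'\<in>{0..pi}. norm (y x - y x') \<le> M' * L1_norm f * \<bar>x - x'\<bar>"
    using y(3) order.trans by blast
  moreover have "\<forall>x\<in>{0..pi}. norm (y x) \<le> M' * L1_norm f"
    using y(2) le order.trans by blast
  ultimately show "\<exists>y. hill_bvp bc q f y \<and> (\<forall>x\<in>{0..pi}. norm (y x) \<le> M' * L1_norm f) \<and>
      (\<forall>x\<in>{0..pi}. \<forall>x'\<in>{0..pi}. norm (y x - y x') \<le> M' * L1_norm f * \<bar>x - x'\<bar>)"
    using y(1) by blast
qed

section \<open>The solution operator as a function of the spectral parameter\<close>

locale hill_potential =
  fixes bc :: boundary_condition and v :: "real \<Rightarrow> complex"
  assumes v: "v absolutely_integrable_on {0..pi}"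
begin

abbreviation "regular \<mu> \<equiv> \<not> hill_eigenvalue bc v \<mu>"
abbreviation "R \<equiv> hill_sol bc v"
abbreviation "q \<mu> \<equiv> (\<lambda>x. v x - \<mu>)"

lemma q: "q \<mu> absolutely_integrable_on {0..pi}"
  using v by (intro set_integral_diff(1)) auto

lemma bvp_unique:
  assumes "regular \<mu>" "hill_bvp bc (q \<mu>) f y" "hill_bvp bc (q \<mu>) f z" "f absolutely_integrable_on {0..pi}" "x \<in> {0..pi}"
  shows "y x = z x"
proof -
  have "hill_bvp bc (q \<mu>) (\<lambda>t. f t + (- 1) * f t) (\<lambda>t. y t + (- 1) * z t)"
    by (rule hill_bvp_linear[OF assms(2,3) q assms(4,4)])
  then have "hill_bvp bc (q \<mu>) (\<lambda>_. 0) (\<lambda>t. y t - z t)" by simp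
  then have "y x - z x = 0"
    using assms(1,5) unfolding hill_eigenvalue_iff[OF v] by blast
  then show ?thesis by simp
qed

lemma regular_solvable:
  assumes "regular \<mu>"
  obtains M where "M > 0" "solvable_with bc (q \<mu>) M"
proof (rule hill_bvp_solvable[OF q])
  fix y x assume "hill_bvp bc (q \<mu>) (\<lambda>_. 0) y" "x \<in> {0..pi}"
  then show "y x = 0" using assms unfolding hill_eigenvalue_iff[OF v] by blast
qed (use that in blast)

lemma ex1:
  assumes "regular \<mu>" "f absolutely_integrable_on {0..pi}"
  shows "\<exists>!y. hill_bvp bc (q \<mu>) f y \<and> (\<forall>x. x \<notin> {0..pi} \<longrightarrow> y x = 0)"
proof -
  obtain M where "solvable_with bc (q \<mu>) M" by (rule regular_solvable[OF assms(1)])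
  then obtain y where y: "hill_bvp bc (q \<mu>) f y" using assms(2) unfolding solvable_with_def by blast
  have y': "hill_bvp bc (q \<mu>) f (\<lambda>x. if x \<in> {0..pi} then y x else 0)"
    by (rule hill_bvp_cong_imp[OF y]) auto
  show ?thesis
  proof (rule ex1I)
    show "hill_bvp bc (q \<mu>) f (\<lambda>x. if x \<in> {0..pi} then y x else 0) \<and> (\<forall>x. x \<notin> {0..pi} \<longrightarrow> (if x \<in> {0..pi} then y x else 0) = 0)"
      using y' by simp
    fix z assume z: "hill_bvp bc (q \<mu>) f z \<and> (\<forall>x. x \<notin> {0..pi} \<longrightarrow> z x = 0)"
    show "z = (\<lambda>x. if x \<in> {0..pi} then y x else 0)"
    proof
      fix x
      show "z x = (if x \<in> {0..pi} then y x else 0)"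
        using bvp_unique[OF assms(1) conjunct1[OF z] y assms(2), of x] z by auto
    qed
  qed
qed

lemma R:
  assumes "regular \<mu>" "f absolutely_integrable_on {0..pi}"
  shows R_bvp: "hill_bvp bc (q \<mu>) f (R \<mu> f)" and R_outside: "x \<notin> {0..pi} \<Longrightarrow> R \<mu> f x = 0"
  using theI'[OF ex1[OF assms]] unfolding hill_sol_def by blast+

lemma R_unique:
  assumes "regular \<mu>" "f absolutely_integrable_on {0..pi}" "hill_bvp bc (q \<mu>) f y" "x \<in> {0..pi}"
  shows "y x = R \<mu> f x"
  using bvp_unique[OF assms(1,3) R_bvp[OF assms(1,2)] assms(2,4)] .

lemma R_continuous: "regular \<mu> \<Longrightarrow> f absolutely_integrable_on {0..pi} \<Longrightarrow> continuous_on {0..pi} (R \<mu> f)"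
  using R_bvp hill_bvp_continuous by blast

lemma R_integrable: "regular \<mu> \<Longrightarrow> f absolutely_integrable_on {0..pi} \<Longrightarrow> R \<mu> f absolutely_integrable_on {0..pi}"
  using R_continuous absolutely_integrable_continuous_real by blast

lemma R_linear:
  assumes "regular \<mu>" "f absolutely_integrable_on {0..pi}" "g absolutely_integrable_on {0..pi}"
  shows "R \<mu> (\<lambda>t. f t + c * g t) x = R \<mu> f x + c * R \<mu> g x"
proof -
  have fg: "(\<lambda>t. f t + c * g t) absolutely_integrable_on {0..pi}"
    using assms by (intro set_integral_add(1)) auto
  show ?thesis
  proof (cases "x \<in> {0..pi}")
    case True
    then show ?thesis
      using R_unique[OF assms(1) fg hill_bvp_linear[OF R_bvp R_bvp q, OF assms(1,2) assms(1,3) assms(2,3)] True] by simp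
  next
    case False
    then show ?thesis using assms fg R_outside by simp
  qed
qed

lemma R_bound:
  assumes "regular \<mu>" "solvable_with bc (q \<mu>) M" "f absolutely_integrable_on {0..pi}"
  shows "x \<in> {0..pi} \<Longrightarrow> norm (R \<mu> f x) \<le> M * L1_norm f"
    and "x \<in> {0..pi} \<Longrightarrow> x' \<in> {0..pi} \<Longrightarrow> norm (R \<mu> f x - R \<mu> f x') \<le> M * L1_norm f * \<bar>x - x'\<bar>"
proof -
  obtain y where y: "hill_bvp bc (q \<mu>) f y" "\<forall>x\<in>{0..pi}. norm (y x) \<le> M * L1_norm f"
    "\<forall>x\<in>{0..pi}. \<forall>x'\<in>{0..pi}. norm (y x - y x') \<le> M * L1_norm f * \<bar>x - x'\<bar>"
    using assms(2,3) unfolding solvable_with_def by blast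
  have "y x = R \<mu> f x" if "x \<in> {0..pi}" for x by (rule R_unique[OF assms(1,3) y(1) that])
  with y show "x \<in> {0..pi} \<Longrightarrow> norm (R \<mu> f x) \<le> M * L1_norm f"
    and "x \<in> {0..pi} \<Longrightarrow> x' \<in> {0..pi} \<Longrightarrow> norm (R \<mu> f x - R \<mu> f x') \<le> M * L1_norm f * \<bar>x - x'\<bar>"
    by auto
qed

lemma bvp_shift:
  assumes "hill_bvp bc (q \<mu>) f y"
  shows "hill_bvp bc (q \<nu>) (\<lambda>t. f t + (\<nu> - \<mu>) * y t) y"
  by (rule hill_bvp_cong_imp[OF assms]) (simp_all add: algebra_simps)

text \<open>A solution at \<mu> solves the problem at \<nu> once \<open>(\<nu> - \<mu>) y\<close> is
  moved to the right-hand side.\<close>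

lemma resolvent_identity:
  assumes "regular \<mu>" "regular \<nu>" "f absolutely_integrable_on {0..pi}"
  shows "R \<mu> f x = R \<nu> f x + (\<nu> - \<mu>) * R \<nu> (R \<mu> f) x"
proof (cases "x \<in> {0..pi}")
  case True
  have i: "(\<lambda>t. f t + (\<nu> - \<mu>) * R \<mu> f t) absolutely_integrable_on {0..pi}"
    using assms R_integrable by (intro set_integral_add(1)) auto
  have "R \<mu> f x = R \<nu> (\<lambda>t. f t + (\<nu> - \<mu>) * R \<mu> f t) x"
    by (rule R_unique[OF assms(2) i bvp_shift[OF R_bvp[OF assms(1,3)]] True])
  then show ?thesis using R_linear[OF assms(2,3) R_integrable[OF assms(1,3)]] by simp
next
  case False
  then show ?thesis using assms R_outside R_integrable by simp
qed

text \<open>Read as a solution at \<nu> with right-hand side \<open>f + (\<nu> - \<mu>) y\<close>,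
  the function \<open>y\<close> satisfies a bound whose second term is at most half of its own
  maximum. With \<open>f = 0\<close> this also excludes eigenvalues near \<nu>.\<close>

lemma bvp_near_bound:
  assumes \<nu>: "regular \<nu>" and M: "solvable_with bc (q \<nu>) M" "M > 0" and near: "norm (\<mu> - \<nu>) * M * pi \<le> 1 / 2"
    and y: "hill_bvp bc (q \<mu>) f y" and f: "f absolutely_integrable_on {0..pi}"
  shows "x \<in> {0..pi} \<Longrightarrow> norm (y x) \<le> 2 * M * L1_norm f"
    and "x \<in> {0..pi} \<Longrightarrow> x' \<in> {0..pi} \<Longrightarrow> norm (y x - y x') \<le> 2 * M * L1_norm f * \<bar>x - x'\<bar>"
proof -
  define g where "g t = f t + (\<nu> - \<mu>) * y t" for t
  have yc: "continuous_on {0..pi} y" using y by (rule hill_bvp_continuous)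
  have yi: "y absolutely_integrable_on {0..pi}" using absolutely_integrable_continuous_real[OF yc] .
  have gi: "g absolutely_integrable_on {0..pi}"
    unfolding g_def using f yi by (intro set_integral_add(1)) auto
  have yR: "y x = R \<nu> g x" if "x \<in> {0..pi}" for x
    using R_unique[OF \<nu> gi _ that] bvp_shift[OF y] by (simp add: g_def[abs_def])
  have "continuous_on {0..pi} (\<lambda>x. norm (y x))" by (intro continuous_intros yc)
  then obtain x1 where x1: "x1 \<in> {0..pi}" "\<And>x. x \<in> {0..pi} \<Longrightarrow> norm (y x) \<le> norm (y x1)"
    using continuous_attains_sup[of "{0..pi}" "\<lambda>x. norm (y x)"] by auto
  have "L1_norm g \<le> L1_norm f + norm (\<nu> - \<mu>) * L1_norm y"
    unfolding g_def by (rule L1_norm_linear_le[OF f yi])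
  also have "\<dots> \<le> L1_norm f + norm (\<mu> - \<nu>) * (pi * norm (y x1))"
    using L1_norm_le_bound[OF yc x1(2)] by (simp add: norm_minus_commute mult_left_mono)
  finally have g1: "L1_norm g \<le> L1_norm f + norm (\<mu> - \<nu>) * (pi * norm (y x1))" .
  have "norm (y x1) \<le> M * L1_norm g"
    using R_bound(1)[OF \<nu> M(1) gi x1(1)] yR[OF x1(1)] by simp
  also have "\<dots> \<le> M * (L1_norm f + norm (\<mu> - \<nu>) * (pi * norm (y x1)))"
    using g1 M(2) by (intro mult_left_mono) auto
  also have "\<dots> = M * L1_norm f + (norm (\<mu> - \<nu>) * M * pi) * norm (y x1)" by (simp add: algebra_simps)
  also have "\<dots> \<le> M * L1_norm f + 1 / 2 * norm (y x1)"
    using near by (intro add_left_mono mult_right_mono) auto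
  finally have b: "norm (y x1) \<le> 2 * M * L1_norm f" by simp
  show "x \<in> {0..pi} \<Longrightarrow> norm (y x) \<le> 2 * M * L1_norm f"
    using x1(2)[of x] b by simp
  have "norm (\<mu> - \<nu>) * (pi * norm (y x1)) \<le> norm (\<mu> - \<nu>) * (pi * (2 * M * L1_norm f))"
    using b by (intro mult_left_mono) auto
  also have "\<dots> = (norm (\<mu> - \<nu>) * M * pi) * (2 * L1_norm f)" by (simp add: algebra_simps)
  also have "\<dots> \<le> 1 / 2 * (2 * L1_norm f)"
    using near L1_norm_nonneg[OF f] by (intro mult_right_mono) auto
  finally have "L1_norm g \<le> 2 * L1_norm f" using g1 by simp
  then have "M * L1_norm g * \<bar>x - x'\<bar> \<le> M * (2 * L1_norm f) * \<bar>x - x'\<bar>"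
    using M(2) by (intro mult_left_mono mult_right_mono) auto
  then show "x \<in> {0..pi} \<Longrightarrow> x' \<in> {0..pi} \<Longrightarrow> norm (y x - y x') \<le> 2 * M * L1_norm f * \<bar>x - x'\<bar>"
    using R_bound(2)[OF \<nu> M(1) gi, of x x'] yR by (simp add: mult_ac)
qed

lemma regular_near:
  assumes \<nu>: "regular \<nu>" and M: "solvable_with bc (q \<nu>) M" "M > 0" and near: "norm (\<mu> - \<nu>) * M * pi \<le> 1 / 2"
  shows "regular \<mu>" "solvable_with bc (q \<mu>) (2 * M)"
proof -
  show \<mu>: "regular \<mu>"
  proof (rule ccontr)
    assume "\<not> regular \<mu>"
    then obtain y x where y: "hill_bvp bc (q \<mu>) (\<lambda>_. 0) y" "x \<in> {0..pi}" "y x \<noteq> 0"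
      using hill_eigenvalue_iff[OF v] by blast
    have "norm (y x) \<le> 2 * M * L1_norm (\<lambda>_. 0)"
      by (rule bvp_near_bound(1)[OF assms y(1) _ y(2)]) simp
    then show False using y(3) by simp
  qed
  show "solvable_with bc (q \<mu>) (2 * M)"
    unfolding solvable_with_def
  proof (intro allI impI exI conjI ballI)
    fix f :: "real \<Rightarrow> complex" assume f: "f absolutely_integrable_on {0..pi}"
    show "hill_bvp bc (q \<mu>) f (R \<mu> f)" by (rule R_bvp[OF \<mu> f])
    show "norm (R \<mu> f x) \<le> 2 * M * L1_norm f" if "x \<in> {0..pi}" for x
      by (rule bvp_near_bound(1)[OF assms R_bvp[OF \<mu> f] f that])
    show "norm (R \<mu> f x - R \<mu> f x') \<le> 2 * M * L1_norm f * \<bar>x - x'\<bar>" if "x \<in> {0..pi}" "x' \<in> {0..pi}" for x x'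
      by (rule bvp_near_bound(2)[OF assms R_bvp[OF \<mu> f] f that])
  qed
qed

lemma regular_ball:
  assumes "regular \<nu>"
  obtains r M where "r > 0" "M > 0" "\<And>\<mu>. \<mu> \<in> ball \<nu> r \<Longrightarrow> regular \<mu> \<and> solvable_with bc (q \<mu>) M"
proof -
  obtain M where M: "M > 0" "solvable_with bc (q \<nu>) M" by (rule regular_solvable[OF assms])
  \<comment> \<open>The largest radius for which the perturbation absorbs at most half; the factor
    \<pi> comes from bounding an \<open>L^1\<close> norm by the sup norm.\<close>
  define r where "r = 1 / (2 * M * pi)"
  have "r > 0" using M by (simp add: r_def)
  have "regular \<mu> \<and> solvable_with bc (q \<mu>) (2 * M)" if "\<mu> \<in> ball \<nu> r" for \<mu>
  proof -
    have "norm (\<mu> - \<nu>) \<le> r" using that by (simp add: dist_norm norm_minus_commute)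
    then have "norm (\<mu> - \<nu>) * M * pi \<le> r * M * pi" using M by (intro mult_right_mono) auto
    also have "\<dots> = 1 / 2" using M by (simp add: r_def)
    finally show ?thesis using regular_near[OF assms M(2,1)] by blast
  qed
  then show thesis using \<open>r > 0\<close> M that[of r "2 * M"] by simp
qed

lemma open_regular: "open {\<mu>. regular \<mu>}"
  unfolding open_contains_ball using regular_ball by (metis mem_Collect_eq subsetI)

lemma solvable_compact:
  assumes "compact K" "\<And>\<mu>. \<mu> \<in> K \<Longrightarrow> regular \<mu>"
  obtains M where "M > 0" "\<And>\<mu>. \<mu> \<in> K \<Longrightarrow> solvable_with bc (q \<mu>) M"
proof -
  have "\<exists>r M. r > 0 \<and> M > 0 \<and> (\<forall>\<mu>\<in>ball \<nu> r. solvable_with bc (q \<mu>) M)" if "\<nu> \<in> K" for \<nu>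
    using regular_ball[OF assms(2)[OF that]] by metis
  then obtain r M where rM: "\<And>\<nu>. \<nu> \<in> K \<Longrightarrow> r \<nu> > 0" "\<And>\<nu>. \<nu> \<in> K \<Longrightarrow> M \<nu> > 0"
    "\<And>\<nu> \<mu>. \<nu> \<in> K \<Longrightarrow> \<mu> \<in> ball \<nu> (r \<nu>) \<Longrightarrow> solvable_with bc (q \<mu>) (M \<nu>)"
    by metis
  have "K \<subseteq> (\<Union>\<nu>\<in>K. ball \<nu> (r \<nu>))" using rM(1) by force
  then obtain T where T: "T \<subseteq> K" "finite T" "K \<subseteq> (\<Union>\<nu>\<in>T. ball \<nu> (r \<nu>))"
    using compactE_image[OF assms(1), of K "\<lambda>\<nu>. ball \<nu> (r \<nu>)"] by auto
  \<comment> \<open>The sum dominates each of the finitely many local bounds, and the 1 keeps it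
    positive when \<open>K\<close> is empty.\<close>
  define B where "B = 1 + (\<Sum>\<nu>\<in>T. M \<nu>)"
  have sn: "0 \<le> (\<Sum>\<nu>\<in>T. M \<nu>)" using T rM(2) by (intro sum_nonneg) (auto intro: less_imp_le)
  have "solvable_with bc (q \<mu>) B" if \<mu>: "\<mu> \<in> K" for \<mu>
  proof -
    obtain \<nu> where \<nu>: "\<nu> \<in> T" "\<mu> \<in> ball \<nu> (r \<nu>)" using T \<mu> by blast
    have "M \<nu> \<le> (\<Sum>\<nu>\<in>T. M \<nu>)"
      using \<nu> T rM(2) by (intro member_le_sum) (auto intro: less_imp_le)
    then show ?thesis
      using solvable_with_mono[OF rM(3)[OF _ \<nu>(2)], of B] \<nu> T by (auto simp: B_def)
  qed
  then show thesis using that[of B] sn by (auto simp: B_def)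
qed

lemma R_lipschitz_parameter:
  assumes "regular \<mu>" "regular \<nu>" "solvable_with bc (q \<mu>) M" "solvable_with bc (q \<nu>) M" "M > 0"
    "f absolutely_integrable_on {0..pi}" "x \<in> {0..pi}"
  shows "norm (R \<mu> f x - R \<nu> f x) \<le> norm (\<mu> - \<nu>) * (M ^ 2 * pi * L1_norm f)"
proof -
  have "norm (R \<mu> f x - R \<nu> f x) = norm (\<mu> - \<nu>) * norm (R \<nu> (R \<mu> f) x)"
    by (subst resolvent_identity[OF assms(1,2,6)]) (simp add: norm_mult norm_minus_commute)
  also have "\<dots> \<le> norm (\<mu> - \<nu>) * (M * L1_norm (R \<mu> f))"
    using assms R_integrable by (intro mult_left_mono R_bound(1)) auto
  also have "\<dots> \<le> norm (\<mu> - \<nu>) * (M * (pi * (M * L1_norm f)))"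
    using assms R_continuous R_bound(1)[OF assms(1,3,6)]
    by (intro mult_left_mono L1_norm_le_bound) auto
  finally show ?thesis by (simp add: power2_eq_square mult_ac)
qed

text \<open>By the resolvent identity the difference quotient is
  \<open>- R \<nu> (R \<mu> f)\<close>, which differs from \<open>- R \<nu> (R \<nu> f)\<close> by
  at most a multiple of \<open>|\<mu> - \<nu>|\<close>. Fixing \<open>x\<close> makes this a
  statement about scalar functions, ready for Cauchy's theorem.\<close>

lemma R_holomorphic:
  assumes f: "f absolutely_integrable_on {0..pi}" and x: "x \<in> {0..pi}"
  shows "(\<lambda>\<mu>. R \<mu> f x) holomorphic_on {\<mu>. regular \<mu>}"
  unfolding holomorphic_on_open[OF open_regular]
proof (intro ballI, clarify)
  fix \<nu> assume \<nu>: "regular \<nu>"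
  obtain r M where rM: "r > 0" "M > 0" "\<And>\<mu>. \<mu> \<in> ball \<nu> r \<Longrightarrow> regular \<mu> \<and> solvable_with bc (q \<mu>) M"
    using regular_ball[OF \<nu>] by blast
  have \<nu>M: "solvable_with bc (q \<nu>) M" using rM by simp
  note Rf = R_integrable[OF _ f]
  define C where "C = M * (pi * (M ^ 2 * pi * L1_norm f))"
  have lim: "((\<lambda>\<mu>. norm (\<mu> - \<nu>) * C) \<longlongrightarrow> 0) (at \<nu>)"
    by (rule tendsto_eq_intros refl | simp)+
  have "((\<lambda>\<mu>. (R \<mu> f x - R \<nu> f x) / (\<mu> - \<nu>)) \<longlongrightarrow> - R \<nu> (R \<nu> f) x) (at \<nu>)"
  proof (rule LIM_zero_cancel, rule Lim_null_comparison)
    show "((\<lambda>\<mu>. norm (\<mu> - \<nu>) * C) \<longlongrightarrow> 0) (at \<nu>)" by (rule lim)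
    have "\<forall>\<^sub>F \<mu> in at \<nu>. \<mu> \<in> ball \<nu> r - {\<nu>}"
      using rM(1) by (intro eventually_at_in_open) auto
    then show "\<forall>\<^sub>F \<mu> in at \<nu>. norm ((R \<mu> f x - R \<nu> f x) / (\<mu> - \<nu>) - - R \<nu> (R \<nu> f) x) \<le> norm (\<mu> - \<nu>) * C"
    proof eventually_elim
      case (elim \<mu>)
      then have \<mu>: "regular \<mu>" "solvable_with bc (q \<mu>) M" "\<mu> \<noteq> \<nu>" using rM(3) by auto
      have "(R \<mu> f x - R \<nu> f x) / (\<mu> - \<nu>) - - R \<nu> (R \<nu> f) x = R \<nu> (R \<nu> f) x + (- 1) * R \<nu> (R \<mu> f) x"
        using \<mu>(3) by (subst resolvent_identity[OF \<mu>(1) \<nu> f]) (simp add: field_simps)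
      also have "\<dots> = R \<nu> (\<lambda>t. R \<nu> f t + (- 1) * R \<mu> f t) x"
        by (rule R_linear[OF \<nu> Rf[OF \<nu>] Rf[OF \<mu>(1)], symmetric])
      finally have eq: "(R \<mu> f x - R \<nu> f x) / (\<mu> - \<nu>) - - R \<nu> (R \<nu> f) x = R \<nu> (\<lambda>t. R \<nu> f t + (- 1) * R \<mu> f t) x" .
      have c: "continuous_on {0..pi} (\<lambda>t. R \<nu> f t + (- 1) * R \<mu> f t)"
        by (intro continuous_intros R_continuous \<nu> \<mu> f)
      have "norm (R \<nu> (\<lambda>t. R \<nu> f t + (- 1) * R \<mu> f t) x) \<le> M * L1_norm (\<lambda>t. R \<nu> f t + (- 1) * R \<mu> f t)"
        by (rule R_bound(1)[OF \<nu> \<nu>M absolutely_integrable_continuous_real[OF c] x])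
      also have "\<dots> \<le> M * (pi * (norm (\<mu> - \<nu>) * (M ^ 2 * pi * L1_norm f)))"
        using rM(2) R_lipschitz_parameter[OF \<mu>(1) \<nu> \<mu>(2) \<nu>M rM(2) f]
        by (intro mult_left_mono L1_norm_le_bound c) (auto simp: norm_minus_commute)
      finally show ?case unfolding eq by (simp add: C_def mult_ac)
    qed
  qed
  then show "\<exists>f'. ((\<lambda>\<mu>. R \<mu> f x) has_field_derivative f') (at \<nu>)"
    unfolding has_field_derivative_iff by blast
qed

end

section \<open>Operator-valued contour integrals\<close>

lemma lp_norm_leD:
  assumes p: "p > 0" and [measurable]: "f \<in> borel_measurable (lebesgue_on {0..pi})"
    and le: "lp_norm (ereal p) f \<le> ennreal c" and c: "0 \<le> c"
  shows "f \<in> Lp (ereal p)" "integral {0..pi} (\<lambda>x. norm (f x) powr p) \<le> pi * c powr p"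
proof -
  show f: "f \<in> Lp (ereal p)"
    using assms(2) le_less_trans[OF le ennreal_less_top] by (simp add: Lp_def)
  define J where "J = integral {0..pi} (\<lambda>x. norm (f x) powr p)"
  have i: "integrable (lebesgue_on {0..pi}) (\<lambda>x. norm (f x) powr p)"
    using f unfolding Lp_iff[OF p] by (rule conjunct2)
  have "0 \<le> J"
    unfolding J_def using integrable_on_lebesgue_on[OF i]
    by (intro Henstock_Kurzweil_Integration.integral_nonneg) auto
  have "(1 / pi * J) powr (1 / p) \<le> c"
    using le c unfolding lp_norm_eq[OF p f] J_def[symmetric] by simp
  then have "((1 / pi * J) powr (1 / p)) powr p \<le> c powr p"
    using p by (intro powr_mono2) auto
  then have "1 / pi * J \<le> c powr p"
    using p \<open>0 \<le> J\<close> by (simp add: powr_powr)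
  then show "J \<le> pi * c powr p" by (simp add: field_simps)
qed

lemma lp_norm_finite: "f \<in> Lp p \<Longrightarrow> lp_norm p f = ennreal (enn2real (lp_norm p f))"
  by (simp add: Lp_def)

lemma weighted_am_gm:
  fixes a b \<alpha> :: real
  assumes "0 \<le> a" "0 \<le> b" "0 \<le> \<alpha>" "0 \<le> \<beta>" "\<alpha> + \<beta> = 1"
  shows "a powr \<alpha> * b powr \<beta> \<le> \<alpha> * a + \<beta> * b"
proof (cases "a = 0 \<or> b = 0")
  case True
  then show ?thesis using assms by auto
next
  case False
  then show ?thesis using assms by (intro Youngs_inequality_0) auto
qed

text \<open>Jensen's inequality by way of means: \<open>|f| / K\<close> is the geometric mean of
  \<open>|f|^p / K^p\<close> and 1 with weights \<open>1/p\<close> and \<open>1 - 1/p\<close>, and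
  both of these have integral at most \<pi>.\<close>

lemma L1_norm_le_of_Lp:
  assumes p: "1 \<le> p" and f: "f \<in> Lp (ereal p)" and K: "K > 0"
    and le: "integral {0..pi} (\<lambda>x. norm (f x) powr p) \<le> pi * K powr p"
  shows "L1_norm f \<le> pi * K"
proof -
  have i: "(\<lambda>x. norm (f x) powr p) integrable_on {0..pi}"
    using integrable_on_lebesgue_on[of "{0..pi}"] f p Lp_iff[of p f] by auto
  have pt: "norm (f x) \<le> K * (1 / p * (norm (f x) powr p / K powr p) + (1 - 1 / p))" for x
  proof -
    have "(norm (f x) powr p / K powr p) powr (1 / p) * 1 powr (1 - 1 / p)
        \<le> 1 / p * (norm (f x) powr p / K powr p) + (1 - 1 / p) * 1"
      using p by (intro weighted_am_gm) auto
    moreover have "(norm (f x) powr p / K powr p) powr (1 / p) = norm (f x) / K"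
      using p K by (simp add: powr_divide powr_powr)
    ultimately show ?thesis using K by (simp add: pos_divide_le_eq mult.commute)
  qed
  have "L1_norm f \<le> integral {0..pi} (\<lambda>x. K * (1 / p * (norm (f x) powr p / K powr p) + (1 - 1 / p)))"
    using i pt absolutely_integrable_onI_Lp[OF p f]
    by (intro integral_le integrable_on_mult_right integrable_add integrable_on_divide integrable_const_ivl integrable_on_norm) auto
  also have "\<dots> = K * (1 / p * (integral {0..pi} (\<lambda>x. norm (f x) powr p) / K powr p) + (1 - 1 / p) * pi)"
    using i by (subst Henstock_Kurzweil_Integration.integral_mult_right,
        subst Henstock_Kurzweil_Integration.integral_add)
      (auto intro!: integrable_on_mult_right integrable_on_divide)
  also have "\<dots> \<le> K * (1 / p * pi + (1 - 1 / p) * pi)"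
    using le p K by (intro mult_left_mono add_right_mono) (auto simp: pos_divide_le_eq)
  also have "\<dots> = pi * K" by (simp add: algebra_simps)
  finally show ?thesis .
qed

text \<open>The scaling above divides by a positive number, so the norm, possibly zero, is
  approached from above.\<close>

lemma L1_norm_le_lp_norm:
  assumes p: "1 \<le> p" and f: "f \<in> Lp (ereal p)"
  shows "L1_norm f \<le> pi * enn2real (lp_norm (ereal p) f)"
proof (rule field_le_epsilon)
  define n where "n = enn2real (lp_norm (ereal p) f)"
  have n: "n \<ge> 0" by (simp add: n_def)
  fix e :: real assume "e > 0"
  then have ne: "n + e / pi > 0" using n by (intro add_nonneg_pos) auto
  have "f \<in> borel_measurable (lebesgue_on {0..pi})" using f by (simp add: Lp_def)
  moreover have "lp_norm (ereal p) f \<le> ennreal (n + e / pi)"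
    by (subst lp_norm_finite[OF f], rule ennreal_leI) (use \<open>e > 0\<close> in \<open>simp add: n_def\<close>)
  ultimately have "integral {0..pi} (\<lambda>x. norm (f x) powr p) \<le> pi * (n + e / pi) powr p"
    using p ne by (intro lp_norm_leD(2)) auto
  then have "L1_norm f \<le> pi * (n + e / pi)"
    by (rule L1_norm_le_of_Lp[OF p f ne])
  then show "L1_norm f \<le> pi * enn2real (lp_norm (ereal p) f) + e"
    by (simp add: n_def algebra_simps)
qed

text \<open>Asking for two-sided derivatives at inner points, off a finite set, makes the property
  stable under joining paths; one-sided behaviour at the end points is left out.\<close>

definition bounded_speed :: "(real \<Rightarrow> complex) \<Rightarrow> bool" where
  "bounded_speed g \<longleftrightarrow> (\<exists>B>0. \<exists>S. finite S \<and> (\<forall>t\<in>{0<..<1} - S. \<exists>d. (g has_vector_derivative d) (at t) \<and> norm d \<le> B))"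

lemma bounded_speed_linepath: "bounded_speed (linepath a b)"
  unfolding bounded_speed_def
  by (rule exI[of _ "norm (b - a) + 1"])
    (auto intro!: exI[of _ "{}"] exI[of _ "b - a"] has_vector_derivative_linepath_within add_nonneg_pos)

lemma bounded_speed_join:
  assumes "bounded_speed g" "bounded_speed h"
  shows "bounded_speed (g +++ h)"
proof -
  obtain B1 S1 where 1: "B1 > 0" "finite S1" "\<And>t. t\<in>{0<..<1} - S1 \<Longrightarrow> \<exists>d. (g has_vector_derivative d) (at t) \<and> norm d \<le> B1"
    using assms(1) unfolding bounded_speed_def by blast
  obtain B2 S2 where 2: "B2 > 0" "finite S2" "\<And>t. t\<in>{0<..<1} - S2 \<Longrightarrow> \<exists>d. (h has_vector_derivative d) (at t) \<and> norm d \<le> B2"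
    using assms(2) unfolding bounded_speed_def by blast
  \<comment> \<open>Exceptional points of the joined path are those of its halves after rescaling,
    together with the junction 1/2.\<close>
  define S where "S = insert (1/2) ((\<lambda>t. t / 2) ` S1 \<union> (\<lambda>t. (t + 1) / 2) ` S2)"
  have "finite S" using 1 2 by (simp add: S_def)
  moreover have "\<exists>d. ((g +++ h) has_vector_derivative d) (at t) \<and> norm d \<le> 2 * (B1 + B2)" if t: "t \<in> {0<..<1} - S" for t
  proof (cases "t < 1/2")
    case True
    have "2 * t \<notin> S1"
    proof
      assume "2 * t \<in> S1"
      then have "(2 * t) / 2 \<in> S" unfolding S_def by blast
      then show False using t by simp
    qed
    then obtain d where d: "(g has_vector_derivative d) (at (2 * t))" "norm d \<le> B1"
      using 1(3)[of "2 * t"] True t by auto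
    have "((\<lambda>t. 2 * t) has_vector_derivative 2) (at t)"
      by (rule has_vector_derivative_eq_rhs, (rule derivative_intros)+) simp
    then have "((g \<circ> (\<lambda>t. 2 * t)) has_vector_derivative 2 *\<^sub>R d) (at t)"
      by (rule vector_diff_chain_at) (rule d(1))
    then have "((g +++ h) has_vector_derivative 2 *\<^sub>R d) (at t)"
      by (rule has_vector_derivative_transform_within_open[of _ _ _ "{..<1/2}"]) (use True in \<open>auto simp: joinpaths_def\<close>)
    then show ?thesis using d(2) 2(1) by (intro exI[of _ "2 *\<^sub>R d"]) auto
  next
    case False
    then have t2: "t > 1/2" using t by (auto simp: S_def)
    have "2 * t - 1 \<notin> S2"
    proof
      assume "2 * t - 1 \<in> S2"
      then have "((2 * t - 1) + 1) / 2 \<in> S" unfolding S_def by blast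
      then show False using t by simp
    qed
    then obtain d where d: "(h has_vector_derivative d) (at (2 * t - 1))" "norm d \<le> B2"
      using 2(3)[of "2 * t - 1"] t2 t by auto
    have "((\<lambda>t. 2 * t - 1) has_vector_derivative 2) (at t)"
      by (rule has_vector_derivative_eq_rhs, (rule derivative_intros)+) simp
    then have "((h \<circ> (\<lambda>t. 2 * t - 1)) has_vector_derivative 2 *\<^sub>R d) (at t)"
      by (rule vector_diff_chain_at) (rule d(1))
    then have "((g +++ h) has_vector_derivative 2 *\<^sub>R d) (at t)"
      by (rule has_vector_derivative_transform_within_open[of _ _ _ "{1/2<..}"]) (use t2 in \<open>auto simp: joinpaths_def\<close>)
    then show ?thesis using d(2) 1(1) by (intro exI[of _ "2 *\<^sub>R d"]) auto
  qed
  ultimately show ?thesis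
    unfolding bounded_speed_def using 1(1) 2(1) by (intro exI[of _ "2 * (B1 + B2)"] conjI exI[of _ S]) auto
qed

lemma bounded_speed_rectpath: "bounded_speed (rectpath a b)"
  unfolding rectpath_def Let_def by (intro bounded_speed_join bounded_speed_linepath)

lemma bounded_speed_within:
  assumes "bounded_speed g"
  obtains B S where "B > 0" "finite S" "\<And>t. t \<in> {0..1} - S \<Longrightarrow> norm (vector_derivative g (at t within {0..1})) \<le> B"
proof -
  obtain B S where 1: "B > 0" "finite S" "\<And>t. t\<in>{0<..<1} - S \<Longrightarrow> \<exists>d. (g has_vector_derivative d) (at t) \<and> norm d \<le> B"
    using assms unfolding bounded_speed_def by blast
  have "norm (vector_derivative g (at t within {0..1})) \<le> B" if t: "t \<in> {0..1} - (S \<union> {0, 1})" for t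
  proof -
    obtain d where d: "(g has_vector_derivative d) (at t)" "norm d \<le> B" using 1(3)[of t] t by auto
    have "vector_derivative g (at t within {0..1}) = d"
      using vector_derivative_within_cbox[of 0 1 t g d] has_vector_derivative_at_within[OF d(1)] t by auto
    then show ?thesis using d by simp
  qed
  then show thesis using that[of B "S \<union> {0, 1}"] 1 by blast
qed

section \<open>The operator integral of the resolvent as a pointwise contour integral\<close>

context hill_potential
begin

text \<open>A scalar integral for each \<open>x\<close>, so it makes sense for integrable
  \<open>f\<close> outside \<open>L^2\<close> as well.\<close>

definition contour_R :: "(real \<Rightarrow> complex) \<Rightarrow> fop" where
  "contour_R \<gamma> f x = contour_integral \<gamma> (\<lambda>\<mu>. R \<mu> f x)"

lemma R_contour_integrable:
  assumes "valid_path \<gamma>" "path_image \<gamma> \<subseteq> {\<mu>. regular \<mu>}" "f absolutely_integrable_on {0..pi}" "x \<in> {0..pi}"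
  shows "(\<lambda>\<mu>. R \<mu> f x) contour_integrable_on \<gamma>"
  by (rule contour_integrable_holomorphic_simple[OF R_holomorphic[OF assms(3,4)] open_regular assms(1,2)])

text \<open>The resolvents along the compact path share one Lipschitz constant in \<open>x\<close>,
  and this bound survives integration along a path of bounded speed.\<close>

lemma contour_R_continuous:
  assumes \<gamma>: "valid_path \<gamma>" "path_image \<gamma> \<subseteq> {\<mu>. regular \<mu>}" "bounded_speed \<gamma>"
    and f: "f absolutely_integrable_on {0..pi}"
  shows "continuous_on {0..pi} (contour_R \<gamma> f)"
proof -
  obtain M where M: "M > 0" "\<And>\<mu>. \<mu> \<in> path_image \<gamma> \<Longrightarrow> solvable_with bc (q \<mu>) M"
    using solvable_compact[OF compact_path_image[OF valid_path_imp_path[OF \<gamma>(1)]]] \<gamma>(2) by blast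
  obtain B S where B: "B > 0" "finite S" "\<And>t. t \<in> {0..1} - S \<Longrightarrow> norm (vector_derivative \<gamma> (at t within {0..1})) \<le> B"
    using bounded_speed_within[OF \<gamma>(3)] by blast
  define L where "L = M * L1_norm f * B"
  have "norm (contour_R \<gamma> f x - contour_R \<gamma> f y) \<le> L * \<bar>x - y\<bar>" if xy: "x \<in> {0..pi}" "y \<in> {0..pi}" for x y
  proof -
    have "((\<lambda>\<mu>. R \<mu> f x - R \<mu> f y) has_contour_integral (contour_R \<gamma> f x - contour_R \<gamma> f y)) \<gamma>"
      unfolding contour_R_def
      by (intro has_contour_integral_diff has_contour_integral_integral R_contour_integrable \<gamma> f xy)
    then have "((\<lambda>t. (R (\<gamma> t) f x - R (\<gamma> t) f y) * vector_derivative \<gamma> (at t within {0..1}))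
        has_integral (contour_R \<gamma> f x - contour_R \<gamma> f y)) (cbox 0 1)"
      by (simp add: has_contour_integral_def)
    then have "norm (contour_R \<gamma> f x - contour_R \<gamma> f y) \<le> (L * \<bar>x - y\<bar>) * measure lborel (cbox 0 (1::real))"
    proof (rule has_integral_bound_spike_finite[rotated 2])
      show "0 \<le> L * \<bar>x - y\<bar>" using M B L1_norm_nonneg[OF f] by (simp add: L_def)
      fix t assume t: "t \<in> cbox 0 1 - S"
      then have "\<gamma> t \<in> path_image \<gamma>" by (auto simp: path_image_def)
      then have "norm (R (\<gamma> t) f x - R (\<gamma> t) f y) \<le> M * L1_norm f * \<bar>x - y\<bar>"
        using R_bound(2)[OF _ M(2) f xy] \<gamma>(2) by blast
      moreover have "norm (vector_derivative \<gamma> (at t within {0..1})) \<le> B" using B(3) t by simp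
      ultimately show "norm ((R (\<gamma> t) f x - R (\<gamma> t) f y) * vector_derivative \<gamma> (at t within {0..1})) \<le> L * \<bar>x - y\<bar>"
        using mult_mono[of "norm (R (\<gamma> t) f x - R (\<gamma> t) f y)" "M * L1_norm f * \<bar>x - y\<bar>"
            "norm (vector_derivative \<gamma> (at t within {0..1}))" B] M L1_norm_nonneg[OF f]
        by (simp add: norm_mult L_def mult_ac)
    qed (rule B(2))
    then show ?thesis by simp
  qed
  moreover have "L \<ge> 0" using M B L1_norm_nonneg[OF f] by (simp add: L_def)
  ultimately have "L-lipschitz_on {0..pi} (contour_R \<gamma> f)"
    by (intro lipschitz_onI) (auto simp: dist_norm)
  then show ?thesis by (rule lipschitz_on_continuous_on)
qed

text \<open>Henstock's lemma for \<open>\<gamma>'\<close> takes care of the corners of the path.\<close>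

lemma has_op_contour_integral_contour_R:
  assumes \<gamma>: "valid_path \<gamma>" "path_image \<gamma> \<subseteq> {\<mu>. regular \<mu>}" "bounded_speed \<gamma>"
  shows "has_op_contour_integral (hill_resolvent bc v) (contour_R \<gamma>) \<gamma>"
proof -
  note reg = \<gamma>(2)
  define \<gamma>' where "\<gamma>' t = vector_derivative \<gamma> (at t within {0..1})" for t
  define T where "T D f x = (\<Sum>(t, K)\<in>D. measure lborel K *\<^sub>R (\<gamma>' t * hill_resolvent bc v (\<gamma> t) f x)) - contour_R \<gamma> f x" for D :: "(real \<times> real set) set" and f x
  obtain M where M: "M > 0" "\<And>\<mu>. \<mu> \<in> path_image \<gamma> \<Longrightarrow> solvable_with bc (q \<mu>) M"
    using solvable_compact[OF compact_path_image[OF valid_path_imp_path[OF \<gamma>(1)]]] \<gamma>(2) by blast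
  obtain B S where B: "B > 0" "finite S" "\<And>t. t \<in> {0..1} - S \<Longrightarrow> norm (\<gamma>' t) \<le> B"
    using bounded_speed_within[OF \<gamma>(3)] unfolding \<gamma>'_def by blast
  have \<gamma>t: "\<gamma> t \<in> path_image \<gamma>" "regular (\<gamma> t)" if "t \<in> {0..1}" for t
  proof -
    show "\<gamma> t \<in> path_image \<gamma>" using that by (auto simp: path_image_def)
    with reg show "regular (\<gamma> t)" by blast
  qed
  have int\<gamma>': "\<gamma>' integrable_on cbox 0 1"
  proof -
    have "(\<lambda>_. 1) contour_integrable_on \<gamma>"
      by (rule contour_integrable_holomorphic_simple[OF _ open_UNIV \<gamma>(1)]) auto
    then show ?thesis
      unfolding contour_integrable_on_def has_contour_integral_def integrable_on_def by (simp add: \<gamma>'_def[abs_def])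
  qed
  have ev: "\<forall>\<^sub>F D in division_filter {0..1}. opnorm 2 2 (T D) \<le> ennreal \<epsilon>" if "\<epsilon> > 0" for \<epsilon>
  proof -
    \<comment> \<open>Two errors are balanced: \<open>e1\<close> controls the Riemann sums of
      \<open>\<gamma>'\<close> alone and is multiplied by the bound \<open>M F\<close> of the
      resolvent, while \<eta> controls the oscillation of the resolvent on one interval. Each
      contributes \<open>\<epsilon> / (2 \<pi>)\<close> times the \<open>L^1\<close> norm
      \<open>F\<close>, and \<open>F\<close> is at most \<pi> times the \<open>L^2\<close>
      norm.\<close>
    define e1 where "e1 = \<epsilon> / (2 * pi * M)"
    define \<eta> where "\<eta> = \<epsilon> / (2 * pi * (B * (M ^ 2 * pi)))"
    have e1: "e1 > 0" "e1 * M = \<epsilon> / (2 * pi)" using \<open>\<epsilon> > 0\<close> M by (auto simp: e1_def)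
    have \<eta>: "\<eta> > 0" "B * (\<eta> * (M ^ 2 * pi)) = \<epsilon> / (2 * pi)" using \<open>\<epsilon> > 0\<close> M B by (auto simp: \<eta>_def)
    obtain G where G: "gauge G" "\<And>p. p tagged_partial_division_of cbox 0 1 \<Longrightarrow> G fine p \<Longrightarrow>
        (\<Sum>(x, k)\<in>p. norm (measure lborel k *\<^sub>R \<gamma>' x - integral k \<gamma>')) < e1"
      using Henstock_lemma[OF int\<gamma>' e1(1)] by blast
    have "uniformly_continuous_on {0..1} \<gamma>"
      using valid_path_imp_path[OF \<gamma>(1)] unfolding path_def by (intro compact_uniformly_continuous) auto
    then obtain \<delta> where \<delta>: "\<delta> > 0" "\<And>s t. s \<in> {0..1} \<Longrightarrow> t \<in> {0..1} \<Longrightarrow> dist s t < \<delta> \<Longrightarrow> dist (\<gamma> s) (\<gamma> t) < \<eta>"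
      using \<eta>(1) unfolding uniformly_continuous_on_def by metis
    have "opnorm 2 2 (T p) \<le> ennreal \<epsilon>"
      if p: "p tagged_division_of {0..1}" and fine: "(\<lambda>x. G x \<inter> ball x \<delta>) fine p" for p
      unfolding opnorm_def
    proof (rule Inf_lower, clarify)
      fix f assume f: "f \<in> Lp 2"
      have fi: "f absolutely_integrable_on {0..pi}" by (rule Lp2_absolutely_integrable[OF f])
      define F where "F = L1_norm f"
      have F: "F \<ge> 0" using L1_norm_nonneg[OF fi] by (simp add: F_def)
      have fineG: "G fine p" and fine\<delta>: "\<And>t K. (t, K) \<in> p \<Longrightarrow> K \<subseteq> ball t \<delta>"
        using fine by (auto simp: fine_def)
      have p': "p tagged_division_of cbox 0 1" using p by simp
      note pD = tagged_division_ofD[OF p]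
      have TR: "T p f x = (\<Sum>(t, K)\<in>p. measure lborel K *\<^sub>R (\<gamma>' t * R (\<gamma> t) f x)) - contour_R \<gamma> f x" for x
        by (simp add: T_def hill_resolvent_eq_hill_sol[OF v f])
      have main: "norm (T p f x) \<le> \<epsilon> / pi * F" if x: "x \<in> {0..pi}" for x
      proof -
        define h where "h s = R (\<gamma> s) f x * \<gamma>' s" for s
        have hi: "(h has_integral contour_R \<gamma> f x) (cbox 0 1)"
          using has_contour_integral_integral[OF R_contour_integrable[OF \<gamma>(1,2) fi x]]
          unfolding has_contour_integral_def contour_R_def h_def \<gamma>'_def by simp
        have "contour_R \<gamma> f x = (\<Sum>(t, K)\<in>p. integral K h)"
          using integral_combine_tagged_division_topdown[OF _ p', of h] hi by (metis has_integral_integrable integral_unique)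
        then have "T p f x = (\<Sum>(t, K)\<in>p. measure lborel K *\<^sub>R (\<gamma>' t * R (\<gamma> t) f x) - integral K h)"
          by (simp add: TR sum_subtractf split_def)
        then have "norm (T p f x) \<le> (\<Sum>(t, K)\<in>p. norm (measure lborel K *\<^sub>R (\<gamma>' t * R (\<gamma> t) f x) - integral K h))"
          by (simp add: split_def norm_sum)
        also have "\<dots> \<le> (\<Sum>(t, K)\<in>p. norm (measure lborel K *\<^sub>R \<gamma>' t - integral K \<gamma>') * (M * F)
            + B * (\<eta> * (M ^ 2 * pi * F)) * measure lborel K)"
        proof (rule sum_mono, clarify)
          fix t K assume tK: "(t, K) \<in> p"
          then obtain u w where K: "K = cbox u w" "t \<in> K" "K \<subseteq> {0..1}" using pD by metis
          then have t: "t \<in> {0..1}" by blast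
          have i1: "\<gamma>' integrable_on K" using integrable_on_subcbox[OF int\<gamma>'] K by simp
          have i2: "h integrable_on K" using integrable_on_subcbox[OF has_integral_integrable[OF hi]] K by simp
          have i3: "(\<lambda>s. R (\<gamma> t) f x * \<gamma>' s) integrable_on K" using i1 by (rule integrable_on_mult_right)
          \<comment> \<open>The resolvent is frozen at the tag. The first term then involves only
            \<open>\<gamma>'\<close>, the second only the variation of the resolvent on
            \<open>K\<close>.\<close>
          have split: "measure lborel K *\<^sub>R (\<gamma>' t * R (\<gamma> t) f x) - integral K h
              = (measure lborel K *\<^sub>R \<gamma>' t - integral K \<gamma>') * R (\<gamma> t) f x
                 - integral K (\<lambda>s. h s - R (\<gamma> t) f x * \<gamma>' s)"
            using i1 i2 i3 by (simp add: Henstock_Kurzweil_Integration.integral_diff algebra_simps)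
          have "((\<lambda>s. h s - R (\<gamma> t) f x * \<gamma>' s) has_integral integral K (\<lambda>s. h s - R (\<gamma> t) f x * \<gamma>' s)) (cbox u w)"
            using K integrable_diff[OF i2 i3] by (simp add: integrable_integral)
          then have "norm (integral K (\<lambda>s. h s - R (\<gamma> t) f x * \<gamma>' s)) \<le> (B * (\<eta> * (M ^ 2 * pi * F))) * measure lborel (cbox u w)"
          proof (rule has_integral_bound_spike_finite[rotated 2])
            show "0 \<le> B * (\<eta> * (M ^ 2 * pi * F))" using B \<eta> M F by simp
            fix s assume "s \<in> cbox u w - S"
            then have s: "s \<in> {0..1} - S" "s \<in> K" using K by blast+
            then have "dist s t < \<delta>" using fine\<delta>[OF tK] by (auto simp: dist_commute)
            then have "norm (\<gamma> s - \<gamma> t) \<le> \<eta>" using \<delta>(2)[of s t] s t by (auto simp: dist_norm)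
            then have "norm (\<gamma> s - \<gamma> t) * (M ^ 2 * pi * F) \<le> \<eta> * (M ^ 2 * pi * F)"
              using M F by (intro mult_right_mono) auto
            moreover have "norm (R (\<gamma> s) f x - R (\<gamma> t) f x) \<le> norm (\<gamma> s - \<gamma> t) * (M ^ 2 * pi * F)"
              unfolding F_def using s t by (intro R_lipschitz_parameter fi x M \<gamma>t) auto
            ultimately have 1: "norm (R (\<gamma> s) f x - R (\<gamma> t) f x) \<le> \<eta> * (M ^ 2 * pi * F)" by simp
            have "norm (h s - R (\<gamma> t) f x * \<gamma>' s) = norm (\<gamma>' s) * norm (R (\<gamma> s) f x - R (\<gamma> t) f x)"
              by (simp add: h_def left_diff_distrib[symmetric] norm_mult)
            also have "\<dots> \<le> B * (\<eta> * (M ^ 2 * pi * F))"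
              using B(3)[OF s(1)] B(1) 1 by (intro mult_mono) auto
            finally show "norm (h s - R (\<gamma> t) f x * \<gamma>' s) \<le> B * (\<eta> * (M ^ 2 * pi * F))" .
          qed (rule B(2))
          then have 2: "norm (integral K (\<lambda>s. h s - R (\<gamma> t) f x * \<gamma>' s)) \<le> B * (\<eta> * (M ^ 2 * pi * F)) * measure lborel K"
            by (simp only: K(1))
          have 3: "norm ((measure lborel K *\<^sub>R \<gamma>' t - integral K \<gamma>') * R (\<gamma> t) f x)
              \<le> norm (measure lborel K *\<^sub>R \<gamma>' t - integral K \<gamma>') * (M * F)"
            unfolding norm_mult F_def
            by (intro mult_left_mono R_bound(1) \<gamma>t(2) M(2) \<gamma>t(1) fi x t) auto
          show "norm (measure lborel K *\<^sub>R (\<gamma>' t * R (\<gamma> t) f x) - integral K h)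
             \<le> norm (measure lborel K *\<^sub>R \<gamma>' t - integral K \<gamma>') * (M * F) + B * (\<eta> * (M ^ 2 * pi * F)) * measure lborel K"
            unfolding split by (rule order.trans[OF norm_triangle_ineq4 add_mono[OF 3 2]])
        qed
        also have "\<dots> = (\<Sum>(t, K)\<in>p. norm (measure lborel K *\<^sub>R \<gamma>' t - integral K \<gamma>')) * (M * F)
            + B * (\<eta> * (M ^ 2 * pi * F)) * (\<Sum>(t, K)\<in>p. measure lborel K)"
          by (simp only: split_def sum.distrib sum_distrib_left sum_distrib_right)
        also have "(\<Sum>(t, K)\<in>p. measure lborel K) = 1"
          using additive_content_tagged_division[OF p'] by simp
        also have "(\<Sum>(t, K)\<in>p. norm (measure lborel K *\<^sub>R \<gamma>' t - integral K \<gamma>')) * (M * F)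
            + B * (\<eta> * (M ^ 2 * pi * F)) * 1 \<le> e1 * (M * F) + B * (\<eta> * (M ^ 2 * pi * F)) * 1"
          using G(2)[of p] p' fineG M F
          by (intro add_right_mono mult_right_mono) (auto simp: tagged_division_of_def)
        also have "e1 * (M * F) + B * (\<eta> * (M ^ 2 * pi * F)) * 1 = (e1 * M) * F + (B * (\<eta> * (M ^ 2 * pi))) * F"
          by (simp add: algebra_simps)
        also have "\<dots> = \<epsilon> / pi * F" unfolding e1(2) \<eta>(2) by (simp add: field_simps)
        finally show ?thesis by simp
      qed
      have "continuous_on {0..pi} (T p f)"
        unfolding TR[abs_def]
      proof (rule continuous_on_diff[OF _ contour_R_continuous[OF \<gamma> fi]])
        have "fst i \<in> {0..1}" if "i \<in> p" for i
          using pD(2,3)[of "fst i" "snd i"] that by auto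
        then show "continuous_on {0..pi} (\<lambda>x. \<Sum>(t, K)\<in>p. measure lborel K *\<^sub>R (\<gamma>' t * R (\<gamma> t) f x))"
          unfolding split_def by (intro continuous_intros R_continuous \<gamma>t fi)
      qed
      then have "lp_norm 2 (T p f) \<le> ennreal (\<epsilon> / pi * F)"
        using main F \<open>\<epsilon> > 0\<close>
        by (intro lp_norm_le_bound(2) continuous_imp_measurable_on_sets_lebesgue) auto
      also have "\<dots> \<le> ennreal (\<epsilon> * enn2real (lp_norm 2 f))"
        using L1_norm_le_lp_norm[of 2 f] f \<open>\<epsilon> > 0\<close>
        by (intro ennreal_leI) (simp add: F_def field_simps)
      also have "\<dots> = ennreal \<epsilon> * lp_norm 2 f"
        using lp_norm_finite[OF f] \<open>\<epsilon> > 0\<close> by (simp add: ennreal_mult)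
      finally show "lp_norm 2 (T p f) \<le> ennreal \<epsilon> * lp_norm 2 f" .
    qed
    moreover have "gauge (\<lambda>x. G x \<inter> ball x \<delta>)"
      using G(1) \<delta>(1) by (auto simp: gauge_def)
    ultimately show ?thesis unfolding eventually_division_filter by blast
  qed
  have "((\<lambda>D. opnorm 2 2 (T D)) \<longlongrightarrow> 0) (division_filter {0..1})"
  proof (rule order_tendstoI)
    fix a :: ennreal assume "0 < a"
    then obtain \<epsilon> where \<epsilon>: "\<epsilon> > 0" "ennreal \<epsilon> < a"
      using ennreal_rat_dense[of 0 a] by (metis ennreal_less_zero_iff linorder_not_less order_less_le zero_le dense ennreal_cases ennreal_0 ennreal_less_top less_top)
    from ev[OF \<epsilon>(1)] show "\<forall>\<^sub>F D in division_filter {0..1}. opnorm 2 2 (T D) < a"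
      by eventually_elim (use \<epsilon> in auto)
  qed simp
  moreover have "\<forall>f\<in>Lp 2. contour_R \<gamma> f \<in> Lp 2"
    by (intro ballI Lp_continuous[OF contour_R_continuous[OF \<gamma> Lp2_absolutely_integrable]]) auto
  ultimately show ?thesis
    unfolding has_op_contour_integral_def T_def \<gamma>'_def by simp
qed

end

text \<open>\<open>op_contour_integral\<close> picks an arbitrary limit, so the limit has to be
  determined up to null sets. Along the division filter a single Riemann sum is within \<epsilon> of
  both candidates, and the \<open>L^2\<close> distance between them is forced to vanish.\<close>

lemma has_op_contour_integral_unique:
  assumes S1: "has_op_contour_integral F S1 g" and S2: "has_op_contour_integral F S2 g"
    and F: "\<And>t f. t \<in> {0..1} \<Longrightarrow> f \<in> Lp 2 \<Longrightarrow> F (g t) f \<in> borel_measurable (lebesgue_on {0..pi})"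
    and f: "f \<in> Lp 2"
  shows "AE x in lebesgue_on {0..pi}. S1 f x = S2 f x"
proof -
  define A where "A D f x = (\<Sum>(t, K)\<in>D. measure lborel K *\<^sub>R (vector_derivative g (at t within {0..1}) * F (g t) f x))" for D :: "(real \<times> real set) set" and f x
  define n where "n = enn2real (lp_norm 2 f)"
  have n: "lp_norm 2 f = ennreal n" "n \<ge> 0" using lp_norm_finite[OF f] by (auto simp: n_def)
  have m [measurable]: "S1 f \<in> borel_measurable (lebesgue_on {0..pi})" "S2 f \<in> borel_measurable (lebesgue_on {0..pi})"
    using S1 S2 f unfolding has_op_contour_integral_def by (auto simp: Lp_def)
  have Lp: "(\<lambda>x. S1 f x - S2 f x) \<in> Lp 2"
    using S1 S2 f unfolding has_op_contour_integral_def by (intro Lp2_diff) auto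
  define J where "J = integral {0..pi} (\<lambda>x. norm (S1 f x - S2 f x) ^ 2)"
  have Ji: "integrable (lebesgue_on {0..pi}) (\<lambda>x. norm (S1 f x - S2 f x) ^ 2)"
    by (rule iffD1[OF Lp2_iff Lp, THEN conjunct2])
  have J: "J \<le> 4 * pi * (\<epsilon> * n) ^ 2" if "\<epsilon> > 0" for \<epsilon>
  proof -
    have "\<forall>\<^sub>F D in division_filter {0..1}. opnorm 2 2 (\<lambda>f x. A D f x - S1 f x) < ennreal \<epsilon>"
      "\<forall>\<^sub>F D in division_filter {0..1}. opnorm 2 2 (\<lambda>f x. A D f x - S2 f x) < ennreal \<epsilon>"
      using S1 S2 \<open>\<epsilon> > 0\<close> unfolding has_op_contour_integral_def A_def by (auto elim!: order_tendstoD(2))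
    then have "\<forall>\<^sub>F D in division_filter {0..1}. D tagged_division_of {0..1} \<and> opnorm 2 2 (\<lambda>f x. A D f x - S1 f x) < ennreal \<epsilon>
        \<and> opnorm 2 2 (\<lambda>f x. A D f x - S2 f x) < ennreal \<epsilon>"
      using eventually_division_filter_tagged_division[of "{0..1::real}"] by eventually_elim auto
    then obtain D where D: "D tagged_division_of {0..1}" "opnorm 2 2 (\<lambda>f x. A D f x - S1 f x) < ennreal \<epsilon>"
        "opnorm 2 2 (\<lambda>f x. A D f x - S2 f x) < ennreal \<epsilon>"
      using eventually_happens' division_filter_not_empty[of 0 "1::real"] by (metis (no_types, lifting) cbox_interval)
    have Am [measurable]: "A D f \<in> borel_measurable (lebesgue_on {0..pi})"
      unfolding A_def[abs_def] split_def
    proof (intro borel_measurable_sum borel_measurable_scaleR borel_measurable_times borel_measurable_const F f)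
      fix i assume "i \<in> D"
      then show "fst i \<in> {0..1}" using tagged_division_ofD(2,3)[OF D(1)] by (metis prod.collapse subsetD)
    qed
    have est: "(\<lambda>x. A D f x - S f x) \<in> Lp 2 \<and> integral {0..pi} (\<lambda>x. norm (A D f x - S f x) ^ 2) \<le> pi * (\<epsilon> * n) ^ 2"
      if [measurable]: "S f \<in> borel_measurable (lebesgue_on {0..pi})" and o: "opnorm 2 2 (\<lambda>f x. A D f x - S f x) < ennreal \<epsilon>" for S :: fop
    proof -
      obtain K where K: "\<forall>f\<in>Lp 2. lp_norm 2 (\<lambda>x. A D f x - S f x) \<le> K * lp_norm 2 f" "K < ennreal \<epsilon>"
        using o unfolding opnorm_def Inf_less_iff by auto
      have "lp_norm 2 (\<lambda>x. A D f x - S f x) \<le> K * lp_norm 2 f" using K(1) f by blast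
      also have "\<dots> \<le> ennreal \<epsilon> * ennreal n" using K(2) n by (intro mult_mono) auto
      also have "\<dots> = ennreal (\<epsilon> * n)" using n \<open>\<epsilon> > 0\<close> by (simp add: ennreal_mult)
      finally have "lp_norm (ereal 2) (\<lambda>x. A D f x - S f x) \<le> ennreal (\<epsilon> * n)" by simp
      from lp_norm_leD[OF _ _ this] n \<open>\<epsilon> > 0\<close> show ?thesis
        by (simp add: powr_numeral)
    qed
    note e1 = est[OF m(1) D(2)] and e2 = est[OF m(2) D(3)]
    have i1: "(\<lambda>x. norm (A D f x - S1 f x) ^ 2) integrable_on {0..pi}" "(\<lambda>x. norm (A D f x - S2 f x) ^ 2) integrable_on {0..pi}"
      by (rule integrable_on_lebesgue_on[OF iffD1[OF Lp2_iff conjunct1[OF e1], THEN conjunct2]], simp)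
       (rule integrable_on_lebesgue_on[OF iffD1[OF Lp2_iff conjunct1[OF e2], THEN conjunct2]], simp)
    have "J \<le> integral {0..pi} (\<lambda>x. 2 * norm (A D f x - S1 f x) ^ 2 + 2 * norm (A D f x - S2 f x) ^ 2)"
      unfolding J_def
    proof (intro integral_le integrable_add integrable_on_mult_right i1)
      show "(\<lambda>x. norm (S1 f x - S2 f x) ^ 2) integrable_on {0..pi}" using Ji by (intro integrable_on_lebesgue_on) auto
      fix x
      have "norm (S1 f x - S2 f x) \<le> norm (A D f x - S1 f x) + norm (A D f x - S2 f x)"
        using norm_triangle_ineq4[of "A D f x - S2 f x" "A D f x - S1 f x"] by simp
      then have "norm (S1 f x - S2 f x) ^ 2 \<le> (norm (A D f x - S1 f x) + norm (A D f x - S2 f x)) ^ 2"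
        by (intro power_mono) auto
      also have "\<dots> \<le> 2 * norm (A D f x - S1 f x) ^ 2 + 2 * norm (A D f x - S2 f x) ^ 2"
        using zero_le_power2[of "norm (A D f x - S1 f x) - norm (A D f x - S2 f x)"] by (simp add: power2_eq_square algebra_simps)
      finally show "norm (S1 f x - S2 f x) ^ 2 \<le> 2 * norm (A D f x - S1 f x) ^ 2 + 2 * norm (A D f x - S2 f x) ^ 2" .
    qed
    also have "\<dots> = 2 * integral {0..pi} (\<lambda>x. norm (A D f x - S1 f x) ^ 2) + 2 * integral {0..pi} (\<lambda>x. norm (A D f x - S2 f x) ^ 2)"
      using i1 by (subst Henstock_Kurzweil_Integration.integral_add) (auto intro: integrable_on_mult_right)
    also have "\<dots> \<le> 4 * pi * (\<epsilon> * n) ^ 2" using e1 e2 by simp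
    finally show ?thesis .
  qed
  have "J \<le> 0"
  proof (rule field_le_epsilon)
    fix e :: real assume "e > 0"
    \<comment> \<open>Chosen so that \<open>4 \<pi> (\<epsilon> n)^2\<close> is at most
      \<open>e\<close>; the denominator \<open>n + 1\<close> allows for
      \<open>n = 0\<close>.\<close>
    define \<epsilon> where "\<epsilon> = sqrt (e / (4 * pi)) / (n + 1)"
    have "\<epsilon> > 0" using \<open>e > 0\<close> n by (simp add: \<epsilon>_def)
    have "\<epsilon> * n \<le> \<epsilon> * (n + 1)" using \<open>\<epsilon> > 0\<close> by (intro mult_left_mono) auto
    also have "\<dots> = sqrt (e / (4 * pi))" using n by (simp add: \<epsilon>_def)
    finally have "(\<epsilon> * n) ^ 2 \<le> sqrt (e / (4 * pi)) ^ 2" using \<open>\<epsilon> > 0\<close> n by (intro power_mono) auto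
    also have "\<dots> = e / (4 * pi)" using \<open>e > 0\<close> by simp
    finally have "4 * pi * (\<epsilon> * n) ^ 2 \<le> e" by (simp add: field_simps)
    then show "J \<le> 0 + e" using J[OF \<open>\<epsilon> > 0\<close>] by simp
  qed
  then have "integral\<^sup>L (lebesgue_on {0..pi}) (\<lambda>x. norm (S1 f x - S2 f x) ^ 2) \<le> 0"
    unfolding J_def using lebesgue_integral_eq_integral[OF Ji] by simp
  moreover have "0 \<le> integral\<^sup>L (lebesgue_on {0..pi}) (\<lambda>x. norm (S1 f x - S2 f x) ^ 2)"
    by (intro Bochner_Integration.integral_nonneg) auto
  ultimately have "AE x in lebesgue_on {0..pi}. norm (S1 f x - S2 f x) ^ 2 = 0"
    using integral_nonneg_eq_0_iff_AE[OF Ji] by auto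
  then show ?thesis by eventually_elim simp
qed

section \<open>A priori estimates\<close>

lemma abs_continuous_on_subset:
  "abs_continuous_on a b f \<Longrightarrow> {c..d} \<subseteq> {a..b} \<Longrightarrow> abs_continuous_on c d f"
  unfolding abs_continuous_on_def by (meson order.trans)

lemma abs_continuous_on_C1:
  assumes f: "\<And>x. x \<in> {a..b} \<Longrightarrow> (f has_vector_derivative f' x) (at x within {a..b})"
    and f': "continuous_on {a..b} f'"
  shows "abs_continuous_on a b f"
proof -
  have ac: "abs_continuous_on a b (\<lambda>x. f a + integral {a..x} f')"
    by (rule abs_continuous_on_integral[OF absolutely_integrable_continuous_real[OF f']])
  have eq: "f x = f a + integral {a..x} f'" if "x \<in> {a..b}" for x
  proof -
    have "(f' has_integral (f x - f a)) {a..x}"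
      by (rule fundamental_theorem_of_calculus)
        (use that in \<open>auto intro!: has_vector_derivative_within_subset[OF f]\<close>)
    then show ?thesis by (simp add: integral_unique)
  qed
  show ?thesis
  proof (rule abs_continuous_on_dominated[OF ac ac, where L = 1])
    fix r s assume "r \<in> {a..b}" "s \<in> {a..b}"
    from eq[OF this(1)] eq[OF this(2)]
    show "norm (f r - f s) \<le> 1 * (norm (f a + integral {a..r} f' - (f a + integral {a..s} f'))
        + norm (f a + integral {a..r} f' - (f a + integral {a..s} f')))"
      by simp
  qed
qed

text \<open>With \<open>c\<^sup>2 = - \<nu>\<close>, the equation \<open>y'' + \<nu> y = \<psi>\<close> is the first-order equation \<open>P' - c P = \<psi>\<close>
  for \<open>P = y' + c y\<close>.\<close>

lemma first_order_factor:
  fixes v f :: "real \<Rightarrow> complex"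
  assumes v: "v absolutely_integrable_on {0..pi}" and f: "f absolutely_integrable_on {0..pi}"
    and y: "ivp_solution (\<lambda>x. v x - \<nu>) f y y'" and c: "c ^ 2 = - \<nu>"
    and ab: "0 \<le> a" "a \<le> b" "b \<le> pi"
  shows "((\<lambda>t. exp (- c * of_real t) * (f t + v t * y t)) has_integral
           (exp (- c * of_real b) * (y' b + c * y b) - exp (- c * of_real a) * (y' a + c * y a))) {a..b}"
proof -
  have q: "(\<lambda>x. v x - \<nu>) absolutely_integrable_on {0..pi}"
    using v by (intro set_integral_diff(1)) auto
  obtain N where N: "negligible N"
    "\<And>x. x \<in> {0..pi} - N \<Longrightarrow> (y' has_vector_derivative (v x - \<nu>) * y x + f x) (at x within {0..pi})"
    and ac: "abs_continuous_on 0 pi y" and ac': "abs_continuous_on 0 pi y'"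
    by (rule ivp_solution_regularity[OF y q f]) (rule that)
  define e where "e x = exp (- c * of_real x)" for x :: real
  have e: "(e has_vector_derivative - c * e x) (at x within S)" for x S
    unfolding e_def
    by (rule has_vector_derivative_real_field) (auto intro!: derivative_eq_intros)
  have ce: "continuous_on S e" for S unfolding e_def by (intro continuous_intros)
  have ace: "abs_continuous_on 0 pi e"
    by (rule abs_continuous_on_C1[OF e]) (intro continuous_intros ce)
  define P where "P x = y' x + c * y x" for x
  have Pc: "continuous_on {0..pi} P"
    unfolding P_def by (intro continuous_intros ivp_solution_continuous'[OF y q f] ivp_solution_continuous[OF y])
  have acP: "abs_continuous_on 0 pi P"
  proof (rule abs_continuous_on_dominated[OF ac' ac, where L = "1 + norm c"])
    fix r s
    have "P r - P s = (y' r - y' s) + c * (y r - y s)" by (simp add: P_def algebra_simps)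
    then have "norm (P r - P s) \<le> norm (y' r - y' s) + norm c * norm (y r - y s)"
      by (metis norm_mult norm_triangle_ineq)
    also have "\<dots> \<le> (1 + norm c) * (norm (y' r - y' s) + norm (y r - y s))"
      by (simp add: algebra_simps)
    finally show "norm (P r - P s) \<le> (1 + norm c) * (norm (y' r - y' s) + norm (y r - y s))" .
  qed
  have acp: "abs_continuous_on 0 pi (\<lambda>x. e x * P x)"
    by (intro abs_continuous_on_mult ace acP compact_imp_bounded compact_continuous_image ce Pc) auto
  have "((\<lambda>t. e t * (f t + v t * y t)) has_integral (e b * P b - e a * P a)) {a..b}"
  proof (rule has_integral_abs_continuous[OF ab(2) abs_continuous_on_subset[OF acp] N(1)])
    show "{a..b} \<subseteq> {0..pi}" using ab by auto
    fix x assume x: "x \<in> {a..b} - N"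
    then have x': "x \<in> {0..pi} - N" "x \<in> {0..pi}" using ab by auto
    have "((\<lambda>x. e x * P x) has_vector_derivative
        e x * (((v x - \<nu>) * y x + f x) + c * y' x) + (- c * e x) * P x) (at x within {0..pi})"
      unfolding P_def
      by (intro has_vector_derivative_mult e has_vector_derivative_add has_vector_derivative_mult_right
          N(2)[OF x'(1)] ivp_solutionD(1)[OF y x'(2)])
    also have "e x * (((v x - \<nu>) * y x + f x) + c * y' x) + (- c * e x) * P x = e x * (f x + v x * y x - (\<nu> + c ^ 2) * y x)"
      by (simp add: P_def algebra_simps power2_eq_square)
    also have "\<dots> = e x * (f x + v x * y x)" by (simp add: c)
    finally show "((\<lambda>x. e x * P x) has_vector_derivative e x * (f x + v x * y x)) (at x within {a..b})"
      by (rule has_vector_derivative_within_subset) (use ab in auto)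
  qed
  then show ?thesis by (simp only: e_def P_def)
qed

text \<open>The first term dominates the free kernel on the line, the product the contributions
  reflected at the two ends. The factor 4 is the inverse of the lower bound 1/4 for
  \<open>|1 - \<omega>|\<close> and \<open>|1 + \<omega>|\<close>, where
  \<open>\<omega> = exp (i \<mu> \<pi>)\<close>.\<close>

definition green_bound :: "real \<Rightarrow> real \<Rightarrow> real \<Rightarrow> real" where
  "green_bound \<tau> x t = exp (- \<tau> * \<bar>x - t\<bar>) +
     4 * (exp (- \<tau> * x) + exp (- \<tau> * (pi - x))) * (exp (- \<tau> * t) + exp (- \<tau> * (pi - t)))"

lemma green_bound_sym: "green_bound \<tau> x t = green_bound \<tau> t x"
  by (simp add: green_bound_def abs_minus_commute algebra_simps)

lemma green_bound_nonneg: "0 \<le> green_bound \<tau> x t"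
  by (simp add: green_bound_def add_nonneg_nonneg)

lemma green_bound_continuous: "continuous_on S (green_bound \<tau> x)"
  unfolding green_bound_def by (intro continuous_intros)

text \<open>Lets the imaginary part of \<open>\<mu>\<close> be replaced by a lower bound that is
  constant on a whole piece of the contour.\<close>

lemma green_bound_antimono:
  assumes "\<sigma> \<le> \<tau>" "x \<in> {0..pi}" "t \<in> {0..pi}"
  shows "green_bound \<tau> x t \<le> green_bound \<sigma> x t"
proof -
  have le: "exp (- \<tau> * s) \<le> exp (- \<sigma> * s)" if "s \<ge> 0" for s
    using assms(1) that by (simp add: mult_right_mono)
  show ?thesis
    unfolding green_bound_def using assms(2,3)
    by (intro add_mono mult_mono mult_left_mono le) (auto intro!: add_nonneg_nonneg mult_nonneg_nonneg)
qed

text \<open>The value 17 is \<open>1 + 4 * 2 * 2\<close>, reached at \<tau> = 0.\<close>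

lemma green_bound_le:
  assumes "0 \<le> \<tau>" "x \<in> {0..pi}" "t \<in> {0..pi}"
  shows "green_bound \<tau> x t \<le> 17"
  using green_bound_antimono[OF assms] by (simp add: green_bound_def)

text \<open>The integral is at most \<open>1 / |\<sigma>|\<close> by its antiderivative and at most
  4 by its length; adding the two bounds in the form \<open>(1 + |\<sigma>|) I \<le> 5\<close>
  treats small and large \<sigma> together.\<close>

lemma integral_exp_le:
  assumes ab: "0 \<le> a" "a \<le> b" "b \<le> pi" and le: "\<sigma> * a + d \<le> 0" "\<sigma> * b + d \<le> 0"
  shows "integral {a..b} (\<lambda>t. exp (\<sigma> * t + d)) \<le> 5 / (1 + \<bar>\<sigma>\<bar>)"
proof -
  define I where "I = integral {a..b} (\<lambda>t. exp (\<sigma> * t + d))"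
  have i: "(\<lambda>t. exp (\<sigma> * t + d)) integrable_on {a..b}"
    by (intro integrable_continuous_interval continuous_intros)
  have "((\<lambda>t. \<sigma> * exp (\<sigma> * t + d)) has_integral (exp (\<sigma> * b + d) - exp (\<sigma> * a + d))) {a..b}"
    by (rule fundamental_theorem_of_calculus[OF ab(2)])
      (auto simp flip: has_real_derivative_iff_has_vector_derivative intro!: derivative_eq_intros)
  then have "\<sigma> * I = exp (\<sigma> * b + d) - exp (\<sigma> * a + d)"
    by (simp only: I_def Henstock_Kurzweil_Integration.integral_mult_right[symmetric] integral_unique)
  then have "\<bar>\<sigma>\<bar> * \<bar>I\<bar> = \<bar>exp (\<sigma> * b + d) - exp (\<sigma> * a + d)\<bar>" by (metis abs_mult)
  also have "\<dots> \<le> 1"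
  proof -
    have "exp (\<sigma> * b + d) \<le> 1" "exp (\<sigma> * a + d) \<le> 1" "0 < exp (\<sigma> * b + d)" "0 < exp (\<sigma> * a + d)"
      using le by auto
    then show ?thesis by linarith
  qed
  finally have 1: "\<bar>\<sigma>\<bar> * \<bar>I\<bar> \<le> 1" .
  have "I \<le> integral {a..b} (\<lambda>t. 1)"
    unfolding I_def
  proof (intro integral_le i integrable_const_ivl)
    fix t assume t: "t \<in> {a..b}"
    have "\<sigma> * t \<le> max (\<sigma> * a) (\<sigma> * b)"
      using t by (cases "\<sigma> \<ge> 0") (auto simp: le_max_iff_disj mult_left_mono mult_left_mono_neg)
    then show "exp (\<sigma> * t + d) \<le> 1" using le by auto
  qed
  then have "I \<le> 4" using ab pi_less_4 by simp
  moreover have "0 \<le> I" unfolding I_def by (rule Henstock_Kurzweil_Integration.integral_nonneg[OF i]) simp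
  ultimately have "(1 + \<bar>\<sigma>\<bar>) * I \<le> 5" using 1 by (simp add: algebra_simps)
  then show ?thesis unfolding I_def[symmetric] by (simp add: pos_le_divide_eq mult.commute add_pos_nonneg)
qed

text \<open>The constant 90 is 18 times 5: two half-line integrals from the first term, and from the
  reflections a factor at most 8 in \<open>x\<close> times two integrals in
  \<open>t\<close>.\<close>

lemma green_bound_integral:
  assumes \<tau>: "0 \<le> \<tau>" and x: "x \<in> {0..pi}"
  shows "integral {0..pi} (green_bound \<tau> x) \<le> 90 / (1 + \<tau>)"
proof -
  define D where "D = 5 / (1 + \<tau>)"
  have [simp]: "D \<ge> 0" using \<tau> by (simp add: D_def)
  have i: "g integrable_on {0..pi}" if "continuous_on {0..pi} g" for g :: "real \<Rightarrow> real"
    using that by (rule integrable_continuous_interval)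
  have i1: "(\<lambda>t. exp (- \<tau> * \<bar>x - t\<bar>)) integrable_on {0..pi}"
    "(\<lambda>t. exp (- \<tau> * t)) integrable_on {0..pi}" "(\<lambda>t. exp (- \<tau> * (pi - t))) integrable_on {0..pi}"
    by (intro i continuous_intros)+
  have "integral {0..pi} (\<lambda>t. exp (- \<tau> * \<bar>x - t\<bar>))
      = integral {0..x} (\<lambda>t. exp (- \<tau> * \<bar>x - t\<bar>)) + integral {x..pi} (\<lambda>t. exp (- \<tau> * \<bar>x - t\<bar>))"
    using x by (intro Henstock_Kurzweil_Integration.integral_combine[symmetric] i1) auto
  also have "integral {0..x} (\<lambda>t. exp (- \<tau> * \<bar>x - t\<bar>)) = integral {0..x} (\<lambda>t. exp (\<tau> * t + (- \<tau> * x)))"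
    by (intro integral_cong) (auto simp: algebra_simps)
  also have "integral {x..pi} (\<lambda>t. exp (- \<tau> * \<bar>x - t\<bar>)) = integral {x..pi} (\<lambda>t. exp ((- \<tau>) * t + \<tau> * x))"
    by (intro integral_cong) (auto simp: algebra_simps)
  also have "integral {0..x} (\<lambda>t. exp (\<tau> * t + (- \<tau> * x))) + integral {x..pi} (\<lambda>t. exp ((- \<tau>) * t + \<tau> * x)) \<le> D + D"
    using integral_exp_le[of 0 x \<tau> "- \<tau> * x"] integral_exp_le[of x pi "- \<tau>" "\<tau> * x"] x \<tau>
    by (intro add_mono) (auto simp: D_def mult_left_mono)
  finally have 1: "integral {0..pi} (\<lambda>t. exp (- \<tau> * \<bar>x - t\<bar>)) \<le> 2 * D" by simp
  have 2: "integral {0..pi} (\<lambda>t. exp (- \<tau> * t)) \<le> D"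
    using integral_exp_le[of 0 pi "- \<tau>" 0] \<tau> by (simp add: D_def)
  have "integral {0..pi} (\<lambda>t. exp (- \<tau> * (pi - t))) = integral {0..pi} (\<lambda>t. exp (\<tau> * t + (- \<tau> * pi)))"
    by (simp add: algebra_simps)
  then have 3: "integral {0..pi} (\<lambda>t. exp (- \<tau> * (pi - t))) \<le> D"
    using integral_exp_le[of 0 pi \<tau> "- \<tau> * pi"] \<tau> by (simp add: D_def)
  define c where "c = 4 * (exp (- \<tau> * x) + exp (- \<tau> * (pi - x)))"
  have c: "0 \<le> c" "c \<le> 4 * (1 + 1)"
  proof -
    have e: "exp (- \<tau> * x) \<le> 1" "exp (- \<tau> * (pi - x)) \<le> 1"
      "0 \<le> exp (- \<tau> * x)" "0 \<le> exp (- \<tau> * (pi - x))" using \<tau> x by auto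
    show "0 \<le> c" unfolding c_def by (intro mult_nonneg_nonneg add_nonneg_nonneg e) simp
    show "c \<le> 4 * (1 + 1)" unfolding c_def by (intro mult_left_mono add_mono e) simp
  qed
  have i23: "(\<lambda>t. exp (- \<tau> * t) + exp (- \<tau> * (pi - t))) integrable_on {0..pi}"
    using i1 by (intro integrable_add) auto
  have "integral {0..pi} (green_bound \<tau> x) = integral {0..pi} (\<lambda>t. exp (- \<tau> * \<bar>x - t\<bar>) + c * (exp (- \<tau> * t) + exp (- \<tau> * (pi - t))))"
    by (simp add: green_bound_def[abs_def] c_def)
  also have "\<dots> = integral {0..pi} (\<lambda>t. exp (- \<tau> * \<bar>x - t\<bar>)) + c * integral {0..pi} (\<lambda>t. exp (- \<tau> * t) + exp (- \<tau> * (pi - t)))"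
    by (subst Henstock_Kurzweil_Integration.integral_add[OF i1(1) integrable_on_mult_right[OF i23]])
      (simp only: Henstock_Kurzweil_Integration.integral_mult_right)
  also have "integral {0..pi} (\<lambda>t. exp (- \<tau> * t) + exp (- \<tau> * (pi - t))) = integral {0..pi} (\<lambda>t. exp (- \<tau> * t)) + integral {0..pi} (\<lambda>t. exp (- \<tau> * (pi - t)))"
    by (rule Henstock_Kurzweil_Integration.integral_add[OF i1(2,3)])
  also have "integral {0..pi} (\<lambda>t. exp (- \<tau> * \<bar>x - t\<bar>)) + c * (integral {0..pi} (\<lambda>t. exp (- \<tau> * t)) + integral {0..pi} (\<lambda>t. exp (- \<tau> * (pi - t))))
      \<le> 2 * D + 8 * (D + D)"
    using 1 2 3 c
    by (intro add_mono mult_mono add_nonneg_nonneg Henstock_Kurzweil_Integration.integral_nonneg i1) auto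
  also have "\<dots> = 90 / (1 + \<tau>)" by (simp add: D_def)
  finally show ?thesis .
qed

lemma norm_exp_ii_mult: "norm (exp (\<i> * \<mu> * of_real t)) = exp (- Im \<mu> * t)"
  by (simp add: norm_exp_eq_Re)

lemma green_bound_integrable:
  fixes \<psi> :: "real \<Rightarrow> complex"
  assumes "\<psi> absolutely_integrable_on {0..pi}"
  shows "(\<lambda>t. green_bound \<tau> x t * norm (\<psi> t)) integrable_on {0..pi}"
proof -
  have "(\<lambda>t. norm (\<psi> t) * green_bound \<tau> x t) absolutely_integrable_on {0..pi}"
    by (intro absolutely_integrable_continuous_mult green_bound_continuous absolutely_integrable_norm[unfolded o_def] assms)
  then show ?thesis using set_lebesgue_integral_eq_integral(1) by (simp add: mult.commute)
qed

text \<open>Of the two first-order factors, \<open>p = y' + i \<mu> y\<close> is propagated with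
  decay from the left end and \<open>m = y' - i \<mu> y\<close> with decay from the right end. Their
  difference is \<open>2 i \<mu> y\<close>, so the bound follows once \<open>p 0\<close> and
  \<open>m pi\<close> are controlled through the boundary conditions.\<close>

lemma hill_bvp_apriori:
  fixes v f :: "real \<Rightarrow> complex"
  assumes v: "v absolutely_integrable_on {0..pi}" and f: "f absolutely_integrable_on {0..pi}"
    and y: "hill_bvp bc (\<lambda>x. v x - \<mu> ^ 2) f y" and \<tau>: "0 \<le> Im \<mu>"
    and far: "1 / 2 \<le> norm (1 - exp (2 * \<i> * of_real pi * \<mu>))" and x: "x \<in> {0..pi}"
  shows "2 * norm \<mu> * norm (y x) \<le> integral {0..pi} (\<lambda>t. green_bound (Im \<mu>) x t * norm (f t + v t * y t))"
proof -
  obtain y' where y': "ivp_solution (\<lambda>x. v x - \<mu> ^ 2) f y y'" and bc: "satisfies_bc bc y y'"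
    using y unfolding hill_bvp_def by blast
  define \<tau> where "\<tau> = Im \<mu>"
  have "\<tau> \<ge> 0" using \<tau> by (simp add: \<tau>_def)
  define \<psi> where "\<psi> t = f t + v t * y t" for t
  have \<psi>: "\<psi> absolutely_integrable_on {0..pi}"
    unfolding \<psi>_def by (intro set_integral_add(1) f absolutely_integrable_continuous_mult v hill_bvp_continuous[OF y])
  have wint: "(\<lambda>t. g t * norm (\<psi> t)) integrable_on {a..b}" if "continuous_on {0..pi} g" "0 \<le> a" "b \<le> pi" for g a b
  proof -
    have "(\<lambda>t. norm (\<psi> t) * g t) absolutely_integrable_on {0..pi}"
      by (intro absolutely_integrable_continuous_mult that absolutely_integrable_norm[unfolded o_def] \<psi>)
    from integrable_on_initial[OF this that(2,3)] show ?thesis by (simp add: mult.commute)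
  qed
  define p m where "p t = y' t + \<i> * \<mu> * y t" and "m t = y' t + - (\<i> * \<mu>) * y t" for t
  have p: "norm (exp (- (\<i> * \<mu>) * of_real b) * p b - exp (- (\<i> * \<mu>) * of_real a) * p a) * exp (- \<tau> * b)
      \<le> integral {a..b} (\<lambda>t. exp (- \<tau> * (b - t)) * norm (\<psi> t))" if ab: "0 \<le> a" "a \<le> b" "b \<le> pi" for a b
  proof -
    have h: "((\<lambda>t. exp (- (\<i> * \<mu>) * of_real t) * \<psi> t) has_integral
       (exp (- (\<i> * \<mu>) * of_real b) * p b - exp (- (\<i> * \<mu>) * of_real a) * p a)) {a..b}"
      unfolding p_def \<psi>_def by (rule first_order_factor[OF v f y' _ ab]) (simp add: power_mult_distrib)
    from has_integral_mult_right[OF h, of "exp (- \<tau> * b)"]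
    have h': "((\<lambda>t. of_real (exp (- \<tau> * b)) * (exp (- (\<i> * \<mu>) * of_real t) * \<psi> t)) has_integral
       of_real (exp (- \<tau> * b)) * (exp (- (\<i> * \<mu>) * of_real b) * p b - exp (- (\<i> * \<mu>) * of_real a) * p a)) {a..b}" .
    have "norm (of_real (exp (- \<tau> * b)) * (exp (- (\<i> * \<mu>) * of_real b) * p b - exp (- (\<i> * \<mu>) * of_real a) * p a))
        \<le> integral {a..b} (\<lambda>t. exp (- \<tau> * (b - t)) * norm (\<psi> t))"
      unfolding integral_unique[OF h', symmetric]
    proof (rule integral_norm_bound_integral)
      show "(\<lambda>t. exp (- \<tau> * (b - t)) * norm (\<psi> t)) integrable_on {a..b}"
        by (rule wint) (auto intro!: continuous_intros ab)
      fix t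
      show "norm (of_real (exp (- \<tau> * b)) * (exp (- (\<i> * \<mu>) * of_real t) * \<psi> t)) \<le> exp (- \<tau> * (b - t)) * norm (\<psi> t)"
      proof -
        have "exp (- \<tau> * (b - t)) = exp (- \<tau> * b) * exp (\<tau> * t)"
          unfolding mult_exp_exp by (simp add: algebra_simps)
        then show ?thesis by (simp add: norm_mult norm_exp_eq_Re \<tau>_def)
      qed
    qed (use h' in blast)
    then show ?thesis by (simp add: norm_mult mult.commute)
  qed
  have m: "norm (exp (\<i> * \<mu> * of_real b) * m b - exp (\<i> * \<mu> * of_real a) * m a) * exp (\<tau> * a)
      \<le> integral {a..b} (\<lambda>t. exp (- \<tau> * (t - a)) * norm (\<psi> t))" if ab: "0 \<le> a" "a \<le> b" "b \<le> pi" for a b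
  proof -
    have h: "((\<lambda>t. exp (- (- (\<i> * \<mu>)) * of_real t) * \<psi> t) has_integral
       (exp (- (- (\<i> * \<mu>)) * of_real b) * m b - exp (- (- (\<i> * \<mu>)) * of_real a) * m a)) {a..b}"
      unfolding m_def \<psi>_def by (rule first_order_factor[OF v f y' _ ab]) (simp add: power_mult_distrib)
    then have h: "((\<lambda>t. exp (\<i> * \<mu> * of_real t) * \<psi> t) has_integral
       (exp (\<i> * \<mu> * of_real b) * m b - exp (\<i> * \<mu> * of_real a) * m a)) {a..b}" by simp
    from has_integral_mult_right[OF h, of "exp (\<tau> * a)"]
    have h': "((\<lambda>t. of_real (exp (\<tau> * a)) * (exp (\<i> * \<mu> * of_real t) * \<psi> t)) has_integral
       of_real (exp (\<tau> * a)) * (exp (\<i> * \<mu> * of_real b) * m b - exp (\<i> * \<mu> * of_real a) * m a)) {a..b}" .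
    have "norm (of_real (exp (\<tau> * a)) * (exp (\<i> * \<mu> * of_real b) * m b - exp (\<i> * \<mu> * of_real a) * m a))
        \<le> integral {a..b} (\<lambda>t. exp (- \<tau> * (t - a)) * norm (\<psi> t))"
      unfolding integral_unique[OF h', symmetric]
    proof (rule integral_norm_bound_integral)
      show "(\<lambda>t. exp (- \<tau> * (t - a)) * norm (\<psi> t)) integrable_on {a..b}"
        by (rule wint) (auto intro!: continuous_intros ab)
      fix t
      show "norm (of_real (exp (\<tau> * a)) * (exp (\<i> * \<mu> * of_real t) * \<psi> t)) \<le> exp (- \<tau> * (t - a)) * norm (\<psi> t)"
      proof -
        have "exp (- \<tau> * (t - a)) = exp (\<tau> * a) * exp (- \<tau> * t)"
          unfolding mult_exp_exp by (simp add: algebra_simps)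
        then show ?thesis by (simp add: norm_mult norm_exp_eq_Re \<tau>_def)
      qed
    qed (use h' in blast)
    then show ?thesis by (simp add: norm_mult mult.commute)
  qed
  define I1 where "I1 = integral {0..x} (\<lambda>t. exp (- \<tau> * (x - t)) * norm (\<psi> t))"
  define I2 where "I2 = integral {x..pi} (\<lambda>t. exp (- \<tau> * (t - x)) * norm (\<psi> t))"
  define E1 where "E1 = integral {0..pi} (\<lambda>t. exp (- \<tau> * t) * norm (\<psi> t))"
  define E2 where "E2 = integral {0..pi} (\<lambda>t. exp (- \<tau> * (pi - t)) * norm (\<psi> t))"
  have E: "0 \<le> E1" "0 \<le> E2"
    unfolding E1_def E2_def
    by (intro Henstock_Kurzweil_Integration.integral_nonneg wint continuous_intros; simp)+
  have Pb: "norm (p b - exp (\<i> * \<mu> * of_real b) * p 0) \<le> integral {0..b} (\<lambda>t. exp (- \<tau> * (b - t)) * norm (\<psi> t))"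
    if "0 \<le> b" "b \<le> pi" for b
  proof -
    have "p b - exp (\<i> * \<mu> * of_real b) * p 0 = exp (\<i> * \<mu> * of_real b) * (exp (- (\<i> * \<mu>) * of_real b) * p b - exp (- (\<i> * \<mu>) * of_real 0) * p 0)"
    proof -
      have "exp (\<i> * \<mu> * of_real b) * exp (- (\<i> * \<mu>) * of_real b) = 1"
        unfolding mult_exp_exp by simp
      then show ?thesis unfolding right_diff_distrib mult.assoc[symmetric] by simp
    qed
    then have "norm (p b - exp (\<i> * \<mu> * of_real b) * p 0) = exp (- Im \<mu> * b) * norm (exp (- (\<i> * \<mu>) * of_real b) * p b - exp (- (\<i> * \<mu>) * of_real 0) * p 0)"
      by (simp only: norm_mult norm_exp_ii_mult)
    then show ?thesis using p[of 0 b] that by (simp add: \<tau>_def mult.commute)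
  qed
  have Mb: "norm (m a - exp (\<i> * \<mu> * of_real (pi - a)) * m pi) \<le> integral {a..pi} (\<lambda>t. exp (- \<tau> * (t - a)) * norm (\<psi> t))"
    if "0 \<le> a" "a \<le> pi" for a
  proof -
    have "m a - exp (\<i> * \<mu> * of_real (pi - a)) * m pi = - (exp (\<i> * \<mu> * of_real (- a)) * (exp (\<i> * \<mu> * of_real pi) * m pi - exp (\<i> * \<mu> * of_real a) * m a))"
    proof -
      have "exp (\<i> * \<mu> * of_real (- a)) * exp (\<i> * \<mu> * of_real a) = 1"
        "exp (\<i> * \<mu> * of_real (- a)) * exp (\<i> * \<mu> * of_real pi) = exp (\<i> * \<mu> * of_real (pi - a))"
        unfolding mult_exp_exp by (simp_all add: algebra_simps)
      then show ?thesis unfolding right_diff_distrib mult.assoc[symmetric] by simp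
    qed
    then have "norm (m a - exp (\<i> * \<mu> * of_real (pi - a)) * m pi) = exp (- Im \<mu> * (- a)) * norm (exp (\<i> * \<mu> * of_real pi) * m pi - exp (\<i> * \<mu> * of_real a) * m a)"
      by (simp only: norm_mult norm_minus_cancel norm_exp_ii_mult)
    then show ?thesis using m[of a pi] that by (simp add: \<tau>_def mult.commute)
  qed
  \<comment> \<open>The factor picked up across the whole interval. Solving for the end values
    divides by \<open>1 - \<omega>\<close>, \<open>1 + \<omega>\<close> or
    \<open>1 - \<omega>^2\<close>, according to the boundary condition.\<close>
  define \<omega> where "\<omega> = exp (\<i> * \<mu> * of_real pi)"
  have \<omega>: "norm \<omega> \<le> 1"
    unfolding \<omega>_def norm_exp_ii_mult using \<tau> by simp
  have "\<omega> * \<omega> = exp (2 * \<i> * of_real pi * \<mu>)"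
    by (simp add: \<omega>_def mult_exp_exp algebra_simps)
  then have far': "1 / 2 \<le> norm (1 - \<omega>) * norm (1 + \<omega>)" "1 / 2 \<le> norm (1 - \<omega> * \<omega>)"
    using far by (simp_all add: algebra_simps flip: norm_mult)
  have le2: "norm (1 - \<omega>) \<le> 2" "norm (1 + \<omega>) \<le> 2"
    using \<omega> norm_triangle_ineq4[of 1 \<omega>] norm_triangle_ineq[of 1 \<omega>] by auto
  \<comment> \<open>The product of the two factors is at least 1/2 and each is at most 2, so each is
    at least 1/4. Thus one hypothesis serves both periodic cases.\<close>
  have quarter: "1 / 4 \<le> norm (1 - \<omega>)" "1 / 4 \<le> norm (1 + \<omega>)"
    using far'(1) mult_left_mono[OF le2(2), of "norm (1 - \<omega>)"] mult_right_mono[OF le2(1), of "norm (1 + \<omega>)"] by auto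
  define J2 where "J2 = p pi - \<omega> * p 0"
  define J1 where "J1 = m 0 - \<omega> * m pi"
  have J2: "norm J2 \<le> E2" using Pb[of pi] by (simp add: J2_def \<omega>_def E2_def)
  have J1: "norm J1 \<le> E1" using Mb[of 0] by (simp add: J1_def \<omega>_def E1_def)
  have quot: "norm z \<le> 4 * e" if "norm (z * w) \<le> e" "1 / 4 \<le> norm w" for z w :: complex and e
  proof -
    have "norm z * (1 / 4) \<le> norm z * norm w" using that(2) by (rule mult_left_mono) simp
    then show ?thesis using that(1) by (simp add: norm_mult)
  qed
  have ends: "norm (p 0) \<le> 4 * (E1 + E2) \<and> norm (m pi) \<le> 4 * (E1 + E2)"
  proof (cases bc)
    case Per_plus
    then have "p pi = p 0" "m pi = m 0" using bc by (simp_all add: p_def m_def)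
    then have "p 0 * (1 - \<omega>) = J2" "m pi * (1 - \<omega>) = J1" by (simp_all add: J1_def J2_def algebra_simps)
    then have "norm (p 0) \<le> 4 * E2" "norm (m pi) \<le> 4 * E1" using quot quarter(1) J1 J2 by metis+
    then show ?thesis using E by simp
  next
    case Per_minus
    then have "p pi = - p 0" "m pi = - m 0" using bc by (simp_all add: p_def m_def)
    then have "p 0 * (1 + \<omega>) = - J2" "m pi * (1 + \<omega>) = - J1" by (simp_all add: J1_def J2_def algebra_simps)
    then have "norm (p 0) \<le> 4 * E2" "norm (m pi) \<le> 4 * E1" using quot quarter(2) J1 J2 by (metis norm_minus_cancel)+
    then show ?thesis using E by simp
  next
    case Dir
    \<comment> \<open>Under Dirichlet conditions each end reflects one factor into the other.
      Eliminating \<open>p 0\<close> gives \<open>m pi\<close> with divisor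
      \<open>1 - \<omega>^2\<close>, hence the bound 2; one more reflection gives \<open>p 0\<close>
      and stays within 4.\<close>
    then have eq: "p pi = m pi" "p 0 = m 0" using bc by (simp_all add: p_def m_def)
    then have "m pi * (1 - \<omega> * \<omega>) = J2 + \<omega> * J1" by (simp add: J1_def J2_def algebra_simps)
    moreover have "norm (\<omega> * J1) \<le> 1 * E1"
      unfolding norm_mult using J1 \<omega> by (intro mult_mono) auto
    then have "norm (J2 + \<omega> * J1) \<le> E2 + 1 * E1"
      using J2 by (intro norm_triangle_le add_mono)
    ultimately have "norm (m pi) * norm (1 - \<omega> * \<omega>) \<le> E1 + E2" by (metis add.commute mult_1 norm_mult)
    moreover have "norm (m pi) * (1 / 2) \<le> norm (m pi) * norm (1 - \<omega> * \<omega>)" using far'(2) by (rule mult_left_mono) simp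
    ultimately have mp: "norm (m pi) \<le> 2 * (E1 + E2)" by simp
    have "p 0 = J1 + \<omega> * m pi" using eq by (simp add: J1_def)
    moreover have "norm (\<omega> * m pi) \<le> 1 * (2 * (E1 + E2))"
      unfolding norm_mult using mp \<omega> by (intro mult_mono) auto
    then have "norm (J1 + \<omega> * m pi) \<le> E1 + 1 * (2 * (E1 + E2))"
      using J1 by (intro norm_triangle_le add_mono)
    ultimately show ?thesis using mp E by simp
  qed
  define e1 where "e1 = exp (- \<tau> * x)"
  define e2 where "e2 = exp (- \<tau> * (pi - x))"
  have e12: "0 \<le> e1" "0 \<le> e2" by (simp_all add: e1_def e2_def)
  have px: "norm (p x) \<le> I1 + e1 * (4 * (E1 + E2))"
  proof -
    have "norm (p x) \<le> norm (p x - exp (\<i> * \<mu> * of_real x) * p 0) + norm (exp (\<i> * \<mu> * of_real x) * p 0)"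
      by (metis diff_add_cancel norm_triangle_ineq)
    also have "\<dots> \<le> I1 + e1 * (4 * (E1 + E2))"
      using Pb[of x] x ends e12 unfolding norm_mult norm_exp_ii_mult I1_def e1_def \<tau>_def[symmetric]
      by (intro add_mono mult_left_mono) auto
    finally show ?thesis .
  qed
  have mx: "norm (m x) \<le> I2 + e2 * (4 * (E1 + E2))"
  proof -
    have "norm (m x) \<le> norm (m x - exp (\<i> * \<mu> * of_real (pi - x)) * m pi) + norm (exp (\<i> * \<mu> * of_real (pi - x)) * m pi)"
      by (metis diff_add_cancel norm_triangle_ineq)
    also have "\<dots> \<le> I2 + e2 * (4 * (E1 + E2))"
      using Mb[of x] x ends e12 unfolding norm_mult norm_exp_ii_mult I2_def e2_def \<tau>_def[symmetric]
      by (intro add_mono mult_left_mono) auto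
    finally show ?thesis .
  qed
  have "2 * norm \<mu> * norm (y x) = norm (p x - m x)"
    by (simp add: p_def m_def norm_mult)
  also have "\<dots> \<le> norm (p x) + norm (m x)" by (rule norm_triangle_ineq4)
  also have "\<dots> \<le> (I1 + I2) + 4 * (e1 + e2) * (E1 + E2)" using px mx by (simp add: algebra_simps)
  also have "\<dots> = integral {0..pi} (\<lambda>t. green_bound (Im \<mu>) x t * norm (\<psi> t))"
  proof -
    have i1: "(\<lambda>t. exp (- \<tau> * t) * norm (\<psi> t)) integrable_on {0..pi}"
      and i2: "(\<lambda>t. exp (- \<tau> * (pi - t)) * norm (\<psi> t)) integrable_on {0..pi}"
      and i3: "(\<lambda>t. exp (- \<tau> * \<bar>x - t\<bar>) * norm (\<psi> t)) integrable_on {0..pi}"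
      by (intro wint continuous_intros order.refl)+
    have "integral {0..pi} (\<lambda>t. exp (- \<tau> * \<bar>x - t\<bar>) * norm (\<psi> t))
        = integral {0..x} (\<lambda>t. exp (- \<tau> * \<bar>x - t\<bar>) * norm (\<psi> t)) + integral {x..pi} (\<lambda>t. exp (- \<tau> * \<bar>x - t\<bar>) * norm (\<psi> t))"
      using x by (intro Henstock_Kurzweil_Integration.integral_combine[symmetric] i3) auto
    also have "integral {0..x} (\<lambda>t. exp (- \<tau> * \<bar>x - t\<bar>) * norm (\<psi> t)) = I1"
      unfolding I1_def by (intro integral_cong) auto
    also have "integral {x..pi} (\<lambda>t. exp (- \<tau> * \<bar>x - t\<bar>) * norm (\<psi> t)) = I2"
      unfolding I2_def by (intro integral_cong) auto
    finally have I12: "integral {0..pi} (\<lambda>t. exp (- \<tau> * \<bar>x - t\<bar>) * norm (\<psi> t)) = I1 + I2" .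
    define c where "c = 4 * (e1 + e2)"
    have i12: "(\<lambda>t. exp (- \<tau> * t) * norm (\<psi> t) + exp (- \<tau> * (pi - t)) * norm (\<psi> t)) integrable_on {0..pi}"
      by (rule integrable_add[OF i1 i2])
    have "integral {0..pi} (\<lambda>t. green_bound (Im \<mu>) x t * norm (\<psi> t))
        = integral {0..pi} (\<lambda>t. exp (- \<tau> * \<bar>x - t\<bar>) * norm (\<psi> t) + c * (exp (- \<tau> * t) * norm (\<psi> t) + exp (- \<tau> * (pi - t)) * norm (\<psi> t)))"
      unfolding green_bound_def \<tau>_def[symmetric] e1_def[symmetric] e2_def[symmetric] c_def[symmetric]
      by (simp only: distrib_left distrib_right mult.assoc)
    also have "\<dots> = (I1 + I2) + c * (E1 + E2)"
      unfolding Henstock_Kurzweil_Integration.integral_add[OF i3 integrable_on_mult_right[OF i12]]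
        Henstock_Kurzweil_Integration.integral_mult_right Henstock_Kurzweil_Integration.integral_add[OF i1 i2] I12
      by (simp only: E1_def E2_def)
    finally show ?thesis by (simp add: c_def)
  qed
  finally show ?thesis by (simp only: \<psi>_def)
qed

text \<open>The exponential equals 1 exactly when \<mu> is an integer, and squares of integers
  include the free eigenvalues of all three boundary conditions, so a single condition covers
  them.\<close>

definition far_from_spectrum :: "complex \<Rightarrow> bool" where
  "far_from_spectrum \<mu> \<longleftrightarrow> 0 \<le> Im \<mu> \<and> \<mu> \<noteq> 0 \<and> 1 / 2 \<le> norm (1 - exp (2 * \<i> * of_real pi * \<mu>))"

section \<open>Regularity and the resolvent difference away from the free spectrum\<close>

context hill_potential
begin

text \<open>At a maximum point of \<open>|y|\<close> the potential term is at most
  \<open>17 L1_norm v |y| \<le> |\<mu>| |y|\<close>. That is half of the left side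
  \<open>2 |\<mu>| |y|\<close> of the a priori estimate and is absorbed.\<close>

lemma bvp_sup_bound:
  assumes far: "far_from_spectrum \<mu>" and large: "17 * L1_norm v \<le> norm \<mu>"
    and f: "f absolutely_integrable_on {0..pi}" and y: "hill_bvp bc (q (\<mu> ^ 2)) f y"
    and S: "\<And>x. x \<in> {0..pi} \<Longrightarrow> integral {0..pi} (\<lambda>t. green_bound (Im \<mu>) x t * norm (f t)) \<le> S"
    and x: "x \<in> {0..pi}"
  shows "norm (y x) \<le> S / norm \<mu>"
proof -
  have \<mu>: "norm \<mu> > 0" "0 \<le> Im \<mu>" using far by (auto simp: far_from_spectrum_def)
  have yc: "continuous_on {0..pi} y" by (rule hill_bvp_continuous[OF y])
  have "continuous_on {0..pi} (\<lambda>x. norm (y x))" by (intro continuous_intros yc)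
  then obtain x1 where x1: "x1 \<in> {0..pi}" "\<And>x. x \<in> {0..pi} \<Longrightarrow> norm (y x) \<le> norm (y x1)"
    using continuous_attains_sup[of "{0..pi}" "\<lambda>x. norm (y x)"] by auto
  define k where "k = green_bound (Im \<mu>) x1"
  have vi: "(\<lambda>t. 17 * norm (y x1) * norm (v t)) integrable_on {0..pi}"
    by (intro integrable_on_mult_right integrable_on_norm v)
  have fi: "(\<lambda>t. k t * norm (f t)) integrable_on {0..pi}"
    unfolding k_def by (rule green_bound_integrable[OF f])
  have \<psi>: "(\<lambda>t. f t + v t * y t) absolutely_integrable_on {0..pi}"
    by (intro set_integral_add(1) f absolutely_integrable_continuous_mult v yc)
  have "2 * norm \<mu> * norm (y x1) \<le> integral {0..pi} (\<lambda>t. k t * norm (f t + v t * y t))"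
    unfolding k_def using far by (intro hill_bvp_apriori[OF v f y _ _ x1(1)]) (auto simp: far_from_spectrum_def)
  also have "\<dots> \<le> integral {0..pi} (\<lambda>t. k t * norm (f t) + 17 * norm (y x1) * norm (v t))"
  proof (intro integral_le integrable_add fi vi)
    show "(\<lambda>t. k t * norm (f t + v t * y t)) integrable_on {0..pi}"
      unfolding k_def by (rule green_bound_integrable[OF \<psi>])
    fix t assume t: "t \<in> {0..pi}"
    have k: "0 \<le> k t" "k t \<le> 17" unfolding k_def using green_bound_le[OF \<mu>(2) x1(1) t] green_bound_nonneg by auto
    have "norm (f t + v t * y t) \<le> norm (f t) + norm (v t) * norm (y t)" by (metis norm_mult norm_triangle_ineq)
    then have "k t * norm (f t + v t * y t) \<le> k t * (norm (f t) + norm (v t) * norm (y t))"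
      using k(1) by (rule mult_left_mono)
    moreover have "k t * (norm (v t) * norm (y t)) \<le> 17 * (norm (v t) * norm (y x1))"
      using k x1(2)[OF t] by (intro mult_mono mult_left_mono) auto
    ultimately show "k t * norm (f t + v t * y t) \<le> k t * norm (f t) + 17 * norm (y x1) * norm (v t)"
      by (simp add: algebra_simps)
  qed
  also have "\<dots> = integral {0..pi} (\<lambda>t. k t * norm (f t)) + 17 * norm (y x1) * L1_norm v"
    unfolding Henstock_Kurzweil_Integration.integral_add[OF fi vi] by simp
  also have "\<dots> \<le> S + norm \<mu> * norm (y x1)"
    using S[OF x1(1)] mult_right_mono[OF large, of "norm (y x1)"] by (simp add: k_def mult_ac)
  finally have "norm \<mu> * norm (y x1) \<le> S" by simp
  then have "norm (y x1) \<le> S / norm \<mu>" using \<mu> by (simp add: pos_le_divide_eq mult.commute)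
  then show ?thesis using x1(2)[OF x] by simp
qed

text \<open>An eigenfunction has right-hand side 0, and the sup bound makes it vanish.\<close>

lemma far_regular:
  assumes "far_from_spectrum \<mu>" "17 * L1_norm v \<le> norm \<mu>"
  shows "regular (\<mu> ^ 2)"
proof (rule ccontr)
  assume "\<not> regular (\<mu> ^ 2)"
  then obtain y x where y: "hill_bvp bc (q (\<mu> ^ 2)) (\<lambda>_. 0) y" "x \<in> {0..pi}" "y x \<noteq> 0"
    using hill_eigenvalue_iff[OF v] by blast
  have "norm (y x) \<le> 0 / norm \<mu>"
    by (rule bvp_sup_bound[OF assms _ y(1) _ y(2)]) auto
  then show False using y(3) by simp
qed


text \<open>The difference of the two solutions solves the free problem with right-hand side
  \<open>v y\<close>. The a priori estimate gives one factor \<open>1 / |\<mu>|\<close>, the sup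
  bound for \<open>y\<close> the other, and the dependence on \<open>x\<close> is kept in the
  integral against \<open>|v|\<close>.\<close>

lemma resolvent_difference_bound:
  assumes far: "far_from_spectrum \<mu>" and large: "17 * L1_norm v \<le> norm \<mu>"
    and f: "f absolutely_integrable_on {0..pi}"
    and S: "\<And>x. x \<in> {0..pi} \<Longrightarrow> integral {0..pi} (\<lambda>t. green_bound (Im \<mu>) x t * norm (f t)) \<le> S"
    and x: "x \<in> {0..pi}"
  shows "norm (R (\<mu> ^ 2) f x - hill_sol bc (\<lambda>_. 0) (\<mu> ^ 2) f x)
           \<le> S / norm \<mu> ^ 2 * integral {0..pi} (\<lambda>t. green_bound (Im \<mu>) x t * norm (v t))"
proof -
  interpret free: hill_potential bc "\<lambda>_. 0" by unfold_locales simp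
  define y where "y = R (\<mu> ^ 2) f"
  define z where "z = free.R (\<mu> ^ 2) f"
  have y: "hill_bvp bc (q (\<mu> ^ 2)) f y"
    unfolding y_def by (rule R_bvp[OF far_regular[OF far large] f])
  have z: "hill_bvp bc (free.q (\<mu> ^ 2)) f z"
    unfolding z_def by (rule free.R_bvp[OF free.far_regular[OF far] f]) simp
  have yc: "continuous_on {0..pi} y" by (rule hill_bvp_continuous[OF y])
  have vy: "(\<lambda>t. v t * y t) absolutely_integrable_on {0..pi}"
    by (rule absolutely_integrable_continuous_mult[OF v yc])
  have fvy: "(\<lambda>t. f t + v t * y t) absolutely_integrable_on {0..pi}"
    by (intro set_integral_add(1) f vy)
  have "hill_bvp bc (free.q (\<mu> ^ 2)) (\<lambda>t. f t + v t * y t) y"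
    by (rule hill_bvp_cong_imp[OF y]) (simp_all add: algebra_simps)
  then have "hill_bvp bc (free.q (\<mu> ^ 2)) (\<lambda>t. (f t + v t * y t) + (- 1) * f t) (\<lambda>t. y t + (- 1) * z t)"
    by (rule hill_bvp_linear[OF _ z free.q fvy f])
  then have w: "hill_bvp bc (free.q (\<mu> ^ 2)) (\<lambda>t. v t * y t) (\<lambda>t. y t - z t)" by simp
  have \<mu>: "norm \<mu> > 0" using far by (auto simp: far_from_spectrum_def)
  have "0 \<le> S"
    using S[OF x] Henstock_Kurzweil_Integration.integral_nonneg[OF green_bound_integrable[OF f], of "Im \<mu>" x]
    by (meson green_bound_nonneg mult_nonneg_nonneg norm_ge_zero order.trans)
  define K where "K = integral {0..pi} (\<lambda>t. green_bound (Im \<mu>) x t * norm (v t))"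
  have "2 * norm \<mu> * norm (y x - z x)
      \<le> integral {0..pi} (\<lambda>t. green_bound (Im \<mu>) x t * norm (v t * y t + 0 * (y t - z t)))"
    using far by (intro hill_bvp_apriori[OF _ vy w _ _ x]) (auto simp: far_from_spectrum_def)
  also have "\<dots> = integral {0..pi} (\<lambda>t. green_bound (Im \<mu>) x t * norm (v t * y t))" by simp
  also have "\<dots> \<le> integral {0..pi} (\<lambda>t. S / norm \<mu> * (green_bound (Im \<mu>) x t * norm (v t)))"
  proof (intro integral_le integrable_on_mult_right green_bound_integrable v vy)
    fix t assume t: "t \<in> {0..pi}"
    have "norm (y t) \<le> S / norm \<mu>"
      by (rule bvp_sup_bound[OF far large f y S t])
    then have "(green_bound (Im \<mu>) x t * norm (v t)) * norm (y t) \<le> (green_bound (Im \<mu>) x t * norm (v t)) * (S / norm \<mu>)"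
      using green_bound_nonneg by (intro mult_left_mono) auto
    then show "green_bound (Im \<mu>) x t * norm (v t * y t) \<le> S / norm \<mu> * (green_bound (Im \<mu>) x t * norm (v t))"
      by (simp add: norm_mult mult_ac)
  qed
  also have "\<dots> = S / norm \<mu> * K" by (simp add: K_def)
  finally have "2 * norm \<mu> * norm (y x - z x) \<le> S / norm \<mu> * K" .
  moreover have "norm \<mu> * norm (y x - z x) \<le> 2 * norm \<mu> * norm (y x - z x)" by simp
  ultimately have "norm \<mu> * norm (y x - z x) \<le> S / norm \<mu> * K" by linarith
  then have "norm (y x - z x) \<le> S / norm \<mu> * K / norm \<mu>"
    using \<mu> by (simp add: pos_le_divide_eq mult.commute)
  then show ?thesis by (simp add: y_def z_def K_def power2_eq_square)
qed

end

section \<open>Mapping properties of the bounding kernel\<close>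

lemma integrable_lebesgue_on_iff_abs:
  fixes g :: "real \<Rightarrow> real"
  shows "integrable (lebesgue_on {0..pi}) g \<longleftrightarrow> g absolutely_integrable_on {0..pi}"
  by (simp add: set_integrable_def integrable_restrict_space)

lemma absolutely_integrable_norm_powr:
  assumes "p > 0" "f \<in> Lp (ereal p)"
  shows "(\<lambda>x. norm (f x) powr p) absolutely_integrable_on {0..pi}"
  using assms Lp_iff[of p f] integrable_lebesgue_on_iff_abs by blast

lemma green_bound_integral_mult_le:
  assumes "0 \<le> \<tau>" "x \<in> {0..pi}" and \<Phi>: "\<Phi> absolutely_integrable_on {0..pi}"
    and nn: "\<And>t. t \<in> {0..pi} \<Longrightarrow> 0 \<le> \<Phi> t" and le: "integral {0..pi} \<Phi> \<le> B"
  shows "(\<lambda>t. green_bound \<tau> x t * \<Phi> t) integrable_on {0..pi}"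
    and "integral {0..pi} (\<lambda>t. green_bound \<tau> x t * \<Phi> t) \<le> 17 * B"
proof -
  have "(\<lambda>t. \<Phi> t * green_bound \<tau> x t) absolutely_integrable_on {0..pi}"
    by (intro absolutely_integrable_continuous_mult green_bound_continuous \<Phi>)
  then show i: "(\<lambda>t. green_bound \<tau> x t * \<Phi> t) integrable_on {0..pi}"
    using set_lebesgue_integral_eq_integral(1) by (simp add: mult.commute)
  have \<Phi>i: "\<Phi> integrable_on {0..pi}" using \<Phi> by (rule set_lebesgue_integral_eq_integral(1))
  have "integral {0..pi} (\<lambda>t. green_bound \<tau> x t * \<Phi> t) \<le> integral {0..pi} (\<lambda>t. 17 * \<Phi> t)"
    using green_bound_le[OF assms(1,2)] nn
    by (intro integral_le i integrable_on_mult_right \<Phi>i mult_right_mono) auto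
  also have "\<dots> = 17 * integral {0..pi} \<Phi>" by simp
  finally show "integral {0..pi} (\<lambda>t. green_bound \<tau> x t * \<Phi> t) \<le> 17 * B" using le by simp
qed

text \<open>Instead of Hoelder's inequality, we use the weighted inequality between the geometric and the
  arithmetic mean for \<open>\<bar>f\<bar>\<^sup>a\<close> and the constant \<open>1 + \<tau>\<close>.\<close>

lemma green_bound_Lp_sup_aux:
  assumes a: "1 \<le> a" and f: "f \<in> Lp (ereal a)" and K: "K > 0"
    and le: "integral {0..pi} (\<lambda>x. norm (f x) powr a) \<le> pi * K powr a"
    and \<tau>: "0 \<le> \<tau>" and x: "x \<in> {0..pi}"
  shows "integral {0..pi} (\<lambda>t. green_bound \<tau> x t * norm (f t)) \<le> 90 * K * (1 + \<tau>) powr - (1 - 1 / a)"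
proof -
  define k where "k = green_bound \<tau> x"
  define \<Phi> where "\<Phi> t = norm (f t) powr a / K powr a" for t
  have \<Phi>: "\<Phi> absolutely_integrable_on {0..pi}"
    unfolding \<Phi>_def using absolutely_integrable_norm_powr[of a f] a f by auto
  have \<Phi>0: "0 \<le> \<Phi> t" for t by (simp add: \<Phi>_def)
  have \<Phi>1: "integral {0..pi} \<Phi> \<le> pi"
    using le K by (simp add: \<Phi>_def[abs_def] pos_divide_le_eq)
  note k\<Phi> = green_bound_integral_mult_le[OF \<tau> x \<Phi> \<Phi>0 \<Phi>1, folded k_def]
  have ki: "k integrable_on {0..pi}"
    unfolding k_def by (intro integrable_continuous_interval green_bound_continuous)
  define c where "c = (1 + \<tau>) powr - (1 - 1 / a)"
  have c: "c > 0" using \<tau> by (simp add: c_def)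
  \<comment> \<open>The constant \<open>1 + \<tau>\<close> offsets the decay
    \<open>1 / (1 + \<tau>)\<close> of the mass of the kernel, so both terms on the right have
    bounded integral against \<open>k\<close> and the gain sits in \<open>c\<close> alone.\<close>
  have pt: "norm (f t) \<le> K * c * (1 / a * \<Phi> t + (1 - 1 / a) * (1 + \<tau>))" for t
  proof -
    have "\<Phi> t powr (1 / a) * (1 + \<tau>) powr (1 - 1 / a) \<le> 1 / a * \<Phi> t + (1 - 1 / a) * (1 + \<tau>)"
      using a \<tau> \<Phi>0 by (intro weighted_am_gm) auto
    moreover have "\<Phi> t powr (1 / a) = norm (f t) / K"
      using a K by (simp add: \<Phi>_def powr_divide powr_powr)
    ultimately have "K * c * (norm (f t) / K * (1 + \<tau>) powr (1 - 1 / a)) \<le> K * c * (1 / a * \<Phi> t + (1 - 1 / a) * (1 + \<tau>))"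
      using K c by (intro mult_left_mono) auto
    moreover have "c * (1 + \<tau>) powr (1 - 1 / a) = 1"
      unfolding c_def powr_add[symmetric] using \<tau> by simp
    then have "K * c * (norm (f t) / K * (1 + \<tau>) powr (1 - 1 / a)) = norm (f t)"
      using K by (simp add: field_simps)
    ultimately show ?thesis by simp
  qed
  have ri: "(\<lambda>t. 1 / a * (k t * \<Phi> t) + (1 - 1 / a) * (1 + \<tau>) * k t) integrable_on {0..pi}"
    by (intro integrable_add integrable_on_mult_right k\<Phi>(1) ki)
  have "integral {0..pi} (\<lambda>t. k t * norm (f t)) \<le> integral {0..pi} (\<lambda>t. K * c * (1 / a * (k t * \<Phi> t) + (1 - 1 / a) * (1 + \<tau>) * k t))"
  proof (intro integral_le integrable_on_mult_right ri)
    show "(\<lambda>t. k t * norm (f t)) integrable_on {0..pi}"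
      unfolding k_def by (rule green_bound_integrable[OF absolutely_integrable_onI_Lp[OF a f]])
    fix t
    have "k t * norm (f t) \<le> k t * (K * c * (1 / a * \<Phi> t + (1 - 1 / a) * (1 + \<tau>)))"
      using pt[of t] green_bound_nonneg by (intro mult_left_mono) (auto simp: k_def)
    also have "\<dots> = K * c * (1 / a * (k t * \<Phi> t) + (1 - 1 / a) * (1 + \<tau>) * k t)"
      by (simp only: distrib_left distrib_right mult_ac)
    finally show "k t * norm (f t) \<le> K * c * (1 / a * (k t * \<Phi> t) + (1 - 1 / a) * (1 + \<tau>) * k t)" .
  qed
  also have "\<dots> = K * c * (1 / a * integral {0..pi} (\<lambda>t. k t * \<Phi> t) + (1 - 1 / a) * (1 + \<tau>) * integral {0..pi} k)"
    unfolding Henstock_Kurzweil_Integration.integral_mult_right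
      Henstock_Kurzweil_Integration.integral_add[OF integrable_on_mult_right[OF k\<Phi>(1)] integrable_on_mult_right[OF ki]] ..
  also have "\<dots> \<le> K * c * (1 / a * 90 + (1 - 1 / a) * 90)"
  proof -
    have "integral {0..pi} (\<lambda>t. k t * \<Phi> t) \<le> 90" using k\<Phi>(2) pi_less_4 by simp
    moreover have "(1 + \<tau>) * integral {0..pi} k \<le> 90"
      using green_bound_integral[OF \<tau> x] \<tau> by (simp add: k_def pos_le_divide_eq mult.commute)
    ultimately show ?thesis
      using K c a unfolding mult.assoc by (intro mult_left_mono add_mono) auto
  qed
  also have "\<dots> = 90 * K * c" by (simp add: algebra_simps)
  finally show ?thesis by (simp add: k_def c_def)
qed

lemma green_bound_Lp_sup:
  assumes a: "1 \<le> a" and f: "f \<in> Lp (ereal a)" and \<tau>: "0 \<le> \<tau>" and x: "x \<in> {0..pi}"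
  shows "integral {0..pi} (\<lambda>t. green_bound \<tau> x t * norm (f t))
           \<le> 90 * enn2real (lp_norm (ereal a) f) * (1 + \<tau>) powr - (1 - 1 / a)"
proof (rule field_le_epsilon)
  define n where "n = enn2real (lp_norm (ereal a) f)"
  define c where "c = (1 + \<tau>) powr - (1 - 1 / a)"
  have n: "n \<ge> 0" by (simp add: n_def)
  have c: "c > 0" using \<tau> by (simp add: c_def)
  fix e :: real assume "e > 0"
  \<comment> \<open>The margin keeps \<open>K\<close> positive when the norm is zero, and its size
    makes the excess exactly \<open>e\<close>.\<close>
  define K where "K = n + e / (90 * c)"
  have K: "K > 0" "n \<le> K" using n c \<open>e > 0\<close> by (auto simp: K_def intro!: add_nonneg_pos)
  have "f \<in> borel_measurable (lebesgue_on {0..pi})" using f by (simp add: Lp_def)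
  moreover have "lp_norm (ereal a) f \<le> ennreal K"
    by (subst lp_norm_finite[OF f], rule ennreal_leI) (use K in \<open>simp add: n_def\<close>)
  ultimately have "integral {0..pi} (\<lambda>x. norm (f x) powr a) \<le> pi * K powr a"
    using a K by (intro lp_norm_leD(2)) auto
  from green_bound_Lp_sup_aux[OF a f K(1) this \<tau> x]
  have "integral {0..pi} (\<lambda>t. green_bound \<tau> x t * norm (f t)) \<le> 90 * K * c" by (simp add: c_def)
  also have "\<dots> = 90 * n * c + e" using c by (simp add: K_def field_simps)
  finally show "integral {0..pi} (\<lambda>t. green_bound \<tau> x t * norm (f t))
      \<le> 90 * enn2real (lp_norm (ereal a) f) * (1 + \<tau>) powr - (1 - 1 / a) + e"
    by (simp add: n_def c_def)
qed

text \<open>Concavity of the logarithm, applied through its tangent at the weighted arithmetic mean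
  \<open>M\<close>.\<close>

lemma weighted_am_gm3:
  fixes x y z :: real
  assumes pos: "0 < x" "0 < y" "0 < z" and w: "0 \<le> \<alpha>" "0 \<le> \<beta>" "0 \<le> \<gamma>" "\<alpha> + \<beta> + \<gamma> = 1"
  shows "x powr \<alpha> * y powr \<beta> * z powr \<gamma> \<le> \<alpha> * x + \<beta> * y + \<gamma> * z"
proof -
  define M where "M = \<alpha> * x + \<beta> * y + \<gamma> * z"
  have "M > 0"
  proof -
    have "0 \<le> \<alpha> * x" "0 \<le> \<beta> * y" "0 \<le> \<gamma> * z" using pos w by auto
    moreover have "0 < \<alpha> \<or> 0 < \<beta> \<or> 0 < \<gamma>" using w by linarith
    then have "0 < \<alpha> * x \<or> 0 < \<beta> * y \<or> 0 < \<gamma> * z" using pos by auto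
    ultimately show ?thesis unfolding M_def by linarith
  qed
  have l: "ln t \<le> ln M + t / M - 1" if "t > 0" for t
    using ln_le_minus_one[of "t / M"] that \<open>M > 0\<close> by (simp add: ln_div)
  have "\<alpha> * ln x + \<beta> * ln y + \<gamma> * ln z
      \<le> \<alpha> * (ln M + x / M - 1) + \<beta> * (ln M + y / M - 1) + \<gamma> * (ln M + z / M - 1)"
    using l pos w by (intro add_mono mult_left_mono) auto
  also have "\<dots> = (\<alpha> + \<beta> + \<gamma>) * (ln M - 1) + (\<alpha> * x / M + \<beta> * y / M + \<gamma> * z / M)"
    by (simp add: algebra_simps)
  also have "\<dots> = ln M"
  proof -
    have "\<alpha> * x / M + \<beta> * y / M + \<gamma> * z / M = M / M"
      unfolding add_divide_distrib[symmetric] M_def[symmetric] ..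
    also have "M / M = 1" using \<open>M > 0\<close> by simp
    finally have eq: "\<alpha> * x / M + \<beta> * y / M + \<gamma> * z / M = 1" .
    show ?thesis unfolding w(4) eq by simp
  qed
  finally have "exp (\<alpha> * ln x + \<beta> * ln y + \<gamma> * ln z) \<le> M"
    using \<open>M > 0\<close> by (metis exp_le_cancel_iff exp_ln)
  then show ?thesis using pos by (simp add: powr_def exp_add M_def)
qed

lemma measurable_id_lebesgue_on: "(\<lambda>x. x) \<in> measurable (lebesgue_on {0..pi}) borel"
  by (intro measurable_restrict_space1 measurable_completion) simp

text \<open>By Tonelli and the symmetry of the kernel, integrating over \<open>x\<close> first
  produces the mass bound \<open>90 / (1 + \<tau>)\<close> for every \<open>s\<close>. The
  measurability recorded beside it is used again for general kernels against
  \<open>|v|\<close>.\<close>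

lemma nn_integral_green_bound_swap:
  assumes \<Phi>: "\<Phi> absolutely_integrable_on {0..pi}" and nn: "\<And>t. 0 \<le> \<Phi> t"
    and le: "integral {0..pi} \<Phi> \<le> pi" and \<tau>: "0 \<le> \<tau>"
  shows "(\<integral>\<^sup>+x. ennreal (integral {0..pi} (\<lambda>s. green_bound \<tau> x s * \<Phi> s)) \<partial>lebesgue_on {0..pi})
           \<le> ennreal (90 * pi / (1 + \<tau>))"
    and "(\<lambda>x. ennreal (integral {0..pi} (\<lambda>s. green_bound \<tau> x s * \<Phi> s))) \<in> borel_measurable (lebesgue_on {0..pi})"
proof -
  define L where "L = lebesgue_on {0..pi}"
  have spL: "space L = {0..pi}" by (simp add: L_def)
  have fin: "finite_measure L" unfolding L_def by (intro finite_measure_lebesgue_on) simp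
  interpret L: finite_measure L by (rule fin)
  interpret LL: pair_sigma_finite L L by unfold_locales
  have id [measurable]: "(\<lambda>x. x) \<in> measurable L borel"
    unfolding L_def by (rule measurable_id_lebesgue_on)
  have \<Phi>L: "integrable L \<Phi>" unfolding L_def integrable_lebesgue_on_iff_abs by (rule \<Phi>)
  then have [measurable]: "\<Phi> \<in> borel_measurable L" by auto
  have f1 [measurable]: "fst \<in> measurable (L \<Otimes>\<^sub>M L) borel"
    using measurable_compose[OF measurable_fst id] by simp
  have f2 [measurable]: "snd \<in> measurable (L \<Otimes>\<^sub>M L) borel"
    using measurable_compose[OF measurable_snd id] by simp
  have m: "(\<lambda>z. ennreal (green_bound \<tau> (fst z) (snd z) * \<Phi> (snd z))) \<in> borel_measurable (L \<Otimes>\<^sub>M L)"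
    unfolding green_bound_def by measurable
  have inner: "(\<integral>\<^sup>+s. ennreal (green_bound \<tau> x s * \<Phi> s) \<partial>L) = ennreal (integral {0..pi} (\<lambda>s. green_bound \<tau> x s * \<Phi> s))" for x
  proof -
    have "(\<lambda>s. \<Phi> s * green_bound \<tau> x s) absolutely_integrable_on {0..pi}"
      by (intro absolutely_integrable_continuous_mult green_bound_continuous \<Phi>)
    then have i: "integrable L (\<lambda>s. green_bound \<tau> x s * \<Phi> s)"
      unfolding L_def integrable_lebesgue_on_iff_abs by (simp add: mult.commute)
    show ?thesis
      using nn_integral_eq_integral[OF i] lebesgue_integral_eq_integral[OF i[unfolded L_def]] nn green_bound_nonneg
      by (simp add: L_def)
  qed
  have outer: "(\<integral>\<^sup>+x. ennreal (green_bound \<tau> x s * \<Phi> s) \<partial>L) \<le> ennreal (90 / (1 + \<tau>) * \<Phi> s)" if s: "s \<in> {0..pi}" for s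
  proof -
    have "(\<lambda>x. green_bound \<tau> s x) absolutely_integrable_on {0..pi}"
      by (rule absolutely_integrable_continuous_real[OF green_bound_continuous])
    then have i: "integrable L (\<lambda>x. green_bound \<tau> s x)"
      unfolding L_def integrable_lebesgue_on_iff_abs .
    have "(\<integral>\<^sup>+x. ennreal (green_bound \<tau> x s * \<Phi> s) \<partial>L) = (\<integral>\<^sup>+x. ennreal (green_bound \<tau> s x) * ennreal (\<Phi> s) \<partial>L)"
      using nn by (intro nn_integral_cong) (simp add: green_bound_sym[of \<tau> _ s] ennreal_mult'' green_bound_nonneg)
    also have "\<dots> = (\<integral>\<^sup>+x. ennreal (green_bound \<tau> s x) \<partial>L) * ennreal (\<Phi> s)"
      by (rule nn_integral_multc) (use i in auto)
    also have "(\<integral>\<^sup>+x. ennreal (green_bound \<tau> s x) \<partial>L) = ennreal (integral {0..pi} (green_bound \<tau> s))"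
      using nn_integral_eq_integral[OF i] lebesgue_integral_eq_integral[OF i[unfolded L_def]] green_bound_nonneg
      by (simp add: L_def)
    also have "\<dots> * ennreal (\<Phi> s) \<le> ennreal (90 / (1 + \<tau>)) * ennreal (\<Phi> s)"
      by (intro mult_right_mono ennreal_leI green_bound_integral[OF \<tau> s]) auto
    also have "\<dots> = ennreal (90 / (1 + \<tau>) * \<Phi> s)"
      by (rule ennreal_mult[symmetric]) (use \<tau> nn in auto)
    finally show ?thesis .
  qed
  have m': "(\<lambda>(x, s). ennreal (green_bound \<tau> x s * \<Phi> s)) \<in> borel_measurable (L \<Otimes>\<^sub>M L)"
    using m by (simp add: split_def)
  have "(\<integral>\<^sup>+x. (\<integral>\<^sup>+s. ennreal (green_bound \<tau> x s * \<Phi> s) \<partial>L) \<partial>L) = (\<integral>\<^sup>+s. (\<integral>\<^sup>+x. ennreal (green_bound \<tau> x s * \<Phi> s) \<partial>L) \<partial>L)"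
    by (rule LL.Fubini'[OF m', symmetric])
  also have "\<dots> \<le> (\<integral>\<^sup>+s. ennreal (90 / (1 + \<tau>) * \<Phi> s) \<partial>L)"
    by (intro nn_integral_mono outer) (simp add: spL)
  also have "\<dots> = ennreal (90 / (1 + \<tau>) * integral {0..pi} \<Phi>)"
    using nn_integral_eq_integral[of L "\<lambda>s. 90 / (1 + \<tau>) * \<Phi> s"] \<Phi>L nn \<tau>
      lebesgue_integral_eq_integral[OF \<Phi>L[unfolded L_def]] by (simp add: L_def)
  also have "\<dots> \<le> ennreal (90 * pi / (1 + \<tau>))"
    using mult_left_mono[OF le, of "90 / (1 + \<tau>)"] \<tau> by (intro ennreal_leI) simp
  finally have "(\<integral>\<^sup>+x. ennreal (integral {0..pi} (\<lambda>s. green_bound \<tau> x s * \<Phi> s)) \<partial>L) \<le> ennreal (90 * pi / (1 + \<tau>))"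
    by (simp only: inner)
  then show "(\<integral>\<^sup>+x. ennreal (integral {0..pi} (\<lambda>s. green_bound \<tau> x s * \<Phi> s)) \<partial>lebesgue_on {0..pi})
           \<le> ennreal (90 * pi / (1 + \<tau>))"
    by (simp only: L_def)
  have "(\<lambda>x. \<integral>\<^sup>+s. ennreal (green_bound \<tau> x s * \<Phi> s) \<partial>L) \<in> borel_measurable L"
    using L.borel_measurable_nn_integral[OF m'] by simp
  then show "(\<lambda>x. ennreal (integral {0..pi} (\<lambda>s. green_bound \<tau> x s * \<Phi> s))) \<in> borel_measurable (lebesgue_on {0..pi})"
    by (simp only: inner) (simp only: L_def)
qed

text \<open>The bilinear form of the kernel, for the exponents \<open>p\<close> and \<open>b'\<close> with \<open>B = 1 / b'\<close>. The weights
  \<open>1 - 1/p\<close>, \<open>1 - B\<close>, \<open>1/p + B - 1\<close> write \<open>(1/p, B)\<close> as a convex combination of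
  \<open>(0, 1)\<close>, \<open>(1, 0)\<close>, \<open>(1, 1)\<close>.\<close>

lemma green_bound_bilinear:
  assumes p: "1 \<le> p" and v: "v \<in> Lp (ereal p)" and K: "K > 0"
    and le: "integral {0..pi} (\<lambda>x. norm (v x) powr p) \<le> pi * K powr p"
    and B: "0 < B" "B \<le> 1" "1 \<le> 1 / p + B" and \<tau>: "0 \<le> \<tau>"
    and G [measurable]: "G \<in> borel_measurable (lebesgue_on {0..pi})" and G0: "\<And>x. 0 \<le> G x"
    and G1: "(\<integral>\<^sup>+x. ennreal (G x) \<partial>lebesgue_on {0..pi}) \<le> 1"
  shows "(\<integral>\<^sup>+x. ennreal (integral {0..pi} (\<lambda>s. green_bound \<tau> x s * norm (v s)) * G x powr B) \<partial>lebesgue_on {0..pi})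
           \<le> ennreal (360 * K * (1 + \<tau>) powr - (2 - 1 / p - B))"
proof -
  define \<Phi> where "\<Phi> t = norm (v t) powr p / K powr p" for t
  have \<Phi>: "\<Phi> absolutely_integrable_on {0..pi}"
    unfolding \<Phi>_def using absolutely_integrable_norm_powr[of p v] p v by auto
  have \<Phi>0: "0 \<le> \<Phi> t" for t by (simp add: \<Phi>_def)
  have \<Phi>1: "integral {0..pi} \<Phi> \<le> pi"
    using le K by (simp add: \<Phi>_def[abs_def] pos_divide_le_eq)
  define T where "T = 1 + \<tau>"
  have T: "T \<ge> 1" using \<tau> by (simp add: T_def)
  define w where "w = 1 / p + B - 1"
  define g where "g = 2 - 1 / p - B"
  have w: "0 \<le> w" "0 \<le> 1 - 1 / p" "0 \<le> 1 - B" "1 - 1 / p \<le> 1" "1 - B \<le> 1" using B p by (auto simp: w_def)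
  define c where "c = K * T powr - g"
  have c: "c > 0" using K T by (simp add: c_def)
  define Q where "Q x = integral {0..pi} (\<lambda>s. green_bound \<tau> x s * \<Phi> s)" for x
  have pt: "norm (v s) * G x powr B \<le> c * ((1 - 1 / p) * (T * G x) + (1 - B) * (T * \<Phi> s) + w * (\<Phi> s * G x))" for s x
  proof (cases "\<Phi> s = 0 \<or> G x = 0")
    case True
    then have z: "norm (v s) * G x powr B = 0"
      using K by (auto simp: \<Phi>_def)
    show ?thesis
      unfolding z using c w T \<Phi>0 G0 by (intro mult_nonneg_nonneg add_nonneg_nonneg) auto
  next
    case False
    then have pos: "\<Phi> s > 0" "G x > 0" using \<Phi>0[of s] G0[of x] by auto
    have "(T * G x) powr (1 - 1 / p) * (T * \<Phi> s) powr (1 - B) * (\<Phi> s * G x) powr w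
        \<le> (1 - 1 / p) * (T * G x) + (1 - B) * (T * \<Phi> s) + w * (\<Phi> s * G x)"
      using pos T w by (intro weighted_am_gm3) (auto simp: w_def)
    moreover have "(T * G x) powr (1 - 1 / p) * (T * \<Phi> s) powr (1 - B) * (\<Phi> s * G x) powr w
        = T powr g * \<Phi> s powr (1 / p) * G x powr B"
    proof -
      have "(T * G x) powr (1 - 1 / p) * (T * \<Phi> s) powr (1 - B) * (\<Phi> s * G x) powr w
          = (T powr (1 - 1 / p) * T powr (1 - B)) * (\<Phi> s powr (1 - B) * \<Phi> s powr w) * (G x powr (1 - 1 / p) * G x powr w)"
        using pos T by (simp add: powr_mult mult_ac)
      also have "\<dots> = T powr g * \<Phi> s powr (1 / p) * G x powr B"
      proof -
        have "(1 - 1 / p) + (1 - B) = g" "(1 - B) + w = 1 / p" "(1 - 1 / p) + w = B"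
          by (simp_all add: w_def g_def)
        then show ?thesis by (simp only: powr_add[symmetric])
      qed
      finally show ?thesis .
    qed
    moreover have "\<Phi> s powr (1 / p) = norm (v s) / K"
      using p K by (simp add: \<Phi>_def powr_divide powr_powr)
    ultimately have "T powr g * (norm (v s) / K) * G x powr B
        \<le> (1 - 1 / p) * (T * G x) + (1 - B) * (T * \<Phi> s) + w * (\<Phi> s * G x)" by simp
    then have "c * (T powr g * (norm (v s) / K) * G x powr B)
        \<le> c * ((1 - 1 / p) * (T * G x) + (1 - B) * (T * \<Phi> s) + w * (\<Phi> s * G x))"
      using c by (intro mult_left_mono) auto
    moreover have "c * (T powr g * (norm (v s) / K) * G x powr B) = norm (v s) * G x powr B"
      using K T by (simp add: c_def powr_minus field_simps)
    ultimately show ?thesis by simp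
  qed
  have vi: "v absolutely_integrable_on {0..pi}" by (rule absolutely_integrable_onI_Lp[OF p v])
  \<comment> \<open>The corner \<open>(0, 1)\<close> is paid for by the mass \<open>90 / T\<close>
    of the kernel and \<open>(1, 1)\<close> by its pointwise bound 17. The corner
    \<open>(1, 0)\<close> leaves \<open>Q x\<close>, which becomes small only after integration over
    \<open>x\<close>.\<close>
  have xb: "integral {0..pi} (\<lambda>s. green_bound \<tau> x s * norm (v s)) * G x powr B
      \<le> c * ((1 - 1 / p) * 90 + w * (17 * pi)) * G x + c * (1 - B) * T * Q x" if x: "x \<in> {0..pi}" for x
  proof -
    define k where "k = green_bound \<tau> x"
    note k\<Phi> = green_bound_integral_mult_le[OF \<tau> x \<Phi> \<Phi>0 \<Phi>1, folded k_def]
    have ki: "k integrable_on {0..pi}"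
      unfolding k_def by (intro integrable_continuous_interval green_bound_continuous)
    have kv: "(\<lambda>s. k s * norm (v s)) integrable_on {0..pi}"
      unfolding k_def by (rule green_bound_integrable[OF vi])
    define c1 c2 where "c1 = c * ((1 - 1 / p) * (T * G x))" and "c2 = c * ((1 - B) * T + w * G x)"
    have "integral {0..pi} (\<lambda>s. k s * norm (v s)) * G x powr B = integral {0..pi} (\<lambda>s. G x powr B * (k s * norm (v s)))"
      by (simp add: mult.commute)
    also have "\<dots> \<le> integral {0..pi} (\<lambda>s. c1 * k s + c2 * (k s * \<Phi> s))"
    proof (intro integral_le integrable_add integrable_on_mult_right kv ki k\<Phi>(1))
      fix s
      have "k s * (norm (v s) * G x powr B) \<le> k s * (c * ((1 - 1 / p) * (T * G x) + (1 - B) * (T * \<Phi> s) + w * (\<Phi> s * G x)))"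
        using pt[of s x] green_bound_nonneg by (intro mult_left_mono) (auto simp: k_def)
      then show "G x powr B * (k s * norm (v s)) \<le> c1 * k s + c2 * (k s * \<Phi> s)"
        by (simp add: c1_def c2_def algebra_simps)
    qed
    also have "\<dots> = c1 * integral {0..pi} k + c2 * Q x"
      by (subst Henstock_Kurzweil_Integration.integral_add[OF integrable_on_mult_right[OF ki] integrable_on_mult_right[OF k\<Phi>(1)]])
        (simp only: Henstock_Kurzweil_Integration.integral_mult_right Q_def k_def)
    also have "\<dots> = c * (1 - 1 / p) * G x * (T * integral {0..pi} k) + (c * (1 - B) * T * Q x + c * w * G x * Q x)"
      by (simp add: c1_def c2_def algebra_simps)
    also have "\<dots> \<le> c * (1 - 1 / p) * G x * 90 + (c * (1 - B) * T * Q x + c * w * G x * (17 * pi))"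
    proof (intro add_mono mult_left_mono order.refl)
      show "T * integral {0..pi} k \<le> 90"
        using green_bound_integral[OF \<tau> x] \<tau> by (simp add: k_def T_def pos_le_divide_eq mult.commute)
      show "Q x \<le> 17 * pi" using k\<Phi>(2) by (simp add: Q_def k_def)
    qed (use c w G0 T in \<open>auto intro!: mult_nonneg_nonneg\<close>)
    finally show ?thesis by (simp add: k_def algebra_simps)
  qed
  have Q0: "0 \<le> Q x" for x
    unfolding Q_def
  proof (rule Henstock_Kurzweil_Integration.integral_nonneg)
    have "(\<lambda>t. \<Phi> t * green_bound \<tau> x t) absolutely_integrable_on {0..pi}"
      by (intro absolutely_integrable_continuous_mult green_bound_continuous \<Phi>)
    then show "(\<lambda>t. green_bound \<tau> x t * \<Phi> t) integrable_on {0..pi}"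
      using set_lebesgue_integral_eq_integral(1) by (simp add: mult.commute)
  qed (use green_bound_nonneg \<Phi>0 in auto)
  note sw = nn_integral_green_bound_swap[OF \<Phi> \<Phi>0 \<Phi>1 \<tau>, folded Q_def T_def]
  define d1 d2 where "d1 = c * ((1 - 1 / p) * 90 + w * (17 * pi))" and "d2 = c * (1 - B) * T"
  have d: "0 \<le> d1" "0 \<le> d2" using c w T by (auto simp: d1_def d2_def intro!: mult_nonneg_nonneg add_nonneg_nonneg)
  have "(\<integral>\<^sup>+x. ennreal (integral {0..pi} (\<lambda>s. green_bound \<tau> x s * norm (v s)) * G x powr B) \<partial>lebesgue_on {0..pi})
      \<le> (\<integral>\<^sup>+x. ennreal d1 * ennreal (G x) + ennreal d2 * ennreal (Q x) \<partial>lebesgue_on {0..pi})"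
  proof (rule nn_integral_mono)
    fix x assume "x \<in> space (lebesgue_on {0..pi})"
    then have "x \<in> {0..pi}" by simp
    from ennreal_leI[OF xb[OF this, folded d1_def d2_def]]
    show "ennreal (integral {0..pi} (\<lambda>s. green_bound \<tau> x s * norm (v s)) * G x powr B) \<le> ennreal d1 * ennreal (G x) + ennreal d2 * ennreal (Q x)"
      using d G0 Q0 by (simp add: ennreal_plus ennreal_mult)
  qed
  also have "\<dots> = ennreal d1 * (\<integral>\<^sup>+x. ennreal (G x) \<partial>lebesgue_on {0..pi}) + ennreal d2 * (\<integral>\<^sup>+x. ennreal (Q x) \<partial>lebesgue_on {0..pi})"
    using sw(2) by (simp add: nn_integral_add nn_integral_cmult)
  also have "\<dots> \<le> ennreal d1 * 1 + ennreal d2 * ennreal (90 * pi / T)"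
    by (intro add_mono mult_left_mono G1 sw(1)) auto
  also have "\<dots> = ennreal (d1 + d2 * (90 * pi / T))"
  proof -
    have "0 \<le> 90 * pi / T" using T by simp
    from ennreal_mult[OF d(2) this] ennreal_plus[OF d(1) mult_nonneg_nonneg[OF d(2) this]]
    show ?thesis by (simp only: mult_1_right)
  qed
  also have "\<dots> \<le> ennreal (360 * c)"
  proof (rule ennreal_leI)
    \<comment> \<open>The constants 90, \<open>17 \<pi>\<close> and \<open>90 \<pi>\<close> are all
      below 360 because \<pi> < 4, and the three weights add up to 1.\<close>
    have "d1 + d2 * (90 * pi / T) = c * ((1 - 1 / p) * 90 + w * (17 * pi) + (1 - B) * (90 * pi))"
      using T by (simp add: d1_def d2_def field_simps)
    also have "\<dots> \<le> c * ((1 - 1 / p) * 360 + w * 360 + (1 - B) * 360)"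
      using c w pi_less_4 by (intro mult_left_mono add_mono) auto
    also have "\<dots> = 360 * c" by (simp add: w_def algebra_simps)
    finally show "d1 + d2 * (90 * pi / T) \<le> 360 * c" .
  qed
  finally show ?thesis by (simp add: c_def T_def g_def mult_ac)
qed

text \<open>For finite \<open>b\<close> the norm of \<open>h\<close> is found by pairing with the
  extremal function of the dual space; in the pairing the sum over pieces splits linearly and each
  term is a bilinear form already bounded. For \<open>b = \<infinity>\<close> the sup bound of the
  kernel does the same. The relation \<open>1 / b \<le> 1 / p\<close> makes the third weight of the
  bilinear estimate nonnegative.\<close>

lemma lp_norm_le_kernel_sum:
  fixes h v :: "real \<Rightarrow> complex" and b :: ereal
  assumes p: "1 \<le> p" and v: "v \<in> Lp (ereal p)" and K: "K > 0"
    and le: "integral {0..pi} (\<lambda>x. norm (v x) powr p) \<le> pi * K powr p"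
    and b: "1 < b" "real_of_ereal (1 / b) \<le> 1 / p"
    and I: "finite I" "\<And>i. i \<in> I \<Longrightarrow> 0 \<le> c i" "\<And>i. i \<in> I \<Longrightarrow> 0 \<le> \<tau> i"
    and h: "continuous_on {0..pi} h"
    and hb: "\<And>x. x \<in> {0..pi} \<Longrightarrow>
        norm (h x) \<le> (\<Sum>i\<in>I. c i * integral {0..pi} (\<lambda>s. green_bound (\<tau> i) x s * norm (v s)))"
  shows "lp_norm b h \<le> ennreal (360 * K * (\<Sum>i\<in>I. c i * (1 + \<tau> i) powr - (1 - 1 / p + real_of_ereal (1 / b))))"
proof (cases "b = \<infinity>")
  case True
  define S where "S = 360 * K * (\<Sum>i\<in>I. c i * (1 + \<tau> i) powr - (1 - 1 / p))"
  have "norm (h x) \<le> S" if x: "x \<in> {0..pi}" for x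
  proof -
    have "norm (h x) \<le> (\<Sum>i\<in>I. c i * integral {0..pi} (\<lambda>s. green_bound (\<tau> i) x s * norm (v s)))"
      by (rule hb[OF x])
    also have "\<dots> \<le> (\<Sum>i\<in>I. c i * (360 * K * (1 + \<tau> i) powr - (1 - 1 / p)))"
    proof (intro sum_mono mult_left_mono I)
      fix i assume i: "i \<in> I"
      have "integral {0..pi} (\<lambda>s. green_bound (\<tau> i) x s * norm (v s)) \<le> 90 * K * (1 + \<tau> i) powr - (1 - 1 / p)"
        by (rule green_bound_Lp_sup_aux[OF p v K le I(3)[OF i] x])
      also have "\<dots> \<le> 360 * K * (1 + \<tau> i) powr - (1 - 1 / p)"
        using K by (intro mult_right_mono) auto
      finally show "integral {0..pi} (\<lambda>s. green_bound (\<tau> i) x s * norm (v s)) \<le> 360 * K * (1 + \<tau> i) powr - (1 - 1 / p)" .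
    qed
    also have "\<dots> = S" by (simp add: S_def sum_distrib_left mult_ac)
    finally show ?thesis .
  qed
  moreover have "0 \<le> S" unfolding S_def using K I by (intro mult_nonneg_nonneg sum_nonneg) auto
  ultimately have "lp_norm b h \<le> ennreal S"
    using b h by (intro lp_norm_le_bound(2) continuous_imp_measurable_on_sets_lebesgue) auto
  then show ?thesis by (simp add: True S_def)
next
  case False
  then obtain b' where b': "b = ereal b'" "1 < b'" using b(1) by (cases b) auto
  have rb: "real_of_ereal (1 / b) = 1 / b'" using b' by (simp add: one_ereal_def)
  define B where "B = 1 - 1 / b'"
  have B: "0 < B" "B \<le> 1" "1 \<le> 1 / p + B" using b' b(2) unfolding rb B_def by auto
  define A where "A i x = integral {0..pi} (\<lambda>s. green_bound (\<tau> i) x s * norm (v s))" for i x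
  have vi: "v absolutely_integrable_on {0..pi}" by (rule absolutely_integrable_onI_Lp[OF p v])
  have A0: "0 \<le> A i x" for i x
    unfolding A_def using green_bound_nonneg
    by (intro Henstock_Kurzweil_Integration.integral_nonneg green_bound_integrable vi) auto
  have hL: "h \<in> Lp (ereal b')" using Lp_continuous[OF h, of "ereal b'"] b' by simp
  have hm [measurable]: "h \<in> borel_measurable (lebesgue_on {0..pi})" using hL by (simp add: Lp_def)
  have hi: "integrable (lebesgue_on {0..pi}) (\<lambda>x. norm (h x) powr b')" using hL Lp_iff[of b' h] b' by simp
  define J where "J = integral {0..pi} (\<lambda>x. norm (h x) powr b')"
  have hJ: "(\<integral>\<^sup>+x. ennreal (norm (h x) powr b') \<partial>lebesgue_on {0..pi}) = ennreal J"
    using nn_integral_eq_integral[OF hi] lebesgue_integral_eq_integral[OF hi] by (simp add: J_def)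
  have J0: "0 \<le> J" unfolding J_def
    using integrable_on_lebesgue_on[OF hi] by (intro Henstock_Kurzweil_Integration.integral_nonneg) auto
  define Z where "Z = 360 * K * (\<Sum>i\<in>I. c i * (1 + \<tau> i) powr - (1 - 1 / p + 1 / b'))"
  have Z0: "0 \<le> Z" unfolding Z_def using K I by (intro mult_nonneg_nonneg sum_nonneg) auto
  have "J powr (1 / b') \<le> Z"
  proof (cases "J = 0")
    case True
    then show ?thesis using Z0 by simp
  next
    case False
    then have J: "J > 0" using J0 by simp
    \<comment> \<open>\<open>G\<close> has mass 1, and \<open>G powr B\<close> is the normalised
      extremal function: its pairing with \<open>|h|\<close> is
      \<open>J / J powr B = J powr (1 / b')\<close>.\<close>
    define G where "G x = norm (h x) powr b' / J" for x
    have G [measurable]: "G \<in> borel_measurable (lebesgue_on {0..pi})" unfolding G_def by measurable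
    have G0: "0 \<le> G x" for x using J by (simp add: G_def)
    have "(\<integral>\<^sup>+x. ennreal (G x) \<partial>lebesgue_on {0..pi}) = (\<integral>\<^sup>+x. ennreal (norm (h x) powr b') / ennreal J \<partial>lebesgue_on {0..pi})"
      using J by (intro nn_integral_cong) (simp add: G_def divide_ennreal)
    also have "\<dots> = ennreal J / ennreal J" by (simp add: nn_integral_divide hJ)
    finally have G1: "(\<integral>\<^sup>+x. ennreal (G x) \<partial>lebesgue_on {0..pi}) \<le> 1" using J by (simp add: divide_ennreal)
    have hG: "norm (h x) * G x powr B = norm (h x) powr b' / J powr B" for x
    proof (cases "h x = 0")
      case False
      then have n: "norm (h x) > 0" by simp
      have "G x powr B = norm (h x) powr (b' * B) / J powr B"
        using n J by (simp add: G_def powr_divide powr_powr)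
      moreover have "norm (h x) * norm (h x) powr (b' * B) = norm (h x) powr (1 + b' * B)"
        using n by (simp add: powr_add)
      moreover have "1 + b' * B = b'" using b' by (simp add: B_def field_simps)
      ultimately show ?thesis by simp
    qed (use b' in simp)
    have "ennreal (J powr (1 / b')) = ennreal J / ennreal (J powr B)"
    proof -
      have "J powr 1 / J powr B = J powr (1 - B)" by (rule powr_diff[symmetric])
      then have "J / J powr B = J powr (1 / b')" using J by (simp add: B_def)
      then show ?thesis using J by (simp add: divide_ennreal)
    qed
    also have "\<dots> = (\<integral>\<^sup>+x. ennreal (norm (h x) powr b') / ennreal (J powr B) \<partial>lebesgue_on {0..pi})"
      by (simp add: nn_integral_divide hJ)
    also have "\<dots> = (\<integral>\<^sup>+x. ennreal (norm (h x) * G x powr B) \<partial>lebesgue_on {0..pi})"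
      using J by (intro nn_integral_cong) (simp add: hG divide_ennreal)
    also have "\<dots> \<le> (\<integral>\<^sup>+x. (\<Sum>i\<in>I. ennreal (c i) * ennreal (A i x * G x powr B)) \<partial>lebesgue_on {0..pi})"
    proof (rule nn_integral_mono)
      fix x assume "x \<in> space (lebesgue_on {0..pi})"
      then have x: "x \<in> {0..pi}" by simp
      have "norm (h x) * G x powr B \<le> (\<Sum>i\<in>I. c i * A i x) * G x powr B"
        using hb[OF x] by (intro mult_right_mono) (auto simp: A_def)
      also have "\<dots> = (\<Sum>i\<in>I. c i * (A i x * G x powr B))" by (simp add: sum_distrib_right mult.assoc)
      finally have "ennreal (norm (h x) * G x powr B) \<le> ennreal (\<Sum>i\<in>I. c i * (A i x * G x powr B))"
        by (rule ennreal_leI)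
      also have "\<dots> = (\<Sum>i\<in>I. ennreal (c i) * ennreal (A i x * G x powr B))"
        using I A0 by (subst sum_ennreal[symmetric]) (auto intro!: sum.cong simp: ennreal_mult)
      finally show "ennreal (norm (h x) * G x powr B) \<le> (\<Sum>i\<in>I. ennreal (c i) * ennreal (A i x * G x powr B))" .
    qed
    also have "\<dots> = (\<Sum>i\<in>I. ennreal (c i) * (\<integral>\<^sup>+x. ennreal (A i x * G x powr B) \<partial>lebesgue_on {0..pi}))"
    proof -
      have m: "(\<lambda>x. ennreal (A i x * G x powr B)) \<in> borel_measurable (lebesgue_on {0..pi})" if "i \<in> I" for i
      proof -
        have nv: "(\<lambda>s. norm (v s)) absolutely_integrable_on {0..pi}"
          using vi by (rule absolutely_integrable_norm[unfolded o_def])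
        define L where "L = lebesgue_on {0..pi}"
        have "finite_measure L" unfolding L_def by (intro finite_measure_lebesgue_on) simp
        then interpret L: finite_measure L .
        have "(\<lambda>x. ennreal (A i x)) \<in> borel_measurable (lebesgue_on {0..pi})"
        proof -
          \<comment> \<open>Division by \<open>D\<close> brings \<open>|v|\<close> under the mass
            bound \<pi> of the Tonelli lemma, from which only measurability is taken; multiplying by
            \<open>D\<close> restores it.\<close>
          define D where "D = L1_norm v + 1"
          have D: "D > 0" using L1_norm_nonneg[OF vi] by (simp add: D_def)
          define \<Psi> where "\<Psi> s = norm (v s) / D" for s
          have \<Psi>: "\<Psi> absolutely_integrable_on {0..pi}" unfolding \<Psi>_def using nv by auto
          have "integral {0..pi} \<Psi> = L1_norm v / D" by (simp add: \<Psi>_def[abs_def])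
          also have "\<dots> \<le> 1" using D by (simp add: D_def)
          also have "1 \<le> pi" using pi_gt3 by simp
          finally have \<Psi>1: "integral {0..pi} \<Psi> \<le> pi" .
          have "(\<lambda>x. ennreal D * ennreal (integral {0..pi} (\<lambda>s. green_bound (\<tau> i) x s * \<Psi> s))) \<in> borel_measurable (lebesgue_on {0..pi})"
            using nn_integral_green_bound_swap(2)[OF \<Psi> _ \<Psi>1 I(3)[OF that]] D by (auto simp: \<Psi>_def)
          moreover have "ennreal D * ennreal (integral {0..pi} (\<lambda>s. green_bound (\<tau> i) x s * \<Psi> s)) = ennreal (A i x)" for x
          proof -
            have "integral {0..pi} (\<lambda>s. green_bound (\<tau> i) x s * \<Psi> s) = A i x / D"
              by (simp add: \<Psi>_def A_def)
            then show ?thesis using D A0 by (simp flip: ennreal_mult)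
          qed
          ultimately show ?thesis by simp
        qed
        then have "(\<lambda>x. ennreal (A i x) * ennreal (G x powr B)) \<in> borel_measurable (lebesgue_on {0..pi})"
          by measurable
        then show ?thesis using A0 by (simp add: ennreal_mult)
      qed
      then show ?thesis by (subst nn_integral_sum) (auto intro!: sum.cong nn_integral_cmult)
    qed
    also have "\<dots> \<le> (\<Sum>i\<in>I. ennreal (c i) * ennreal (360 * K * (1 + \<tau> i) powr - (2 - 1 / p - B)))"
      unfolding A_def by (intro sum_mono mult_left_mono green_bound_bilinear[OF p v K le B I(3) G G0 G1]) auto
    also have "\<dots> = ennreal (\<Sum>i\<in>I. c i * (360 * K * (1 + \<tau> i) powr - (2 - 1 / p - B)))"
      using I K by (subst sum_ennreal[symmetric]) (auto intro!: sum.cong simp: ennreal_mult)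
    also have "(\<Sum>i\<in>I. c i * (360 * K * (1 + \<tau> i) powr - (2 - 1 / p - B))) = Z"
      by (simp add: Z_def B_def sum_distrib_left mult_ac algebra_simps)
    finally show ?thesis using Z0 by simp
  qed
  \<comment> \<open>\<open>J\<close> was computed with Lebesgue measure; normalising by
    \<open>1 / \<pi>\<close> only lowers the norm.\<close>
  moreover have "1 / pi * J \<le> 1 * J"
    using J0 pi_gt3 by (intro mult_right_mono) auto
  then have "(1 / pi * J) powr (1 / b') \<le> J powr (1 / b')"
    using J0 b' by (intro powr_mono2) auto
  ultimately have "lp_norm (ereal b') h \<le> ennreal Z"
    using b' by (subst lp_norm_eq[OF _ hL]) (auto simp: J_def[symmetric] intro: ennreal_leI)
  then show ?thesis unfolding rb using b' by (simp add: Z_def)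
qed

section \<open>Square roots of the spectral parameter\<close>

lemma square_root_upper_half_plane: "\<exists>\<mu>. \<mu> ^ 2 = \<nu> \<and> 0 \<le> Im \<mu>" for \<nu> :: complex
proof (cases "0 \<le> Im (csqrt \<nu>)")
  case False
  then show ?thesis by (intro exI[of _ "- csqrt \<nu>"]) auto
qed (auto intro: exI[of _ "csqrt \<nu>"])

text \<open>From \<open>Im (\<mu>^2) = 2 Re \<mu> Im \<mu>\<close>, with \<open>|Re \<mu>|\<close>
  bounded by \<open>|\<mu>|\<close>.\<close>

lemma Im_square_root_ge:
  assumes "\<mu> ^ 2 = \<nu>" "0 \<le> Im \<mu>"
  shows "\<bar>Im \<nu>\<bar> \<le> 2 * sqrt (norm \<nu>) * Im \<mu>"
proof -
  have "norm \<mu> ^ 2 = norm \<nu>" using assms(1) by (metis norm_power)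
  then have n: "norm \<mu> = sqrt (norm \<nu>)" by (metis norm_ge_zero real_sqrt_unique)
  have "Im \<nu> = 2 * Re \<mu> * Im \<mu>" using assms(1) by (auto simp: power2_eq_square)
  then have "\<bar>Im \<nu>\<bar> = 2 * \<bar>Re \<mu>\<bar> * Im \<mu>" using assms(2) by (simp add: abs_mult)
  also have "\<dots> \<le> 2 * norm \<mu> * Im \<mu>"
    using assms(2) abs_Re_le_cmod[of \<mu>] by (intro mult_right_mono mult_left_mono) auto
  finally show ?thesis by (simp add: n)
qed

text \<open>At height 1/4 the exponent \<open>2 \<pi> Im \<mu>\<close> is at least 1, so the
  exponential has modulus at most 1/2.\<close>

lemma far_from_spectrum_large_Im:
  assumes "1 / 4 \<le> Im \<mu>"
  shows "far_from_spectrum \<mu>"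
proof -
  have "1 / 2 \<le> 2 * pi * Im \<mu>" 
    using mult_mono[of 2 "2 * pi" "1 / 4" "Im \<mu>"] assms pi_gt3 by auto
  have e: "2 \<le> exp (2 * pi * Im \<mu>)"
  proof -
    have "1 \<le> 2 * pi * Im \<mu>"
      using mult_mono[of "2 * 3" "2 * pi" "1 / 4" "Im \<mu>"] assms pi_gt3 by auto
    then show ?thesis using exp_ge_add_one_self[of "2 * pi * Im \<mu>"] by linarith
  qed
  have "norm (exp (2 * \<i> * of_real pi * \<mu>)) = exp (- (2 * pi * Im \<mu>))"
    by (simp add: norm_exp_eq_Re)
  also have "\<dots> \<le> 1 / 2" using e by (simp add: exp_minus inverse_eq_divide field_simps)
  finally have "norm (exp (2 * \<i> * of_real pi * \<mu>)) \<le> 1 / 2" .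
  then have "1 / 2 \<le> norm (1 - exp (2 * \<i> * of_real pi * \<mu>))"
    using norm_triangle_ineq2[of 1 "exp (2 * \<i> * of_real pi * \<mu>)"] by simp
  moreover have "\<mu> \<noteq> 0" using assms by auto
  ultimately show ?thesis using assms by (simp add: far_from_spectrum_def)
qed

text \<open>The line runs between the squares of \<open>N\<close> and \<open>N + 1\<close>. If
  \<open>Im \<mu>\<close> is below 1/4, then \<open>|Re \<mu>|\<close> lies between
  \<open>N + 1/4\<close> and \<open>N + 1/2\<close>; the angle \<open>2 \<pi> |Re \<mu>|\<close> is
  then in the second quadrant, and the exponential has nonpositive real part.\<close>

lemma far_from_spectrum_line:
  fixes N :: nat
  assumes N: "1 \<le> N" and \<mu>: "\<mu> ^ 2 = \<nu>" "0 \<le> Im \<mu>" and \<nu>: "Re \<nu> = real N ^ 2 + real N"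
  shows "far_from_spectrum \<mu>" "real N \<le> norm \<mu>"
proof -
  have re: "(Re \<mu>) ^ 2 = real N ^ 2 + real N + (Im \<mu>) ^ 2"
    using \<mu>(1) \<nu> by (auto simp: power2_eq_square algebra_simps)
  have "real N ^ 2 \<le> \<bar>Re \<mu>\<bar> ^ 2" using re by simp
  then have "real N \<le> \<bar>Re \<mu>\<bar>" by (rule power2_le_imp_le) simp
  then show n: "real N \<le> norm \<mu>" using abs_Re_le_cmod[of \<mu>] by linarith
  show "far_from_spectrum \<mu>"
  proof (cases "1 / 4 \<le> Im \<mu>")
    case True
    then show ?thesis by (rule far_from_spectrum_large_Im)
  next
    case False
    then have "(Im \<mu>) ^ 2 \<le> (1 / 4) ^ 2" using \<mu>(2) by (intro power_mono) auto
    then have "\<bar>Re \<mu>\<bar> ^ 2 \<le> (real N + 1 / 2) ^ 2" using re by (simp add: power2_eq_square algebra_simps)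
    then have up: "\<bar>Re \<mu>\<bar> \<le> real N + 1 / 2" by (rule power2_le_imp_le) simp
    have "(real N + 1 / 4) ^ 2 \<le> \<bar>Re \<mu>\<bar> ^ 2"
    proof -
      have "(real N + 1 / 4) ^ 2 = real N ^ 2 + real N / 2 + 1 / 16" by (simp add: power2_eq_square algebra_simps)
      moreover have "\<bar>Re \<mu>\<bar> ^ 2 = real N ^ 2 + real N + (Im \<mu>) ^ 2" using re by simp
      moreover have "1 \<le> real N" using N by simp
      ultimately show ?thesis using zero_le_power2[of "Im \<mu>"] by linarith
    qed
    then have lo: "real N + 1 / 4 \<le> \<bar>Re \<mu>\<bar>" by (rule power2_le_imp_le) simp
    define \<theta> where "\<theta> = 2 * pi * (\<bar>Re \<mu>\<bar> - real N)"
    have "pi / 2 \<le> \<theta>" "\<theta> \<le> pi"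
      using mult_left_mono[of "1 / 4" "\<bar>Re \<mu>\<bar> - real N" "2 * pi"] mult_left_mono[of "\<bar>Re \<mu>\<bar> - real N" "1 / 2" "2 * pi"] up lo
      by (auto simp: \<theta>_def)
    then have c: "cos \<theta> \<le> 0"
      using cos_monotone_0_pi_le[of "pi / 2" \<theta>] by simp
    have "cos (2 * pi * Re \<mu>) = cos (2 * pi * \<bar>Re \<mu>\<bar>)"
      by (cases "0 \<le> Re \<mu>") auto
    also have "2 * pi * \<bar>Re \<mu>\<bar> = \<theta> + of_nat N * (2 * pi)"
      by (simp add: \<theta>_def algebra_simps)
    also have "cos \<dots> = cos \<theta>"
      using cos.plus_of_nat[of \<theta> N] by simp
    finally have c2: "cos (2 * pi * Re \<mu>) \<le> 0" using c by simp
    have "Re (exp (2 * \<i> * of_real pi * \<mu>)) = exp (- (2 * pi * Im \<mu>)) * cos (2 * pi * Re \<mu>)"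
      by (simp add: Re_exp)
    also have "\<dots> \<le> 0" using c2 by (intro mult_nonneg_nonpos) auto
    finally have "1 \<le> Re (1 - exp (2 * \<i> * of_real pi * \<mu>))" by simp
    then have "1 / 2 \<le> norm (1 - exp (2 * \<i> * of_real pi * \<mu>))"
      using complex_Re_le_cmod[of "1 - exp (2 * \<i> * of_real pi * \<mu>)"] by linarith
    moreover have "\<mu> \<noteq> 0" using n N by auto
    ultimately show ?thesis using \<mu>(2) by (simp add: far_from_spectrum_def)
  qed
qed

text \<open>Far to the left, \<open>(Im \<mu>)^2\<close> is at least \<open>- Re \<nu>\<close>. Far
  above or below, \<open>|\<nu>|\<close> is comparable with \<open>|Im \<nu>|\<close>, and the
  product formula for \<open>Im \<nu>\<close> gives the root.\<close>

lemma outer_region: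
  assumes \<mu>: "\<mu> ^ 2 = \<nu>" "0 \<le> Im \<mu>" and H: "1 \<le> H" and \<nu>: "Re \<nu> \<le> H" "Re \<nu> \<le> - H \<or> H \<le> \<bar>Im \<nu>\<bar>"
  shows "sqrt H / 4 \<le> Im \<mu>" "H \<le> norm \<nu>"
proof -
  show n: "H \<le> norm \<nu>"
    using \<nu>(2) abs_Re_le_cmod[of \<nu>] abs_Im_le_cmod[of \<nu>] by linarith
  show "sqrt H / 4 \<le> Im \<mu>"
  proof (cases "Re \<nu> \<le> - H")
    case True
    have "Re \<nu> = (Re \<mu>) ^ 2 - (Im \<mu>) ^ 2" using \<mu>(1) by (auto simp: power2_eq_square)
    then have "H \<le> (Im \<mu>) ^ 2" using True zero_le_power2[of "Re \<mu>"] by linarith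
    then have "sqrt H \<le> Im \<mu>" using \<mu>(2) by (intro real_le_lsqrt) (use H in auto)
    moreover have "0 \<le> sqrt H" using H by simp
    ultimately show ?thesis by linarith
  next
    case False
    then have i: "H \<le> \<bar>Im \<nu>\<bar>" "\<bar>Re \<nu>\<bar> \<le> \<bar>Im \<nu>\<bar>" using \<nu> by auto
    have "norm \<nu> \<le> 4 * \<bar>Im \<nu>\<bar>" using cmod_le[of \<nu>] i by linarith
    then have "sqrt (norm \<nu>) \<le> sqrt (2 ^ 2 * \<bar>Im \<nu>\<bar>)" by (intro real_sqrt_le_mono) simp
    also have "\<dots> = 2 * sqrt \<bar>Im \<nu>\<bar>" by (simp add: real_sqrt_mult)
    finally have s: "sqrt (norm \<nu>) \<le> 2 * sqrt \<bar>Im \<nu>\<bar>" .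
    have pos: "0 < sqrt \<bar>Im \<nu>\<bar>" using i H by simp
    have "sqrt \<bar>Im \<nu>\<bar> * sqrt \<bar>Im \<nu>\<bar> = \<bar>Im \<nu>\<bar>" by simp
    also have "\<dots> \<le> 2 * sqrt (norm \<nu>) * Im \<mu>" by (rule Im_square_root_ge[OF \<mu>])
    also have "\<dots> \<le> 2 * (2 * sqrt \<bar>Im \<nu>\<bar>) * Im \<mu>"
      using s \<mu>(2) by (intro mult_right_mono mult_left_mono) auto
    also have "\<dots> = sqrt \<bar>Im \<nu>\<bar> * (4 * Im \<mu>)" by simp
    finally have "sqrt \<bar>Im \<nu>\<bar> \<le> 4 * Im \<mu>" using pos by (rule mult_left_le_imp_le)
    moreover have "sqrt H \<le> sqrt \<bar>Im \<nu>\<bar>" using i by simp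
    ultimately show ?thesis by linarith
  qed
qed

text \<open>On the line, \<open>|\<nu>|\<close> is at most \<open>4 N^2\<close> while
  \<open>y\<close> is below \<open>N^2\<close> and at most \<open>4 y\<close> beyond. Hence the
  lower bound grows linearly in \<open>y\<close> first and then like its square root.\<close>

lemma Im_square_root_line:
  fixes N :: nat
  assumes N: "1 \<le> N" and \<mu>: "\<mu> ^ 2 = \<nu>" "0 \<le> Im \<mu>" and \<nu>: "Re \<nu> = real N ^ 2 + real N"
    and y: "y \<le> \<bar>Im \<nu>\<bar>" "\<bar>Im \<nu>\<bar> \<le> 2 * y" "0 < y"
  shows "y \<le> real N ^ 2 \<Longrightarrow> y / (4 * real N) \<le> Im \<mu>"
    and "real N ^ 2 \<le> y \<Longrightarrow> sqrt y / 4 \<le> Im \<mu>"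
proof -
  have NN: "real N \<le> real N ^ 2" using N by (simp add: power2_eq_square)
  have "\<bar>Re \<nu>\<bar> = real N ^ 2 + real N" using \<nu> by simp
  then have n: "norm \<nu> \<le> 2 * real N ^ 2 + 2 * y" using cmod_le[of \<nu>] y NN by linarith
  have key: "y / (2 * s) \<le> Im \<mu>" if "sqrt (norm \<nu>) \<le> s" "0 < s" for s
  proof -
    have "y \<le> 2 * sqrt (norm \<nu>) * Im \<mu>" using Im_square_root_ge[OF \<mu>] y by linarith
    also have "\<dots> \<le> 2 * s * Im \<mu>" using that \<mu>(2) by (intro mult_right_mono mult_left_mono) auto
    finally show ?thesis using that by (simp add: pos_divide_le_eq mult_ac)
  qed
  show "y / (4 * real N) \<le> Im \<mu>" if "y \<le> real N ^ 2"
  proof -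
    have "norm \<nu> \<le> (2 * real N) ^ 2" using n that by (simp add: power2_eq_square)
    then have "sqrt (norm \<nu>) \<le> 2 * real N" by (intro real_le_lsqrt) auto
    from key[OF this] N show ?thesis by simp
  qed
  show "sqrt y / 4 \<le> Im \<mu>" if "real N ^ 2 \<le> y"
  proof -
    have "norm \<nu> \<le> (2 * sqrt y) ^ 2" using n that y by (simp add: power_mult_distrib)
    then have "sqrt (norm \<nu>) \<le> 2 * sqrt y" using y by (intro real_le_lsqrt) auto
    from key[OF this] y have "y / (2 * (2 * sqrt y)) \<le> Im \<mu>" by simp
    moreover have "y / (2 * (2 * sqrt y)) = sqrt y / 4"
      using y by (simp add: field_simps)
    ultimately show ?thesis by simp
  qed
qed

section \<open>Deformation of the contour\<close>

lemma encloses_iff: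
  "encloses_low_eigenvalues bc v N \<omega> h \<longleftrightarrow>
     (\<forall>\<mu>. hill_eigenvalue bc v \<mu> \<and> Re \<mu> \<le> real N ^ 2 + real N \<longrightarrow>
        - \<omega> < Re \<mu> \<and> Re \<mu> < real N ^ 2 + real N \<and> - h < Im \<mu> \<and> Im \<mu> < h)"
  unfolding encloses_low_eigenvalues_def corner_ll_def corner_ur_def
  by (auto simp: interior_cbox in_box_complex_iff)

abbreviation rect :: "nat \<Rightarrow> real \<Rightarrow> real \<Rightarrow> real \<Rightarrow> complex" where
  "rect N \<omega> h \<equiv> rectpath (corner_ll \<omega> h) (corner_ur N h)"

context hill_potential
begin

lemma rect_regular:
  assumes "encloses_low_eigenvalues bc v N \<omega> h" "\<omega> > 0" "h > 0"
  shows "path_image (rect N \<omega> h) \<subseteq> {\<mu>. regular \<mu>}"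
proof
  fix \<mu> assume \<mu>: "\<mu> \<in> path_image (rect N \<omega> h)"
  have X: "0 \<le> real N ^ 2 + real N" by simp
  have "\<mu> \<in> {z. Re z \<in> {- \<omega>, real N ^ 2 + real N} \<and> Im z \<in> {- h..h}} \<union>
      {z. Im z \<in> {- h, h} \<and> Re z \<in> {- \<omega>..real N ^ 2 + real N}}"
  proof -
    have "- \<omega> \<le> real N ^ 2 + real N" "- h \<le> h" using X assms by linarith+
    then show ?thesis
      using \<mu> path_image_rectpath[of "corner_ll \<omega> h" "corner_ur N h"] by (simp add: corner_ll_def corner_ur_def)
  qed
  moreover have "- \<omega> \<le> real N ^ 2 + real N" using X assms by linarith
  ultimately have "Re \<mu> \<le> real N ^ 2 + real N"
    "\<not> (- \<omega> < Re \<mu> \<and> Re \<mu> < real N ^ 2 + real N \<and> - h < Im \<mu> \<and> Im \<mu> < h)"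
    by auto
  then show "\<mu> \<in> {\<mu>. regular \<mu>}" using assms(1) unfolding encloses_iff by blast
qed

text \<open>The regular set is not simply connected, so the global Cauchy theorem is applied to a
  closed path \<open>P\<close>: around the small rectangle, along a segment to the large one, around
  that one backwards, and home again.\<close>

lemma contour_R_enlarge:
  assumes e: "encloses_low_eigenvalues bc v N \<omega> h" and pos: "\<omega> > 0" "h > 0" and le: "\<omega> \<le> \<omega>'" "h \<le> h'"
    and f: "f absolutely_integrable_on {0..pi}" and x: "x \<in> {0..pi}"
  shows "contour_R (rect N \<omega> h) f x = contour_R (rect N \<omega>' h') f x"
proof -
  have X: "0 \<le> real N ^ 2 + real N" by simp
  have e': "encloses_low_eigenvalues bc v N \<omega>' h'"
    using e le unfolding encloses_iff by (meson le_less_trans less_le_trans neg_le_iff_le)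
  have r1: "path_image (rect N \<omega> h) \<subseteq> {\<mu>. regular \<mu>}" by (rule rect_regular[OF e pos])
  have r2: "path_image (rect N \<omega>' h') \<subseteq> {\<mu>. regular \<mu>}" by (rule rect_regular[OF e']) (use pos le in auto)
  define c1 c2 where "c1 = corner_ll \<omega> h" and "c2 = corner_ll \<omega>' h'"
  define S where "S = {\<mu>. regular \<mu>}"
  \<comment> \<open>The segment joins the lower left corners and stays in
    \<open>Re \<le> - \<omega>\<close>, where no eigenvalue lies.\<close>
  have seg: "closed_segment c1 c2 \<subseteq> S"
  proof
    fix z assume "z \<in> closed_segment c1 c2"
    then obtain u where u: "0 \<le> u" "u \<le> 1" "z = (1 - u) *\<^sub>R c1 + u *\<^sub>R c2" unfolding closed_segment_def by auto
    have "Re z = - ((1 - u) * \<omega> + u * \<omega>')" by (simp add: u c1_def c2_def corner_ll_def algebra_simps)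
    moreover have "\<omega> \<le> (1 - u) * \<omega> + u * \<omega>'"
      using mult_left_mono[OF le(1) u(1)] by (simp add: algebra_simps)
    ultimately have "Re z \<le> - \<omega>" by simp
    moreover from this have "Re z \<le> real N ^ 2 + real N" using pos X by linarith
    ultimately show "z \<in> S" using e unfolding encloses_iff S_def by force
  qed
  define P where "P = (rect N \<omega> h +++ linepath c1 c2) +++ (reversepath (rect N \<omega>' h') +++ linepath c2 c1)"
  have vp: "valid_path (rect N \<omega> h +++ linepath c1 c2)" "valid_path (reversepath (rect N \<omega>' h') +++ linepath c2 c1)"
    by (auto intro!: valid_path_join simp: c1_def c2_def valid_path_rectpath)
  have vP: "valid_path P" unfolding P_def by (rule valid_path_join[OF vp]) (simp add: c1_def c2_def)
  have hol: "(\<lambda>\<mu>. R \<mu> f x) holomorphic_on S" unfolding S_def by (rule R_holomorphic[OF f x])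
  have oS: "open S" unfolding S_def by (rule open_regular)
  have im: "path_image P \<subseteq> S"
    using r1 r2 seg unfolding P_def S_def[symmetric]
    by (auto simp: path_image_join c1_def c2_def closed_segment_commute)
  \<comment> \<open>An eigenvalue left of the line is inside both rectangles, one to its right is
    outside both, and the connecting segment is traversed in both directions.\<close>
  have wn: "winding_number P w = 0" if w: "w \<notin> S" for w
  proof -
    have nin: "w \<notin> path_image (rect N \<omega> h)" "w \<notin> path_image (rect N \<omega>' h')" "w \<notin> closed_segment c1 c2"
      using r1 r2 seg w unfolding S_def[symmetric] by auto
    have "winding_number (rect N \<omega> h) w = winding_number (rect N \<omega>' h') w"
    proof (cases "Re w \<le> real N ^ 2 + real N")
      case True
      have "w \<in> box (corner_ll \<omega> h) (corner_ur N h)" "w \<in> box (corner_ll \<omega>' h') (corner_ur N h')"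
        using e e' w True unfolding encloses_iff S_def by (auto simp: in_box_complex_iff corner_ll_def corner_ur_def)
      then show ?thesis by (simp add: winding_number_rectpath)
    next
      case False
      then have "w \<notin> cbox (corner_ll \<omega> h) (corner_ur N h)" "w \<notin> cbox (corner_ll \<omega>' h') (corner_ur N h')"
        by (auto simp: in_cbox_complex_iff corner_ll_def corner_ur_def)
      moreover have "- \<omega> \<le> real N ^ 2 + real N" "- \<omega>' \<le> real N ^ 2 + real N" "- h \<le> h" "- h' \<le> h'"
        using pos le X by linarith+
      ultimately have "winding_number (rect N \<omega> h) w = 0" "winding_number (rect N \<omega>' h') w = 0"
        by (auto intro!: winding_number_rectpath_outside simp: corner_ll_def corner_ur_def)
      then show ?thesis by simp
    qed
    moreover have "winding_number P w = winding_number (rect N \<omega> h) w + winding_number (linepath c1 c2) w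
        + (- winding_number (rect N \<omega>' h') w + winding_number (linepath c2 c1) w)"
      unfolding P_def using nin
      by (simp add: winding_number_join winding_number_reversepath path_image_join c1_def c2_def closed_segment_commute)
    moreover have "winding_number (linepath c2 c1) w = - winding_number (linepath c1 c2) w"
      using winding_number_reversepath[of "linepath c1 c2" w] nin by simp
    ultimately show ?thesis by simp
  qed
  have "((\<lambda>\<mu>. R \<mu> f x) has_contour_integral 0) P"
    by (rule Cauchy_theorem_global[OF oS hol vP _ im wn]) (simp_all add: P_def c1_def c2_def)
  moreover have ci: "(\<lambda>\<mu>. R \<mu> f x) contour_integrable_on rect N \<omega> h" "(\<lambda>\<mu>. R \<mu> f x) contour_integrable_on rect N \<omega>' h'"
    "(\<lambda>\<mu>. R \<mu> f x) contour_integrable_on linepath c1 c2" "(\<lambda>\<mu>. R \<mu> f x) contour_integrable_on linepath c2 c1"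
    using r1 r2 seg unfolding S_def[symmetric]
    by (auto intro!: contour_integrable_holomorphic_simple[OF hol oS] simp: valid_path_rectpath closed_segment_commute)
  have "contour_integral P (\<lambda>\<mu>. R \<mu> f x) = contour_integral (rect N \<omega> h) (\<lambda>\<mu>. R \<mu> f x) + contour_integral (linepath c1 c2) (\<lambda>\<mu>. R \<mu> f x)
      + (- contour_integral (rect N \<omega>' h') (\<lambda>\<mu>. R \<mu> f x) + contour_integral (linepath c2 c1) (\<lambda>\<mu>. R \<mu> f x))"
    unfolding P_def using ci
    by (simp add: contour_integral_join contour_integrable_join contour_integrable_reversepath
        contour_integral_reversepath valid_path_rectpath vp c1_def c2_def)
  moreover have "contour_integral (linepath c2 c1) (\<lambda>\<mu>. R \<mu> f x) = - contour_integral (linepath c1 c2) (\<lambda>\<mu>. R \<mu> f x)"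
    using contour_integral_reversepath[of "linepath c1 c2"] by simp
  ultimately show ?thesis
    unfolding contour_R_def by (simp add: contour_integral_unique)
qed

end

section \<open>Summation over the dyadic pieces of the contour\<close>

text \<open>The three cases of the theorem in terms of \<gamma>: since
  \<open>1 / r = 1 - \<gamma> / 2\<close>, the threshold r = 2 is \<gamma> = 1.\<close>

definition decay_rate :: "real \<Rightarrow> nat \<Rightarrow> real" where
  "decay_rate \<gamma> N = (if \<gamma> > 1 then 1 / real N else if \<gamma> = 1 then ln (real N) / real N else real N powr - \<gamma>)"

text \<open>Lower bounds for \<open>\<bar>\<lambda>\<bar>\<close> and \<open>Im \<surd>\<lambda>\<close> on the part
  \<open>2\<^sup>i N \<le> \<bar>Im \<lambda>\<bar> \<le> 2\<^sup>i\<^sup>+\<^sup>1 N\<close> of the line \<open>Re \<lambda> = N\<^sup>2 + N\<close>.\<close>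

definition dyadic_abs :: "nat \<Rightarrow> nat \<Rightarrow> real" where
  "dyadic_abs N i = max (real N ^ 2) (2 ^ i * real N)"

definition dyadic_tau :: "nat \<Rightarrow> nat \<Rightarrow> real" where
  "dyadic_tau N i = (if 2 ^ i \<le> real N then 2 ^ i / 4 else sqrt (2 ^ i * real N) / 4)"

text \<open>The factor \<open>1 / ln 2\<close> answers for \<gamma> = 1, where \<open>ln N\<close>
  may be as small as \<open>ln 2\<close>; for \<open>N = 1\<close> the rate would be 0.\<close>

lemma decay_rate_ge:
  assumes "2 \<le> N"
  shows "1 / real N \<le> 1 / ln 2 * decay_rate \<gamma> N" "real N powr - \<gamma> \<le> 1 / ln 2 * decay_rate \<gamma> N" "0 < decay_rate \<gamma> N"
proof -
  have N: "1 < real N" "2 \<le> real N" using assms by auto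
  have l2: "0 < ln (2::real)" "1 \<le> 1 / ln (2::real)" using ln_2_less_1 by auto
  have lN: "ln 2 \<le> ln (real N)" using N by simp
  show r: "0 < decay_rate \<gamma> N" using N by (simp add: decay_rate_def)
  have up: "d \<le> 1 / ln 2 * decay_rate \<gamma> N" if "d \<le> decay_rate \<gamma> N" for d
    using that mult_right_mono[OF l2(2), of "decay_rate \<gamma> N"] r by simp
  have m1: "1 / real N = real N powr - 1" using N by (simp add: powr_minus inverse_eq_divide)
  consider "\<gamma> > 1" | "\<gamma> = 1" | "\<gamma> < 1" by linarith
  then have "1 / real N \<le> 1 / ln 2 * decay_rate \<gamma> N \<and> real N powr - \<gamma> \<le> 1 / ln 2 * decay_rate \<gamma> N"
  proof cases
    case 1
    then have "real N powr - \<gamma> \<le> 1 / real N" unfolding m1 using N by (intro powr_mono) auto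
    then show ?thesis using 1 by (intro conjI up) (simp_all add: decay_rate_def)
  next
    case 2
    have "ln 2 * (1 / real N) \<le> ln (real N) * (1 / real N)" using lN N by (intro mult_right_mono) auto
    then have "1 / real N \<le> 1 / ln 2 * (ln (real N) / real N)"
    proof -
      have "1 / real N \<le> ln (real N) * (1 / real N) / ln 2"
        unfolding pos_le_divide_eq[OF l2(1)]
        using \<open>ln 2 * (1 / real N) \<le> ln (real N) * (1 / real N)\<close> by (simp only: mult.commute)
      then show ?thesis by (simp add: mult.commute)
    qed
    moreover have "decay_rate \<gamma> N = ln (real N) / real N" "real N powr - \<gamma> = 1 / real N"
      using 2 m1 by (simp_all only: decay_rate_def less_irrefl if_False if_True simp_thms)
    ultimately show ?thesis by (simp only: simp_thms)
  next
    case 3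
    then have "1 / real N \<le> real N powr - \<gamma>" unfolding m1 using N by (intro powr_mono) auto
    then show ?thesis using 3 by (intro conjI up) (simp_all add: decay_rate_def)
  qed
  then show "1 / real N \<le> 1 / ln 2 * decay_rate \<gamma> N" "real N powr - \<gamma> \<le> 1 / ln 2 * decay_rate \<gamma> N" by auto
qed

lemma sum_power_less_le:
  fixes \<rho> :: real
  assumes "0 \<le> \<rho>" "\<rho> < 1"
  shows "(\<Sum>i\<in>{m..<n}. \<rho> ^ i) \<le> \<rho> ^ m / (1 - \<rho>)"
proof (cases "m \<le> n")
  case True
  have "(1 - \<rho>) * (\<Sum>i\<in>{m..<n}. \<rho> ^ i) = \<rho> ^ m - \<rho> ^ n"
    using True
  proof (induction n rule: dec_induct)
    case (step k)
    have "(1 - \<rho>) * (\<Sum>i\<in>{m..<Suc k}. \<rho> ^ i) = (1 - \<rho>) * (\<Sum>i\<in>{m..<k}. \<rho> ^ i) + (1 - \<rho>) * \<rho> ^ k"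
      using step.hyps by (simp add: distrib_left)
    also have "\<dots> = \<rho> ^ m - \<rho> ^ Suc k" unfolding step.IH by (simp add: algebra_simps)
    finally show ?case .
  qed simp
  also have "\<dots> \<le> \<rho> ^ m" using assms by simp
  finally show ?thesis using assms by (simp add: pos_le_divide_eq mult.commute)
qed (use assms in simp)

text \<open>The origin of the three regimes: the geometric ratio
  \<open>2 powr (1 - \<gamma>)\<close> is below, equal to or above 1. The sum is then bounded, of
  the order of the number \<open>m\<close> of terms (about \<open>log N\<close>), or of the order of
  its last term.\<close>

lemma dyadic_head_bound:
  assumes "\<gamma> > 0"
  obtains C where "C > 0" "\<And>N m. 2 \<le> N \<Longrightarrow> 2 ^ m \<le> 2 * real N \<Longrightarrow>
     1 / real N * (\<Sum>i<m. (2 powr (1 - \<gamma>)) ^ i) \<le> C * decay_rate \<gamma> N"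
proof -
  define s where "s = 2 powr (1 - \<gamma>)"
  have s: "s > 0" by (simp add: s_def)
  consider "\<gamma> > 1" | "\<gamma> = 1" | "\<gamma> < 1" by linarith
  then have "\<exists>C>0. \<forall>N m. 2 \<le> N \<longrightarrow> 2 ^ m \<le> 2 * real N \<longrightarrow>
     1 / real N * (\<Sum>i<m. s ^ i) \<le> C * decay_rate \<gamma> N"
  proof cases
    case 1
    then have s1: "s < 1" by (simp add: s_def powr_less_one)
    have "1 / real N * (\<Sum>i<m. s ^ i) \<le> 1 / (1 - s) * decay_rate \<gamma> N" if "2 \<le> N" for N m
    proof -
      have "(\<Sum>i<m. s ^ i) \<le> 1 / (1 - s)"
        using sum_power_less_le[of s 0 m] s s1 by (simp add: atLeast0LessThan)
      then have "1 / real N * (\<Sum>i<m. s ^ i) \<le> 1 / real N * (1 / (1 - s))" by (intro mult_left_mono) auto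
      then show ?thesis using 1 by (simp add: decay_rate_def mult.commute)
    qed
    then show ?thesis using s1 by (intro exI[of _ "1 / (1 - s)"]) auto
  next
    case 2
    then have s1: "s = 1" by (simp add: s_def)
    have "1 / real N * (\<Sum>i<m. s ^ i) \<le> 2 / ln 2 * decay_rate \<gamma> N" if N: "2 \<le> N" and m: "2 ^ m \<le> 2 * real N" for N m
    proof -
      have "ln (2 ^ m) \<le> ln (2 * real N)" using m N by simp
      then have "real m * ln 2 \<le> ln 2 + ln (real N)" using N by (simp add: ln_realpow ln_mult)
      also have "\<dots> \<le> 2 * ln (real N)" using N by simp
      finally have "real m \<le> 2 / ln 2 * ln (real N)" by (simp add: field_simps)
      then have "1 / real N * real m \<le> 1 / real N * (2 / ln 2 * ln (real N))" by (intro mult_left_mono) auto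
      then show ?thesis using 2 s1 by (simp add: decay_rate_def mult.commute)
    qed
    then show ?thesis by (intro exI[of _ "2 / ln 2"]) auto
  next
    case 3
    then have s1: "s > 1" by (simp add: s_def)
    have "1 / real N * (\<Sum>i<m. s ^ i) \<le> 2 powr (1 - \<gamma>) / (s - 1) * decay_rate \<gamma> N" if N: "2 \<le> N" and m: "2 ^ m \<le> 2 * real N" for N m
    proof -
      have "(\<Sum>i<m. s ^ i) = (s ^ m - 1) / (s - 1)"
        using s1 by (simp add: geometric_sum)
      also have "\<dots> \<le> s ^ m / (s - 1)" using s1 by (intro divide_right_mono) auto
      also have "s ^ m = (2 ^ m) powr (1 - \<gamma>)"
        by (simp add: s_def powr_powr powr_realpow[symmetric] mult.commute)
      also have "(2 ^ m) powr (1 - \<gamma>) / (s - 1) \<le> (2 * real N) powr (1 - \<gamma>) / (s - 1)"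
        using m 3 s1 by (intro divide_right_mono powr_mono2) auto
      finally have "1 / real N * (\<Sum>i<m. s ^ i) \<le> 1 / real N * ((2 * real N) powr (1 - \<gamma>) / (s - 1))"
        by (intro mult_left_mono) auto
      also have "\<dots> = 2 powr (1 - \<gamma>) / (s - 1) * real N powr - \<gamma>"
      proof -
        have "real N powr (1 - \<gamma>) = real N * real N powr - \<gamma>"
          using N powr_add[of "real N" 1 "- \<gamma>"] by simp
        then show ?thesis using N by (simp add: powr_mult)
      qed
      finally show ?thesis using 3 by (simp add: decay_rate_def)
    qed
    then show ?thesis using s1 by (intro exI[of _ "2 powr (1 - \<gamma>) / (s - 1)"]) auto
  qed
  then show thesis using that unfolding s_def by blast
qed

text \<open>Up to \<open>2^i = N\<close> the modulus is about \<open>N^2\<close> and \<tau> about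
  \<open>2^i\<close>, which leaves the sum treated before. Beyond that, length and modulus cancel
  and \<tau> is about \<open>sqrt (2^i N)\<close>, so the terms decay with ratio
  \<open>2 powr (- (\<gamma> / 2))\<close> from about \<open>N powr - \<gamma>\<close>. The first
  and last summands are the middle segment and the other three sides.\<close>

lemma dyadic_sum_bound:
  assumes \<gamma>: "\<gamma> > 0"
  obtains C where "C > 0" "\<And>N M. 2 \<le> N \<Longrightarrow> real N ^ 2 \<le> 2 ^ M * real N \<Longrightarrow>
     2 / real N + (\<Sum>i<M. 2 * (2 ^ i * real N) / dyadic_abs N i * (1 + dyadic_tau N i) powr - \<gamma>)
       + 6 * (1 + sqrt (2 ^ M * real N) / 4) powr - \<gamma> \<le> C * decay_rate \<gamma> N"
proof -
  obtain C1 where C1: "C1 > 0" "\<And>N m. 2 \<le> N \<Longrightarrow> 2 ^ m \<le> 2 * real N \<Longrightarrow>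
     1 / real N * (\<Sum>i<m. (2 powr (1 - \<gamma>)) ^ i) \<le> C1 * decay_rate \<gamma> N"
    by (rule dyadic_head_bound[OF \<gamma>]) (rule that)
  define \<rho> where "\<rho> = 2 powr (- (\<gamma> / 2))"
  have \<rho>: "0 < \<rho>" "\<rho> < 1" using \<gamma> by (auto simp: \<rho>_def powr_less_one)
  define L where "L = 1 / ln (2 :: real)"
  have L: "L > 0" by (simp add: L_def)
  define q where "q = 4 powr \<gamma>"
  have q: "q > 0" by (simp add: q_def)
  define C where "C = 2 * L + (2 * q * C1 + 2 * q * (1 / (1 - \<rho>)) * L) + 6 * q * L"
  have "C > 0" using L q C1 \<rho> unfolding C_def by (intro add_pos_pos mult_pos_pos) auto
  moreover have "2 / real N + (\<Sum>i<M. 2 * (2 ^ i * real N) / dyadic_abs N i * (1 + dyadic_tau N i) powr - \<gamma>)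
       + 6 * (1 + sqrt (2 ^ M * real N) / 4) powr - \<gamma> \<le> C * decay_rate \<gamma> N"
    if N: "2 \<le> N" and M: "real N ^ 2 \<le> 2 ^ M * real N" for N M
  proof -
    define r where "r = decay_rate \<gamma> N"
    have r: "1 / real N \<le> L * r" "real N powr - \<gamma> \<le> L * r" "0 < r"
      using decay_rate_ge[OF N] by (auto simp: r_def L_def)
    have N0: "real N > 0" using N by simp
    have quarter: "(1 + u / 4) powr - \<gamma> \<le> q * u powr - \<gamma>" if "u > 0" for u
    proof -
      have "(1 + u / 4) powr - \<gamma> \<le> (u / 4) powr - \<gamma>"
        using that \<gamma> by (intro powr_mono2') auto
      also have "\<dots> = q * u powr - \<gamma>"
        using that by (simp add: q_def powr_divide powr_minus field_simps)
      finally show ?thesis .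
    qed
    have half: "sqrt w powr - \<gamma> = w powr (- (\<gamma> / 2))" if "w > 0" for w
      using that by (simp add: powr_half_sqrt[symmetric] powr_powr)
    define f where "f i = 2 * (2 ^ i * real N) / dyadic_abs N i * (1 + dyadic_tau N i) powr - \<gamma>" for i
    \<comment> \<open>The index at which \<open>dyadic_tau\<close> changes its form. By minimality
      \<open>2^m\<close> is also at most \<open>2 N\<close>, as the estimate of the head
      requires.\<close>
    define m where "m = (LEAST i. real N < 2 ^ i)"
    have ex: "\<exists>i. real N < 2 ^ i" using real_arch_pow[of 2 "real N"] by auto
    have m: "real N < 2 ^ m" unfolding m_def using ex by (rule LeastI_ex)
    have lt: "2 ^ i \<le> real N" if "i < m" for i
      using not_less_Least[of i "\<lambda>i. real N < 2 ^ i"] that by (auto simp: m_def)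
    have m2: "2 ^ m \<le> 2 * real N"
    proof (cases m)
      case (Suc k)
      then show ?thesis using lt[of k] by simp
    qed (use N in simp)
    have da: "dyadic_abs N i > 0" for i using N0 by (simp add: dyadic_abs_def less_max_iff_disj)
    have f1: "f i \<le> 2 * q * (1 / real N * (2 powr (1 - \<gamma>)) ^ i)" if "i < m" for i
    proof -
      have tau: "dyadic_tau N i = 2 ^ i / 4" using lt[OF that] by (simp add: dyadic_tau_def)
      have "f i \<le> 2 * (2 ^ i * real N) / real N ^ 2 * (q * (2 ^ i) powr - \<gamma>)"
        unfolding f_def tau
      proof (intro mult_mono)
        show "2 * (2 ^ i * real N) / dyadic_abs N i \<le> 2 * (2 ^ i * real N) / real N ^ 2"
          using N0 da by (intro divide_left_mono mult_pos_pos) (auto simp: dyadic_abs_def)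
        show "(1 + 2 ^ i / 4) powr - \<gamma> \<le> q * (2 ^ i) powr - \<gamma>" by (rule quarter) simp
      qed (use N0 in auto)
      also have "\<dots> = 2 * q * (1 / real N * (2 ^ i * (2 ^ i) powr - \<gamma>))"
        using N0 by (simp add: power2_eq_square field_simps)
      also have "2 ^ i * (2 ^ i) powr - \<gamma> = (2 powr (1 - \<gamma>)) ^ i"
      proof -
        have "2 ^ i * (2 ^ i) powr - \<gamma> = (2 ^ i) powr 1 * (2 ^ i) powr - \<gamma>" by simp
        also have "\<dots> = (2 ^ i) powr (1 - \<gamma>)" by (simp only: powr_add[symmetric]) simp
        also have "\<dots> = (2 powr (1 - \<gamma>)) ^ i"
          by (simp add: powr_powr powr_realpow[symmetric] mult.commute)
        finally show ?thesis .
      qed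
      finally show ?thesis .
    qed
    have f2: "f i \<le> 2 * q * (\<rho> ^ i * real N powr (- (\<gamma> / 2)))" if "m \<le> i" for i
    proof -
      have "(2::real) ^ m \<le> 2 ^ i" using that by (intro power_increasing) auto
      then have gt: "\<not> 2 ^ i \<le> real N" using m by linarith
      then have tau: "dyadic_tau N i = sqrt (2 ^ i * real N) / 4" by (simp add: dyadic_tau_def)
      have w: "2 ^ i * real N > 0" using N0 by simp
      have "f i \<le> 2 * (q * sqrt (2 ^ i * real N) powr - \<gamma>)"
        unfolding f_def tau
      proof (intro mult_mono)
        have "2 ^ i * real N \<le> dyadic_abs N i" by (simp add: dyadic_abs_def)
        then show "2 * (2 ^ i * real N) / dyadic_abs N i \<le> 2"
          using da[of i] by (simp add: pos_divide_le_eq)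
        show "(1 + sqrt (2 ^ i * real N) / 4) powr - \<gamma> \<le> q * sqrt (2 ^ i * real N) powr - \<gamma>"
          using w by (intro quarter) simp
      qed auto
      also have "sqrt (2 ^ i * real N) powr - \<gamma> = (2 ^ i) powr (- (\<gamma> / 2)) * real N powr (- (\<gamma> / 2))"
        unfolding half[OF w] using N0 by (simp add: powr_mult)
      also have "(2 ^ i) powr (- (\<gamma> / 2)) = \<rho> ^ i"
        by (simp add: \<rho>_def powr_powr powr_realpow[symmetric] mult.commute)
      finally show ?thesis by (simp add: mult_ac)
    qed
    have f0: "0 \<le> f i" for i using N0 da[of i] by (simp add: f_def)
    have "(\<Sum>i<M. f i) \<le> (\<Sum>i\<in>{..<m} \<union> {m..<M}. f i)"
      using f0 by (intro sum_mono2) auto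
    also have "\<dots> = (\<Sum>i<m. f i) + (\<Sum>i\<in>{m..<M}. f i)"
      by (rule sum.union_disjoint) auto
    also have "\<dots> \<le> (\<Sum>i<m. 2 * q * (1 / real N * (2 powr (1 - \<gamma>)) ^ i)) + (\<Sum>i\<in>{m..<M}. 2 * q * (\<rho> ^ i * real N powr (- (\<gamma> / 2))))"
      using f1 f2 by (intro add_mono sum_mono) auto
    also have "\<dots> = 2 * q * (1 / real N * (\<Sum>i<m. (2 powr (1 - \<gamma>)) ^ i)) + 2 * q * ((\<Sum>i\<in>{m..<M}. \<rho> ^ i) * real N powr (- (\<gamma> / 2)))"
      by (simp only: sum_distrib_left sum_distrib_right)
    also have "\<dots> \<le> 2 * q * (C1 * r) + 2 * q * (1 / (1 - \<rho>) * (L * r))"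
    proof (intro add_mono mult_left_mono)
      show "1 / real N * (\<Sum>i<m. (2 powr (1 - \<gamma>)) ^ i) \<le> C1 * r" unfolding r_def by (rule C1(2)[OF N m2])
      have "(\<Sum>i\<in>{m..<M}. \<rho> ^ i) * real N powr (- (\<gamma> / 2)) \<le> \<rho> ^ m / (1 - \<rho>) * real N powr (- (\<gamma> / 2))"
        using sum_power_less_le[of \<rho> m M] \<rho> by (intro mult_right_mono) auto
      also have "\<rho> ^ m = (2 ^ m) powr (- (\<gamma> / 2))"
        by (simp add: \<rho>_def powr_powr powr_realpow[symmetric] mult.commute)
      also have "(2 ^ m) powr (- (\<gamma> / 2)) / (1 - \<rho>) * real N powr (- (\<gamma> / 2)) \<le> real N powr (- (\<gamma> / 2)) / (1 - \<rho>) * real N powr (- (\<gamma> / 2))"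
        using m N0 \<gamma> \<rho> by (intro mult_right_mono divide_right_mono powr_mono2') auto
      also have "\<dots> = 1 / (1 - \<rho>) * (real N powr (- (\<gamma> / 2)) * real N powr (- (\<gamma> / 2)))" by simp
      also have "real N powr (- (\<gamma> / 2)) * real N powr (- (\<gamma> / 2)) = real N powr - \<gamma>"
        by (simp flip: powr_add)
      also have "1 / (1 - \<rho>) * real N powr - \<gamma> \<le> 1 / (1 - \<rho>) * (L * r)"
        using r(2) \<rho> by (intro mult_left_mono) auto
      finally show "(\<Sum>i\<in>{m..<M}. \<rho> ^ i) * real N powr (- (\<gamma> / 2)) \<le> 1 / (1 - \<rho>) * (L * r)" .
    qed (use q in auto)
    finally have S: "(\<Sum>i<M. f i) \<le> (2 * q * C1 + 2 * q * (1 / (1 - \<rho>)) * L) * r" by (simp add: algebra_simps)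
    have "(1 + sqrt (2 ^ M * real N) / 4) powr - \<gamma> \<le> (1 + real N / 4) powr - \<gamma>"
    proof (rule powr_mono2')
      have "real N \<le> sqrt (2 ^ M * real N)" using M by (rule real_le_rsqrt)
      then show "1 + real N / 4 \<le> 1 + sqrt (2 ^ M * real N) / 4" by simp
    qed (use \<gamma> N0 in auto)
    also have "\<dots> \<le> q * real N powr - \<gamma>" by (rule quarter[OF N0])
    also have "\<dots> \<le> q * (L * r)" using r q by (intro mult_left_mono) auto
    finally have O: "6 * (1 + sqrt (2 ^ M * real N) / 4) powr - \<gamma> \<le> 6 * q * L * r" by simp
    have "2 / real N \<le> 2 * L * r" using r(1) by simp
    then show ?thesis
      using S O unfolding f_def C_def r_def[symmetric] by (simp add: algebra_simps)
  qed
  ultimately show thesis by (rule that)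
qed

text \<open>Induction on \<open>M\<close>: each step attaches two segments of length
  \<open>2^M n\<close>, one below and one above; the base case is the middle segment of length
  \<open>2 n\<close>.\<close>

lemma contour_integral_dyadic_line:
  assumes g: "continuous_on {z. Re z = X} g" and N: "0 < n" and Bc: "0 \<le> Bc" and B: "\<And>i. 0 \<le> B i"
    and gc: "\<And>z. Re z = X \<Longrightarrow> \<bar>Im z\<bar> \<le> n \<Longrightarrow> norm (g z) \<le> Bc"
    and gB: "\<And>z i. i < M \<Longrightarrow> Re z = X \<Longrightarrow> 2 ^ i * n \<le> \<bar>Im z\<bar> \<Longrightarrow> \<bar>Im z\<bar> \<le> 2 ^ Suc i * n \<Longrightarrow> norm (g z) \<le> B i"
  shows "norm (contour_integral (linepath (Complex X (- (2 ^ M * n))) (Complex X (2 ^ M * n))) g)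
           \<le> 2 * n * Bc + (\<Sum>i<M. 2 * (2 ^ i * n) * B i)"
  using gB
proof (induction M)
  have seg: "closed_segment (Complex X s) (Complex X t) = {z. Re z = X \<and> s \<le> Im z \<and> Im z \<le> t}" if "s \<le> t" for s t
    using that by (auto simp: closed_segment_same_Re closed_segment_eq_real_ivl)
  have ci: "g contour_integrable_on linepath (Complex X s) (Complex X t)" if "s \<le> t" for s t
    by (rule contour_integrable_continuous_linepath, rule continuous_on_subset[OF g]) (use that in \<open>auto simp: seg\<close>)
  have len: "norm (Complex X t - Complex X s) = t - s" if "s \<le> t" for s t
    using that by (simp add: cmod_def)
  {
    case 0
    show ?case
    proof -
      have "norm (contour_integral (linepath (Complex X (- n)) (Complex X n)) g) \<le> Bc * norm (Complex X n - Complex X (- n))"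
        by (rule contour_integral_bound_linepath[OF ci Bc]) (use N in \<open>auto simp: seg intro!: gc\<close>)
      then show ?thesis using len[of "- n" n] N by (simp add: mult_ac)
    qed
  next
    case (Suc M)
    define s t where "s = 2 ^ M * n" and "t = 2 ^ Suc M * n"
    have st: "0 < s" "s \<le> t" "t - s = s" using N by (auto simp: s_def t_def)
    have IH: "norm (contour_integral (linepath (Complex X (- s)) (Complex X s)) g) \<le> 2 * n * Bc + (\<Sum>i<M. 2 * (2 ^ i * n) * B i)"
      unfolding s_def by (rule Suc.IH) (use Suc.prems in auto)
    have c: "continuous_on (closed_segment (Complex X u) (Complex X w)) g" if "u \<le> w" for u w
      by (rule continuous_on_subset[OF g]) (use that in \<open>auto simp: seg\<close>)
    have "contour_integral (linepath (Complex X (- t)) (Complex X t)) g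
        = contour_integral (linepath (Complex X (- t)) (Complex X (- s))) g + contour_integral (linepath (Complex X (- s)) (Complex X t)) g"
      by (rule contour_integral_split_linepath[OF c]) (use st in \<open>auto simp: seg\<close>)
    also have "contour_integral (linepath (Complex X (- s)) (Complex X t)) g
        = contour_integral (linepath (Complex X (- s)) (Complex X s)) g + contour_integral (linepath (Complex X s) (Complex X t)) g"
      by (rule contour_integral_split_linepath[OF c]) (use st in \<open>auto simp: seg\<close>)
    finally have eq: "contour_integral (linepath (Complex X (- t)) (Complex X t)) g
        = contour_integral (linepath (Complex X (- t)) (Complex X (- s))) g
          + (contour_integral (linepath (Complex X (- s)) (Complex X s)) g + contour_integral (linepath (Complex X s) (Complex X t)) g)" .
    have b1: "norm (contour_integral (linepath (Complex X (- t)) (Complex X (- s))) g) \<le> B M * norm (Complex X (- s) - Complex X (- t))"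
      by (rule contour_integral_bound_linepath[OF ci B]) (use st Suc.prems[of M] in \<open>auto simp: seg s_def t_def\<close>)
    have b2: "norm (contour_integral (linepath (Complex X s) (Complex X t)) g) \<le> B M * norm (Complex X t - Complex X s)"
      by (rule contour_integral_bound_linepath[OF ci B]) (use st Suc.prems[of M] in \<open>auto simp: seg s_def t_def\<close>)
    have l: "norm (Complex X (- s) - Complex X (- t)) = s" "norm (Complex X t - Complex X s) = s"
      using len[of "- t" "- s"] len[of s t] st by auto
    have "norm (contour_integral (linepath (Complex X (- t)) (Complex X t)) g)
        \<le> B M * s + (2 * n * Bc + (\<Sum>i<M. 2 * (2 ^ i * n) * B i) + B M * s)"
      unfolding eq by (intro norm_triangle_le add_mono IH b1[unfolded l] b2[unfolded l])
    also have "\<dots> = 2 * n * Bc + (\<Sum>i<Suc M. 2 * (2 ^ i * n) * B i)" by (simp add: s_def)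
    finally show ?case by (simp only: t_def)
  }
qed

section \<open>The difference of the spectral projections\<close>

lemma Lp_diff:
  assumes p: "1 \<le> p" and f: "f \<in> Lp (ereal p)" and g: "g \<in> Lp (ereal p)"
  shows "(\<lambda>x. f x - g x) \<in> Lp (ereal p)"
proof -
  have p0: "p > 0" using p by simp
  have [measurable]: "f \<in> borel_measurable (lebesgue_on {0..pi})" "g \<in> borel_measurable (lebesgue_on {0..pi})"
    using f g by (auto simp: Lp_def)
  have i: "integrable (lebesgue_on {0..pi}) (\<lambda>x. norm (f x) powr p)" "integrable (lebesgue_on {0..pi}) (\<lambda>x. norm (g x) powr p)"
    using f g unfolding Lp_iff[OF p0] by auto
  have "integrable (lebesgue_on {0..pi}) (\<lambda>x. norm (f x - g x) powr p)"
  proof (rule Bochner_Integration.integrable_bound)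
    show "integrable (lebesgue_on {0..pi}) (\<lambda>x. 2 powr p * (norm (f x) powr p + norm (g x) powr p))"
      using i by auto
    have "norm (f x - g x) powr p \<le> 2 powr p * (norm (f x) powr p + norm (g x) powr p)" for x
    proof -
      define M where "M = max (norm (f x)) (norm (g x))"
      have M: "0 \<le> M" by (simp add: M_def le_max_iff_disj)
      have "norm (f x - g x) \<le> 2 * M"
        using norm_triangle_ineq4[of "f x" "g x"] by (auto simp: M_def)
      then have "norm (f x - g x) powr p \<le> (2 * M) powr p" using p by (intro powr_mono2) auto
      also have "\<dots> = 2 powr p * M powr p" using M by (simp add: powr_mult)
      also have "\<dots> \<le> 2 powr p * (norm (f x) powr p + norm (g x) powr p)"
        by (intro mult_left_mono) (auto simp: M_def max_def)
      finally show ?thesis .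
    qed
    then show "AE x in lebesgue_on {0..pi}. norm (norm (f x - g x) powr p) \<le> norm (2 powr p * (norm (f x) powr p + norm (g x) powr p))"
      by (intro AE_I2) simp
  qed measurable
  then show ?thesis unfolding Lp_iff[OF p0] by simp
qed

lemma norm_square_root_ge:
  fixes \<mu> \<nu> :: complex
  assumes "\<mu> ^ 2 = \<nu>" "real N ^ 2 \<le> norm \<nu>"
  shows "real N \<le> norm \<mu>"
proof -
  have "norm \<mu> ^ 2 = norm \<nu>" unfolding assms(1)[symmetric] norm_power ..
  then have "real N ^ 2 \<le> norm \<mu> ^ 2" using assms(2) by (simp only:)
  then show ?thesis by (rule power2_le_imp_le) simp
qed

text \<open>The contour is cut into the two dyadic pieces for each \<open>j < M\<close>, the part \<open>\<bar>Im \<lambda>\<bar> \<le> N\<close> of the line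
  \<open>Re \<lambda> = N\<^sup>2 + N\<close> (\<open>j = M\<close>), and the other three sides of the rectangle (\<open>j = M + 1\<close>).\<close>

definition piece_length :: "nat \<Rightarrow> nat \<Rightarrow> nat \<Rightarrow> real" where
  "piece_length N M j = (if j < M then 2 * (2 ^ j * real N) else if j = M then 2 * real N else 6 * (2 ^ M * real N))"

definition piece_abs :: "nat \<Rightarrow> nat \<Rightarrow> nat \<Rightarrow> real" where
  "piece_abs N M j = (if j < M then dyadic_abs N j else if j = M then real N ^ 2 else 2 ^ M * real N)"

definition piece_tau :: "nat \<Rightarrow> nat \<Rightarrow> nat \<Rightarrow> real" where
  "piece_tau N M j = (if j < M then dyadic_tau N j else if j = M then 0 else sqrt (2 ^ M * real N) / 4)"

lemma piece_nonneg:
  assumes "1 \<le> N"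
  shows "0 \<le> piece_length N M j" "0 < piece_abs N M j" "0 \<le> piece_tau N M j"
proof -
  have N: "0 < real N" using assms by simp
  show "0 \<le> piece_length N M j" using N by (simp add: piece_length_def)
  show "0 < piece_abs N M j" using N by (simp add: piece_abs_def dyadic_abs_def less_max_iff_disj)
  show "0 \<le> piece_tau N M j" using N by (simp add: piece_tau_def dyadic_tau_def)
qed

section \<open>The bound on the contour and its transfer to the spectral projections\<close>

context hill_potential
begin

text \<open>Above the threshold for \<open>N\<close>, the line and the whole outer region consist of
  regular points, so any such \<open>H\<close> gives an enclosing rectangle.\<close>

lemma encloses_square:
  assumes N: "1 \<le> N" and large: "17 * L1_norm v \<le> real N" and H: "real N ^ 2 + real N \<le> H"
  shows "encloses_low_eigenvalues bc v N H H"
  unfolding encloses_iff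
proof (intro allI impI)
  fix \<nu> assume \<nu>: "hill_eigenvalue bc v \<nu> \<and> Re \<nu> \<le> real N ^ 2 + real N"
  obtain \<mu> where \<mu>: "\<mu> ^ 2 = \<nu>" "0 \<le> Im \<mu>" using square_root_upper_half_plane by blast
  have reg: "\<not> (far_from_spectrum \<mu> \<and> real N \<le> norm \<mu>)"
    using far_regular[of \<mu>] large \<nu> \<mu> by auto
  have "1 \<le> real N" using N by simp
  then have H1: "1 \<le> H" using H zero_le_power2[of "real N"] by linarith
  have "Re \<nu> \<noteq> real N ^ 2 + real N"
    using far_from_spectrum_line[OF N \<mu>] reg by blast
  moreover have "\<not> (Re \<nu> \<le> - H \<or> H \<le> \<bar>Im \<nu>\<bar>)"
  proof
    assume out: "Re \<nu> \<le> - H \<or> H \<le> \<bar>Im \<nu>\<bar>"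
    have "Re \<nu> \<le> H" using \<nu> H by linarith
    note o = outer_region[OF \<mu> H1 this out]
    have "1 \<le> sqrt H" using H1 by simp
    then have "1 / 4 \<le> Im \<mu>" using o(1) by linarith
    moreover have "real N ^ 2 \<le> norm \<nu>" using o(2) H \<open>1 \<le> real N\<close> by linarith
    ultimately show False
      using reg far_from_spectrum_large_Im norm_square_root_ge[OF \<mu>(1)] by blast
  qed
  ultimately show "- H < Re \<nu> \<and> Re \<nu> < real N ^ 2 + real N \<and> - H < Im \<nu> \<and> Im \<nu> < H"
    using \<nu> by linarith
qed

definition potential_kernel :: "real \<Rightarrow> real \<Rightarrow> real" where
  "potential_kernel t x = integral {0..pi} (\<lambda>s. green_bound t x s * norm (v s))"

lemma potential_kernel_nonneg: "0 \<le> potential_kernel t x"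
  unfolding potential_kernel_def using green_bound_nonneg
  by (intro Henstock_Kurzweil_Integration.integral_nonneg green_bound_integrable v) auto

text \<open>The true \<open>Im \<mu>\<close> and \<open>|\<nu>|\<close> are replaced by lower bounds
  \<open>t\<close> and \<open>l\<close>, so that the right-hand side is constant along a piece of
  the contour.\<close>

lemma resolvent_difference_at:
  assumes a: "1 \<le> a" and f: "f \<in> Lp (ereal a)" and \<mu>: "\<mu> ^ 2 = \<nu>"
    and far: "far_from_spectrum \<mu>" and large: "17 * L1_norm v \<le> norm \<mu>"
    and t: "0 \<le> t" "t \<le> Im \<mu>" and l: "0 < l" "l \<le> norm \<nu>" and x: "x \<in> {0..pi}"
  shows "norm (R \<nu> f x - hill_sol bc (\<lambda>_. 0) \<nu> f x)
     \<le> 90 * enn2real (lp_norm (ereal a) f) * (1 + t) powr - (1 - 1 / a) / l * potential_kernel t x"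
proof -
  define S where "S = 90 * enn2real (lp_norm (ereal a) f) * (1 + t) powr - (1 - 1 / a)"
  have S0: "0 \<le> S" by (simp add: S_def)
  have fi: "f absolutely_integrable_on {0..pi}" by (rule absolutely_integrable_onI_Lp[OF a f])
  have \<tau>: "0 \<le> Im \<mu>" using t by simp
  have S: "integral {0..pi} (\<lambda>s. green_bound (Im \<mu>) x s * norm (f s)) \<le> S" if x: "x \<in> {0..pi}" for x
  proof -
    have "integral {0..pi} (\<lambda>s. green_bound (Im \<mu>) x s * norm (f s))
        \<le> 90 * enn2real (lp_norm (ereal a) f) * (1 + Im \<mu>) powr - (1 - 1 / a)"
      by (rule green_bound_Lp_sup[OF a f \<tau> x])
    also have "\<dots> \<le> S"
      unfolding S_def using t a by (intro mult_left_mono powr_mono2') auto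
    finally show ?thesis .
  qed
  have n: "norm \<mu> ^ 2 = norm \<nu>" unfolding \<mu>[symmetric] norm_power ..
  have "norm (R \<nu> f x - hill_sol bc (\<lambda>_. 0) \<nu> f x) \<le> S / norm \<nu> * potential_kernel (Im \<mu>) x"
    using resolvent_difference_bound[OF far large fi S x] unfolding \<mu> n potential_kernel_def .
  also have "\<dots> \<le> S / l * potential_kernel t x"
  proof (intro mult_mono divide_left_mono)
    show "potential_kernel (Im \<mu>) x \<le> potential_kernel t x"
      unfolding potential_kernel_def using t(2) x
      by (intro integral_le green_bound_integrable v mult_right_mono green_bound_antimono) auto
    have "0 < norm \<nu>" using l by linarith
    then show "0 < norm \<nu> * l" using l by simp
  qed (use S0 l potential_kernel_nonneg in auto)
  finally show ?thesis by (simp add: S_def)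
qed

text \<open>The bound stays pointwise in \<open>x\<close>; the \<open>L^b\<close> norm is taken only
  after summation over the pieces. The form \<open>H = 2^M N\<close> lets the dyadic pieces fill the
  right side exactly.\<close>

lemma rect_difference_bound:
  assumes a: "1 \<le> a" and f: "f \<in> Lp (ereal a)" and N: "1 \<le> N" and large: "17 * L1_norm v \<le> real N"
    and H: "H = 2 ^ M * real N" "real N ^ 2 + real N \<le> H" and x: "x \<in> {0..pi}"
  shows "norm (contour_R (rect N H H) f x - hill_potential.contour_R bc (\<lambda>_. 0) (rect N H H) f x)
     \<le> (\<Sum>j<Suc (Suc M). piece_length N M j *
          (90 * enn2real (lp_norm (ereal a) f) * (1 + piece_tau N M j) powr - (1 - 1 / a) / piece_abs N M j)
           * potential_kernel (piece_tau N M j) x)"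
proof -
  interpret free: hill_potential bc "\<lambda>_. 0" by unfold_locales simp
  have fi: "f absolutely_integrable_on {0..pi}" by (rule absolutely_integrable_onI_Lp[OF a f])
  define X where "X = real N ^ 2 + real N"
  have N1: "1 \<le> real N" using N by simp
  have H1: "1 \<le> H" "real N ^ 2 \<le> H" "X \<le> H" "0 \<le> X" 
    unfolding X_def using H(2) N1 zero_le_power2[of "real N"] by linarith+
  define g where "g \<nu> = R \<nu> f x - free.R \<nu> f x" for \<nu>
  define S where "S = {\<nu>. regular \<nu>} \<inter> {\<nu>. free.regular \<nu>}"
  have oS: "open S" unfolding S_def by (intro open_Int open_regular free.open_regular)
  have hol: "g holomorphic_on S"
    unfolding g_def S_def
    by (intro holomorphic_on_diff holomorphic_on_subset[OF R_holomorphic[OF fi x]]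
        holomorphic_on_subset[OF free.R_holomorphic[OF fi x]]) auto
  have reg: "\<nu> \<in> S" if "\<mu> ^ 2 = \<nu>" "far_from_spectrum \<mu>" "real N \<le> norm \<mu>" for \<mu> \<nu>
    using far_regular[of \<mu>] free.far_regular[of \<mu>] that large unfolding S_def by auto
  have line: "\<nu> \<in> S" if "Re \<nu> = X" for \<nu>
  proof -
    obtain \<mu> where \<mu>: "\<mu> ^ 2 = \<nu>" "0 \<le> Im \<mu>" using square_root_upper_half_plane by blast
    show ?thesis using far_from_spectrum_line[OF N \<mu>] that reg[OF \<mu>(1)] by (simp add: X_def)
  qed
  define b where "b j = 90 * enn2real (lp_norm (ereal a) f) * (1 + piece_tau N M j) powr - (1 - 1 / a) / piece_abs N M j
           * potential_kernel (piece_tau N M j) x" for j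
  have b0: "0 \<le> b j" for j
    unfolding b_def using piece_nonneg[OF N, of M j] potential_kernel_nonneg
    by (intro mult_nonneg_nonneg divide_nonneg_pos) auto
  have gb: "norm (g \<nu>) \<le> b j"
    if "\<mu> ^ 2 = \<nu>" "far_from_spectrum \<mu>" "real N \<le> norm \<mu>" "piece_tau N M j \<le> Im \<mu>" "piece_abs N M j \<le> norm \<nu>" for j \<mu> \<nu>
    unfolding g_def b_def
    by (rule resolvent_difference_at[OF a f that(1,2)]) (use that large piece_nonneg[OF N] x in auto)
  have outer: "\<nu> \<in> S \<and> norm (g \<nu>) \<le> b (Suc M)" if "Re \<nu> \<le> X" "Re \<nu> \<le> - H \<or> H \<le> \<bar>Im \<nu>\<bar>" for \<nu>
  proof -
    obtain \<mu> where \<mu>: "\<mu> ^ 2 = \<nu>" "0 \<le> Im \<mu>" using square_root_upper_half_plane by blast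
    have "Re \<nu> \<le> H" using that(1) H1 by linarith
    note o = outer_region[OF \<mu> H1(1) this that(2)]
    have "1 \<le> sqrt H" using H1(1) by simp
    then have far: "far_from_spectrum \<mu>" using o(1) by (intro far_from_spectrum_large_Im) linarith
    have n: "real N \<le> norm \<mu>" using o(2) H1(2) by (intro norm_square_root_ge[OF \<mu>(1)]) linarith
    show ?thesis using reg[OF \<mu>(1) far n] gb[OF \<mu>(1) far n, of "Suc M"] o
      by (simp add: piece_tau_def piece_abs_def H(1))
  qed
  have cline: "continuous_on {z. Re z = X} g"
    by (rule holomorphic_on_imp_continuous_on[OF holomorphic_on_subset[OF hol]]) (use line in auto)
  have right: "norm (contour_integral (linepath (Complex X (- H)) (Complex X H)) g)
      \<le> 2 * real N * b M + (\<Sum>i<M. 2 * (2 ^ i * real N) * b i)"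
    unfolding H(1)
  proof (rule contour_integral_dyadic_line[OF cline _ b0 b0])
    show "0 < real N" using N1 by simp
    fix z assume z: "Re z = X"
    obtain \<mu> where \<mu>: "\<mu> ^ 2 = z" "0 \<le> Im \<mu>" using square_root_upper_half_plane by blast
    note L = far_from_spectrum_line[OF N \<mu> z[unfolded X_def]]
    have zX: "X \<le> norm z" using z abs_Re_le_cmod[of z] by simp
    have zN: "real N ^ 2 \<le> norm z" using zX N1 by (simp add: X_def)
    show "norm (g z) \<le> b M"
      by (rule gb[OF \<mu>(1) L]) (use \<mu>(2) zN in \<open>simp_all add: piece_tau_def piece_abs_def\<close>)
    fix i assume i: "i < M" and y: "2 ^ i * real N \<le> \<bar>Im z\<bar>" "\<bar>Im z\<bar> \<le> 2 ^ Suc i * real N"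
    have y2: "\<bar>Im z\<bar> \<le> 2 * (2 ^ i * real N)" "0 < 2 ^ i * real N" using y N1 by auto
    note T = Im_square_root_line[OF N \<mu> z[unfolded X_def] y(1) y2]
    have "dyadic_tau N i \<le> Im \<mu>"
    proof (cases "2 ^ i \<le> real N")
      case True
      then have "2 ^ i * real N \<le> real N ^ 2" using N1 by (simp add: power2_eq_square)
      from T(1)[OF this] show ?thesis using True N1 by (simp add: dyadic_tau_def)
    next
      case False
      then have "real N ^ 2 \<le> 2 ^ i * real N" using N1 by (simp add: power2_eq_square)
      from T(2)[OF this] show ?thesis using False by (simp add: dyadic_tau_def)
    qed
    moreover have "dyadic_abs N i \<le> norm z"
      using zN y(1) abs_Im_le_cmod[of z] by (simp add: dyadic_abs_def)
    ultimately show "norm (g z) \<le> b i"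
      using i by (intro gb[OF \<mu>(1) L]) (simp_all add: piece_tau_def piece_abs_def)
  qed
  define a1 a2 a3 a4 where "a1 = Complex (- H) (- H)" and "a2 = Complex X (- H)" and "a3 = Complex X H" and "a4 = Complex (- H) H"
  have rp: "rect N H H = linepath a1 a2 +++ linepath a2 a3 +++ linepath a3 a4 +++ linepath a4 a1"
    by (simp add: rectpath_def Let_def corner_ll_def corner_ur_def a1_def a2_def a3_def a4_def X_def)
  have s12: "z \<in> closed_segment a1 a2 \<Longrightarrow> Re z \<le> X \<and> Im z = - H"
    and s34: "z \<in> closed_segment a3 a4 \<Longrightarrow> Re z \<le> X \<and> Im z = H"
    and s41: "z \<in> closed_segment a4 a1 \<Longrightarrow> Re z = - H"
    and s23: "z \<in> closed_segment a2 a3 \<Longrightarrow> Re z = X" for z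
    using H1 unfolding a1_def a2_def a3_def a4_def
    by (auto simp: closed_segment_same_Re closed_segment_same_Im closed_segment_eq_real_ivl split: if_splits)
  have o12: "z \<in> S \<and> norm (g z) \<le> b (Suc M)" if "z \<in> closed_segment a1 a2" for z
    using s12[OF that] H1 by (intro outer) auto
  have o34: "z \<in> S \<and> norm (g z) \<le> b (Suc M)" if "z \<in> closed_segment a3 a4" for z
    using s34[OF that] H1 by (intro outer) auto
  have o41: "z \<in> S \<and> norm (g z) \<le> b (Suc M)" if "z \<in> closed_segment a4 a1" for z
    using s41[OF that] H1 by (intro outer) auto
  have c: "g contour_integrable_on linepath u w" if "closed_segment u w \<subseteq> S" for u w
    using that by (intro contour_integrable_holomorphic_simple[OF hol oS]) auto
  have c12: "g contour_integrable_on linepath a1 a2" and c34: "g contour_integrable_on linepath a3 a4"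
    and c41: "g contour_integrable_on linepath a4 a1" and c23: "g contour_integrable_on linepath a2 a3"
    using o12 o34 o41 s23 line by (intro c subsetI; blast)+
  have split: "contour_integral (rect N H H) g = contour_integral (linepath a1 a2) g + (contour_integral (linepath a2 a3) g
      + (contour_integral (linepath a3 a4) g + contour_integral (linepath a4 a1) g))"
    unfolding rp using c12 c23 c34 c41
    by (simp add: contour_integral_join contour_integrable_join valid_path_join)
  have n12: "norm (contour_integral (linepath a1 a2) g) \<le> b (Suc M) * norm (a2 - a1)"
    using o12 by (intro contour_integral_bound_linepath c12 b0) blast
  have n34: "norm (contour_integral (linepath a3 a4) g) \<le> b (Suc M) * norm (a4 - a3)"
    using o34 by (intro contour_integral_bound_linepath c34 b0) blast
  have n41: "norm (contour_integral (linepath a4 a1) g) \<le> b (Suc M) * norm (a1 - a4)"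
    using o41 by (intro contour_integral_bound_linepath c41 b0) blast
  \<comment> \<open>Three sides of length at most \<open>2 H\<close> account for the
    \<open>6 (2^M N)\<close> in \<open>piece_length\<close>.\<close>
  have lens: "norm (a2 - a1) \<le> 2 * H" "norm (a4 - a3) \<le> 2 * H" "norm (a1 - a4) \<le> 2 * H"
    using H1 cmod_le[of "a2 - a1"] cmod_le[of "a4 - a3"] cmod_le[of "a1 - a4"]
    by (simp_all add: a1_def a2_def a3_def a4_def)
  have r12: "norm (contour_integral (linepath a1 a2) g) \<le> b (Suc M) * (2 * H)"
    by (rule order.trans[OF n12 mult_left_mono[OF lens(1) b0]])
  have r34: "norm (contour_integral (linepath a3 a4) g) \<le> b (Suc M) * (2 * H)"
    by (rule order.trans[OF n34 mult_left_mono[OF lens(2) b0]])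
  have r41: "norm (contour_integral (linepath a4 a1) g) \<le> b (Suc M) * (2 * H)"
    by (rule order.trans[OF n41 mult_left_mono[OF lens(3) b0]])
  have r23: "norm (contour_integral (linepath a2 a3) g) \<le> 2 * real N * b M + (\<Sum>i<M. 2 * (2 ^ i * real N) * b i)"
    using right by (simp add: a2_def a3_def)
  have "norm (contour_integral (rect N H H) g) \<le> b (Suc M) * (2 * H) +
      ((2 * real N * b M + (\<Sum>i<M. 2 * (2 ^ i * real N) * b i)) + (b (Suc M) * (2 * H) + b (Suc M) * (2 * H)))"
    unfolding split by (intro norm_triangle_le add_mono r12 r23 r34 r41)
  also have "\<dots> = (\<Sum>j<Suc (Suc M). piece_length N M j * b j)"
  proof -
    have "(\<Sum>j<M. piece_length N M j * b j) = (\<Sum>i<M. 2 * (2 ^ i * real N) * b i)"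
      by (intro sum.cong) (auto simp: piece_length_def)
    then show ?thesis by (simp add: piece_length_def H(1))
  qed
  finally have *: "norm (contour_integral (rect N H H) g) \<le> (\<Sum>j<Suc (Suc M). piece_length N M j * b j)" .
  have pos: "H > 0" using H1 by simp
  have e: "encloses_low_eigenvalues bc v N H H" by (rule encloses_square[OF N large H(2)])
  have e0: "encloses_low_eigenvalues bc (\<lambda>_. 0) N H H" by (rule free.encloses_square[OF N _ H(2)]) simp
  have "contour_integral (rect N H H) g = contour_R (rect N H H) f x - free.contour_R (rect N H H) f x"
    unfolding g_def contour_R_def free.contour_R_def
    by (intro contour_integral_diff R_contour_integrable free.R_contour_integrable valid_path_rectpath fi x
        rect_regular[OF e pos pos] free.rect_regular[OF e0 pos pos])
  with * show ?thesis by (simp only: b_def mult.assoc)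
qed

text \<open>The extension of the difference of the projections to \<open>L^a\<close>, given by an
  explicit formula instead of a limit.\<close>

definition spectral_difference :: "nat \<Rightarrow> real \<Rightarrow> real \<Rightarrow> fop" where
  "spectral_difference N \<omega> h f x =
     1 / (2 * of_real pi * \<i>) * (contour_R (rect N \<omega> h) f x - hill_potential.contour_R bc (\<lambda>_. 0) (rect N \<omega> h) f x)"

text \<open>The constant 32400 is 360 times 90: the former from the \<open>L^b\<close> norm of the
  kernel against \<open>v\<close>, the latter from the sup norm of the kernel against
  \<open>f\<close>.\<close>

lemma spectral_difference_bound:
  assumes p: "1 \<le> p" and vp: "v \<in> Lp (ereal p)" and K: "K > 0"
    and le: "integral {0..pi} (\<lambda>x. norm (v x) powr p) \<le> pi * K powr p"
    and b: "1 < b" "real_of_ereal (1 / b) \<le> 1 / p" and a: "1 \<le> a" and f: "f \<in> Lp (ereal a)"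
    and \<gamma>: "\<gamma> = (1 - 1 / p) + (1 - (1 / a - real_of_ereal (1 / b)))"
    and C: "\<And>N M. 2 \<le> N \<Longrightarrow> real N ^ 2 \<le> 2 ^ M * real N \<Longrightarrow>
     2 / real N + (\<Sum>i<M. 2 * (2 ^ i * real N) / dyadic_abs N i * (1 + dyadic_tau N i) powr - \<gamma>)
       + 6 * (1 + sqrt (2 ^ M * real N) / 4) powr - \<gamma> \<le> C * decay_rate \<gamma> N"
    and N: "2 \<le> N" and large: "17 * L1_norm v \<le> real N"
    and adm: "admissible bc v N \<omega> h"
  shows "continuous_on {0..pi} (spectral_difference N \<omega> h f)"
    and "lp_norm b (spectral_difference N \<omega> h f) \<le> ennreal (32400 * K * C * decay_rate \<gamma> N) * lp_norm (ereal a) f"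
proof -
  interpret free: hill_potential bc "\<lambda>_. 0" by unfold_locales simp
  define F where "F = enn2real (lp_norm (ereal a) f)"
  have F0: "0 \<le> F" by (simp add: F_def)
  have fi: "f absolutely_integrable_on {0..pi}" by (rule absolutely_integrable_onI_Lp[OF a f])
  have pos: "\<omega> > 0" "h > 0" and e: "encloses_low_eigenvalues bc v N \<omega> h" and e0: "encloses_low_eigenvalues bc (\<lambda>_. 0) N \<omega> h"
    using adm by (auto simp: admissible_def)
  have N1: "1 \<le> N" "1 \<le> real N" using N by auto
  \<comment> \<open>\<open>M\<close> is large enough for \<open>H\<close> to exceed both the given
    rectangle and \<open>N^2 + N\<close>. It depends on the rectangle, but the bound
    \<open>C\<close> on the dyadic sum does not depend on \<open>M\<close>.\<close>
  obtain M where M: "max (max \<omega> h) (real N ^ 2 + real N) < 2 ^ M"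
    using real_arch_pow[of 2 "max (max \<omega> h) (real N ^ 2 + real N)"] by auto
  define H where "H = 2 ^ M * real N"
  have "2 ^ M * 1 \<le> H" unfolding H_def using N1(2) by (intro mult_left_mono) auto
  then have H: "\<omega> \<le> H" "h \<le> H" "real N ^ 2 + real N \<le> H"
    using M unfolding max_less_iff_conj by linarith+
  show cont: "continuous_on {0..pi} (spectral_difference N \<omega> h f)"
    unfolding spectral_difference_def
    by (intro continuous_intros contour_R_continuous free.contour_R_continuous valid_path_rectpath
        bounded_speed_rectpath fi rect_regular[OF e pos] free.rect_regular[OF e0 pos])
  define c where "c j = piece_length N M j * (90 * F * (1 + piece_tau N M j) powr - (1 - 1 / a) / piece_abs N M j)" for j
  note pn = piece_nonneg[OF N1(1), of M]
  have c0: "0 \<le> c j" for j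
    unfolding c_def using pn[of j] F0 by (intro mult_nonneg_nonneg divide_nonneg_pos) auto
  have hb: "norm (spectral_difference N \<omega> h f x)
      \<le> (\<Sum>j<Suc (Suc M). c j * integral {0..pi} (\<lambda>s. green_bound (piece_tau N M j) x s * norm (v s)))"
    if x: "x \<in> {0..pi}" for x
  proof -
    define D where "D = contour_R (rect N H H) f x - free.contour_R (rect N H H) f x"
    have "spectral_difference N \<omega> h f x = 1 / (2 * of_real pi * \<i>) * D"
      unfolding spectral_difference_def D_def contour_R_enlarge[OF e pos H(1,2) fi x]
        free.contour_R_enlarge[OF e0 pos H(1,2) fi x] ..
    then have "norm (spectral_difference N \<omega> h f x) = 1 / (2 * pi) * norm D"
      by (simp add: norm_mult norm_divide)
    also have "\<dots> \<le> 1 * norm D" using pi_gt3 by (intro mult_right_mono) auto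
    also have "\<dots> \<le> (\<Sum>j<Suc (Suc M). c j * potential_kernel (piece_tau N M j) x)"
      using rect_difference_bound[OF a f N1(1) large H_def H(3) x] by (simp only: D_def c_def F_def mult_1)
    finally show ?thesis by (simp only: potential_kernel_def)
  qed
  have "lp_norm b (spectral_difference N \<omega> h f)
      \<le> ennreal (360 * K * (\<Sum>j<Suc (Suc M). c j * (1 + piece_tau N M j) powr - (1 - 1 / p + real_of_ereal (1 / b))))"
    by (rule lp_norm_le_kernel_sum[OF p vp K le b _ c0 pn(3) cont hb]) simp_all
  also have "\<dots> \<le> ennreal (32400 * K * C * decay_rate \<gamma> N * F)"
  proof (rule ennreal_leI)
    \<comment> \<open>The decay from \<open>f\<close> and the decay from \<open>v\<close> multiply,
      and their exponents add up to \<gamma>.\<close>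
    have summand: "c j * (1 + piece_tau N M j) powr - (1 - 1 / p + real_of_ereal (1 / b))
        = 90 * F * (piece_length N M j / piece_abs N M j * (1 + piece_tau N M j) powr - \<gamma>)" for j
    proof -
      have g: "- \<gamma> = - (1 - 1 / a) + - (1 - 1 / p + real_of_ereal (1 / b))" by (simp add: \<gamma>)
      show ?thesis unfolding g powr_add by (simp add: c_def mult_ac)
    qed
    have s: "(\<Sum>i<M. piece_length N M i / piece_abs N M i * (1 + piece_tau N M i) powr - \<gamma>)
        = (\<Sum>i<M. 2 * (2 ^ i * real N) / dyadic_abs N i * (1 + dyadic_tau N i) powr - \<gamma>)"
      by (intro sum.cong) (auto simp: piece_length_def piece_abs_def piece_tau_def)
    have sM: "piece_length N M M / piece_abs N M M * (1 + piece_tau N M M) powr - \<gamma> = 2 / real N"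
      using N1 by (simp add: piece_length_def piece_abs_def piece_tau_def power2_eq_square)
    have sSM: "piece_length N M (Suc M) / piece_abs N M (Suc M) * (1 + piece_tau N M (Suc M)) powr - \<gamma>
        = 6 * (1 + sqrt (2 ^ M * real N) / 4) powr - \<gamma>"
      using N1 by (simp add: piece_length_def piece_abs_def piece_tau_def)
    have "(\<Sum>j<Suc (Suc M). c j * (1 + piece_tau N M j) powr - (1 - 1 / p + real_of_ereal (1 / b)))
        = 90 * F * (\<Sum>j<Suc (Suc M). piece_length N M j / piece_abs N M j * (1 + piece_tau N M j) powr - \<gamma>)"
      unfolding summand by (rule sum_distrib_left[symmetric])
    also have "(\<Sum>j<Suc (Suc M). piece_length N M j / piece_abs N M j * (1 + piece_tau N M j) powr - \<gamma>)
        = 2 / real N + (\<Sum>i<M. 2 * (2 ^ i * real N) / dyadic_abs N i * (1 + dyadic_tau N i) powr - \<gamma>)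
       + 6 * (1 + sqrt (2 ^ M * real N) / 4) powr - \<gamma>"
      unfolding sum.lessThan_Suc s sM sSM by (simp only: add_ac)
    finally have eq: "(\<Sum>j<Suc (Suc M). c j * (1 + piece_tau N M j) powr - (1 - 1 / p + real_of_ereal (1 / b)))
        = 90 * F * (2 / real N + (\<Sum>i<M. 2 * (2 ^ i * real N) / dyadic_abs N i * (1 + dyadic_tau N i) powr - \<gamma>)
       + 6 * (1 + sqrt (2 ^ M * real N) / 4) powr - \<gamma>)" .
    have "real N ^ 2 \<le> 2 ^ M * real N" using H(3) N1 by (simp add: H_def)
    from C[OF N this]
    have "360 * K * (90 * F * (2 / real N + (\<Sum>i<M. 2 * (2 ^ i * real N) / dyadic_abs N i * (1 + dyadic_tau N i) powr - \<gamma>)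
       + 6 * (1 + sqrt (2 ^ M * real N) / 4) powr - \<gamma>)) \<le> 360 * K * (90 * F * (C * decay_rate \<gamma> N))"
      using K F0 by (intro mult_left_mono) auto
    also have "\<dots> = 32400 * K * C * decay_rate \<gamma> N * F" by simp
    finally show "360 * K * (\<Sum>j<Suc (Suc M). c j * (1 + piece_tau N M j) powr - (1 - 1 / p + real_of_ereal (1 / b)))
        \<le> 32400 * K * C * decay_rate \<gamma> N * F"
      unfolding eq .
  qed
  also have "\<dots> = ennreal (32400 * K * C * decay_rate \<gamma> N) * ennreal F"
    using F0 by (rule ennreal_mult'')
  also have "ennreal F = lp_norm (ereal a) f" using lp_norm_finite[OF f] by (simp only: F_def)
  finally show "lp_norm b (spectral_difference N \<omega> h f) \<le> ennreal (32400 * K * C * decay_rate \<gamma> N) * lp_norm (ereal a) f" .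
qed

lemma contour_R_diff:
  assumes \<gamma>: "valid_path \<gamma>" "path_image \<gamma> \<subseteq> {\<mu>. regular \<mu>}"
    and f: "f absolutely_integrable_on {0..pi}" and g: "g absolutely_integrable_on {0..pi}"
  shows "contour_R \<gamma> (\<lambda>t. f t - g t) x = contour_R \<gamma> f x - contour_R \<gamma> g x"
proof -
  have lin: "R \<mu> (\<lambda>t. f t - g t) x = R \<mu> f x - R \<mu> g x" if "\<mu> \<in> path_image \<gamma>" for \<mu>
    using R_linear[of \<mu> f g "- 1" x] that \<gamma>(2) f g by auto
  have int: "(\<lambda>\<mu>. R \<mu> k x) contour_integrable_on \<gamma>" if k: "k absolutely_integrable_on {0..pi}" for k
  \<comment> \<open>The operator identity is claimed at every real \<open>x\<close>; outside the
    interval the resolvents vanish, so the integrand is 0 along the path.\<close>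
  proof (cases "x \<in> {0..pi}")
    case True
    then show ?thesis by (rule R_contour_integrable[OF \<gamma> k])
  next
    case False
    have "(\<lambda>\<mu>. 0) contour_integrable_on \<gamma>"
      by (rule contour_integrable_holomorphic_simple[OF _ open_UNIV \<gamma>(1)]) auto
    then show ?thesis
      by (rule contour_integrable_eq) (use False \<gamma>(2) k R_outside in auto)
  qed
  have "contour_R \<gamma> (\<lambda>t. f t - g t) x = contour_integral \<gamma> (\<lambda>\<mu>. R \<mu> f x - R \<mu> g x)"
    unfolding contour_R_def by (rule contour_integral_eq) (rule lin)
  also have "\<dots> = contour_R \<gamma> f x - contour_R \<gamma> g x"
    unfolding contour_R_def by (rule contour_integral_diff[OF int[OF f] int[OF g]])
  finally show ?thesis .
qed

text \<open>\<open>contour_R\<close> witnesses that a limit exists, so the chosen one is a limit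
  too, and uniqueness identifies them.\<close>

lemma op_contour_integral_AE:
  assumes \<gamma>: "valid_path \<gamma>" "path_image \<gamma> \<subseteq> {\<mu>. regular \<mu>}" "bounded_speed \<gamma>" and f: "f \<in> Lp 2"
  shows "AE x in lebesgue_on {0..pi}. op_contour_integral \<gamma> (hill_resolvent bc v) f x = contour_R \<gamma> f x"
proof (rule has_op_contour_integral_unique[OF _ has_op_contour_integral_contour_R[OF \<gamma>] _ f])
  show "has_op_contour_integral (hill_resolvent bc v) (op_contour_integral \<gamma> (hill_resolvent bc v)) \<gamma>"
    unfolding op_contour_integral_def by (rule someI[of "\<lambda>S. has_op_contour_integral (hill_resolvent bc v) S \<gamma>", OF has_op_contour_integral_contour_R[OF \<gamma>]])
  fix t :: real and f assume t: "t \<in> {0..1}" and f: "f \<in> Lp 2"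
  have "\<gamma> t \<in> path_image \<gamma>" using t by (auto simp: path_image_def)
  then have "regular (\<gamma> t)" using \<gamma>(2) by blast
  then show "hill_resolvent bc v (\<gamma> t) f \<in> borel_measurable (lebesgue_on {0..pi})"
    unfolding hill_resolvent_eq_hill_sol[OF v f]
    by (intro continuous_imp_measurable_on_sets_lebesgue R_continuous Lp2_absolutely_integrable f) auto
qed

text \<open>Both norms are infima, so one extension with one constant suffices. Subtractivity turns
  the norm bound into continuity of \<open>spectral_difference\<close>.\<close>

lemma ext_opnorm_spectral_difference:
  assumes a: "1 \<le> a" and b: "1 \<le> b" and adm: "admissible bc v N \<omega> h"
    and cont: "\<And>f. f \<in> Lp (ereal a) \<Longrightarrow> continuous_on {0..pi} (spectral_difference N \<omega> h f)"
    and bound: "\<And>f. f \<in> Lp (ereal a) \<Longrightarrow> lp_norm b (spectral_difference N \<omega> h f) \<le> ennreal c * lp_norm (ereal a) f"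
  shows "ext_opnorm (ereal a) b
      (\<lambda>f x. spectral_proj bc v N \<omega> h f x - spectral_proj bc (\<lambda>_. 0) N \<omega> h f x) \<le> ennreal c"
proof -
  interpret free: hill_potential bc "\<lambda>_. 0" by unfold_locales simp
  have pos: "\<omega> > 0" "h > 0" and e: "encloses_low_eigenvalues bc v N \<omega> h" and e0: "encloses_low_eigenvalues bc (\<lambda>_. 0) N \<omega> h"
    using adm by (auto simp: admissible_def)
  note r = valid_path_rectpath rect_regular[OF e pos] bounded_speed_rectpath
  note r0 = valid_path_rectpath free.rect_regular[OF e0 pos] bounded_speed_rectpath
  let ?T = "spectral_difference N \<omega> h"
  have diff: "?T (\<lambda>t. f t - g t) x = ?T f x - ?T g x" if "f \<in> Lp (ereal a)" "g \<in> Lp (ereal a)" for f g x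
    unfolding spectral_difference_def
      contour_R_diff[OF r(1,2) absolutely_integrable_onI_Lp[OF a that(1)] absolutely_integrable_onI_Lp[OF a that(2)]]
      free.contour_R_diff[OF r0(1,2) absolutely_integrable_onI_Lp[OF a that(1)] absolutely_integrable_onI_Lp[OF a that(2)]]
    by (simp add: algebra_simps)
  have "extends_by_continuity (ereal a) b
      (\<lambda>f x. spectral_proj bc v N \<omega> h f x - spectral_proj bc (\<lambda>_. 0) N \<omega> h f x) ?T"
    unfolding extends_by_continuity_def
  proof (intro conjI ballI allI impI)
    fix f assume "f \<in> Lp (ereal a)"
    then show "?T f \<in> Lp b" by (rule Lp_continuous[OF cont b])
  next
    fix f assume f: "f \<in> Lp 2"
    show "AE x in lebesgue_on {0..pi}. ?T f x = spectral_proj bc v N \<omega> h f x - spectral_proj bc (\<lambda>_. 0) N \<omega> h f x"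
      using op_contour_integral_AE[OF r f] free.op_contour_integral_AE[OF r0 f]
    proof eventually_elim
      case (elim x)
      then show ?case by (simp only: spectral_proj_def spectral_difference_def right_diff_distrib)
    qed
  next
    fix u :: "nat \<Rightarrow> real \<Rightarrow> complex" and f
    assume uf: "(\<forall>n. u n \<in> Lp (ereal a)) \<and> f \<in> Lp (ereal a) \<and> (\<lambda>n. lp_norm (ereal a) (\<lambda>x. u n x - f x)) \<longlonglongrightarrow> 0"
    then have u: "u n \<in> Lp (ereal a)" and f: "f \<in> Lp (ereal a)" for n by auto
    have le: "lp_norm b (\<lambda>x. ?T (u n) x - ?T f x) \<le> ennreal c * lp_norm (ereal a) (\<lambda>x. u n x - f x)" for n
    proof -
      have "?T (\<lambda>x. u n x - f x) = (\<lambda>x. ?T (u n) x - ?T f x)"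
        by (rule ext) (rule diff[OF u f])
      with bound[OF Lp_diff[OF a u f]] show ?thesis by metis
    qed
    have "(\<lambda>n. ennreal c * lp_norm (ereal a) (\<lambda>x. u n x - f x)) \<longlonglongrightarrow> ennreal c * 0"
      by (rule ennreal_tendsto_cmult[OF ennreal_less_top]) (use uf in blast)
    then have lim: "(\<lambda>n. ennreal c * lp_norm (ereal a) (\<lambda>x. u n x - f x)) \<longlonglongrightarrow> 0"
      by (simp only: mult_zero_right)
    show "(\<lambda>n. lp_norm b (\<lambda>x. ?T (u n) x - ?T f x)) \<longlonglongrightarrow> 0"
      by (rule tendsto_sandwich[OF _ _ tendsto_const lim]) (simp_all add: le)
  qed
  then have "ext_opnorm (ereal a) b (\<lambda>f x. spectral_proj bc v N \<omega> h f x - spectral_proj bc (\<lambda>_. 0) N \<omega> h f x)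
      \<le> opnorm (ereal a) b ?T"
    unfolding ext_opnorm_def
    by (intro Inf_lower CollectI exI[of _ ?T] conjI refl)
  also have "\<dots> \<le> ennreal c"
    unfolding opnorm_def by (intro Inf_lower CollectI ballI bound)
  finally show ?thesis .
qed

end

theorem theorem5:
  fixes p a r :: real and b :: ereal and bc :: boundary_condition
  assumes "1 \<le> p" and "p \<le> 2"
    and "1 \<le> a" and "a \<le> 2" and "2 \<le> b"
    and "1 / a - real_of_ereal (1 / b) < 1"
    and "1 / r = 1 / 2 * (1 / p + 1 / a - real_of_ereal (1 / b))"
  shows "1 / r < 1 \<and>
    (\<exists>Nstar :: real \<Rightarrow> nat. \<forall>v \<in> Lp (ereal p). \<exists>C :: real. C > 0 \<and>
      (\<forall>N :: nat. N \<ge> Nstar (enn2real (lp_norm (ereal p) v)) \<longrightarrow>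
        (\<exists>\<omega> h. admissible bc v N \<omega> h) \<and>
        (\<forall>\<omega> h. admissible bc v N \<omega> h \<longrightarrow>
          ext_opnorm (ereal a) b
            (\<lambda>f x. spectral_proj bc v N \<omega> h f x - spectral_proj bc (\<lambda>_. 0) N \<omega> h f x)
          \<le> ennreal (C *
              (if r > 2 then 1 / real N
               else if r = 2 then ln (real N) / real N
               else real N powr
                 - ((1 - 1 / p) + (1 - (1 / a - real_of_ereal (1 / b)))))))))"
proof -
  \<comment> \<open>For \<open>b = \<infinity>\<close> the quotient is 0, so that case needs no
    formula of its own.\<close>
  define \<beta> where "\<beta> = real_of_ereal (1 / b)"
  have \<beta>: "0 \<le> \<beta>" "\<beta> \<le> 1 / 2"
  proof -
    have "0 \<le> \<beta> \<and> \<beta> \<le> 1 / 2"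
    proof (cases b)
      case (real b')
      then have "2 \<le> b'" using assms(5) by simp
      moreover from this have "\<beta> = 1 / b'" using real by (simp add: \<beta>_def one_ereal_def)
      moreover from calculation(1) have "1 / b' \<le> 1 / 2" by (intro divide_left_mono) simp_all
      moreover from calculation(1) have "0 \<le> 1 / b'" by simp
      ultimately show ?thesis by (simp only: simp_thms)
    qed (use assms(5) in \<open>auto simp: \<beta>_def\<close>)
    then show "0 \<le> \<beta>" "\<beta> \<le> 1 / 2" by auto
  qed
  have b1: "1 < b" "1 \<le> b"
    using less_le_trans[of 1 2 b] assms(5) by auto
  have pa: "1 / 2 \<le> 1 / p" "1 / p \<le> 1" "1 / 2 \<le> 1 / a" using assms(1-4) by auto
  define \<gamma> where "\<gamma> = (1 - 1 / p) + (1 - (1 / a - \<beta>))"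
  have \<gamma>0: "\<gamma> > 0" using assms(6) pa by (simp add: \<gamma>_def \<beta>_def)
  have r: "1 / r = 1 - \<gamma> / 2" using assms(7) by (simp add: \<gamma>_def \<beta>_def field_simps)
  \<comment> \<open>Positivity of \<open>r\<close> is what turns comparisons of \<open>1 / r\<close>
    with 1/2 into comparisons of \<open>r\<close> with 2.\<close>
  have "1 / p + 1 / a - \<beta> > 0" using pa \<beta> by linarith
  then have "1 / r > 0" unfolding assms(7) \<beta>_def[symmetric] by (rule mult_pos_pos[rotated]) simp
  then have r0: "r > 0" by simp
  have g1: "\<gamma> > 1 \<longleftrightarrow> r > 2" and g2: "\<gamma> = 1 \<longleftrightarrow> r = 2"
  proof -
    have "\<gamma> > 1 \<longleftrightarrow> 1 / r < 1 / 2" using r by auto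
    also have "\<dots> \<longleftrightarrow> r > 2" using r0 by (simp add: field_simps)
    finally show "\<gamma> > 1 \<longleftrightarrow> r > 2" .
    have "\<gamma> = 1 \<longleftrightarrow> 1 / r = 1 / 2" using r by auto
    also have "\<dots> \<longleftrightarrow> r = 2" using r0 by (simp add: field_simps)
    finally show "\<gamma> = 1 \<longleftrightarrow> r = 2" .
  qed
  obtain C where C: "C > 0" "\<And>N M. 2 \<le> N \<Longrightarrow> real N ^ 2 \<le> 2 ^ M * real N \<Longrightarrow>
     2 / real N + (\<Sum>i<M. 2 * (2 ^ i * real N) / dyadic_abs N i * (1 + dyadic_tau N i) powr - \<gamma>)
       + 6 * (1 + sqrt (2 ^ M * real N) / 4) powr - \<gamma> \<le> C * decay_rate \<gamma> N"
    by (rule dyadic_sum_bound[OF \<gamma>0]) (rule that)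
  \<comment> \<open>The a priori bounds ask for \<open>17 L1_norm v \<le> N\<close>, and the
    unnormalised \<open>L^1\<close> norm is at most \<pi> times the \<open>L^p\<close> norm. The 2
    guarantees a positive logarithm.\<close>
  define Nstar where "Nstar V = nat \<lceil>17 * pi * V\<rceil> + 2" for V
  have main: "\<exists>C' :: real. C' > 0 \<and> (\<forall>N \<ge> Nstar (enn2real (lp_norm (ereal p) v)).
        (\<exists>\<omega> h. admissible bc v N \<omega> h) \<and>
        (\<forall>\<omega> h. admissible bc v N \<omega> h \<longrightarrow>
          ext_opnorm (ereal a) b
            (\<lambda>f x. spectral_proj bc v N \<omega> h f x - spectral_proj bc (\<lambda>_. 0) N \<omega> h f x)
          \<le> ennreal (C' * decay_rate \<gamma> N)))" if vp: "v \<in> Lp (ereal p)" for v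
  proof -
    interpret hill_potential bc v by unfold_locales (rule absolutely_integrable_onI_Lp[OF assms(1) vp])
    interpret free: hill_potential bc "\<lambda>_. 0" by unfold_locales simp
    define V where "V = enn2real (lp_norm (ereal p) v)"
    \<comment> \<open>A positive scale at least as large as the norm, valid also for
      \<open>v = 0\<close>.\<close>
    define K where "K = V + 1"
    have K: "K > 0" by (simp add: K_def V_def add_nonneg_pos)
    have le: "integral {0..pi} (\<lambda>x. norm (v x) powr p) \<le> pi * K powr p"
    proof (rule lp_norm_leD(2))
      show "v \<in> borel_measurable (lebesgue_on {0..pi})" using vp by (simp add: Lp_def)
      show "lp_norm (ereal p) v \<le> ennreal K"
        by (subst lp_norm_finite[OF vp], rule ennreal_leI) (simp add: K_def V_def)
    qed (use assms K in auto)
    show ?thesis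
    proof (rule exI[of _ "32400 * K * C"], intro conjI allI impI)
      show "32400 * K * C > 0" using K C(1) by simp
      fix N assume "Nstar (enn2real (lp_norm (ereal p) v)) \<le> N"
      then have N: "2 \<le> N" "17 * pi * V \<le> real N" unfolding Nstar_def V_def by linarith+
      have large: "17 * L1_norm v \<le> real N"
        using L1_norm_le_lp_norm[OF assms(1) vp] N(2) by (simp add: V_def)
      have N1: "1 \<le> N" using N by simp
      \<comment> \<open>The square of half-side \<open>N^2 + N\<close> is admissible, so the
        estimate over all admissible rectangles is not vacuous.\<close>
      have "real N ^ 2 + real N > 0" using N1 by (simp add: add_nonneg_pos)
      then have "admissible bc v N (real N ^ 2 + real N) (real N ^ 2 + real N)"
        unfolding admissible_def
        using encloses_square[OF N1 large order.refl] free.encloses_square[OF N1 _ order.refl] by simp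
      then show "\<exists>\<omega> h. admissible bc v N \<omega> h" by blast
      fix \<omega> h assume adm: "admissible bc v N \<omega> h"
      have bp: "real_of_ereal (1 / b) \<le> 1 / p" using \<beta> pa by (simp add: \<beta>_def)
      note sd = spectral_difference_bound[OF assms(1) vp K le b1(1) bp assms(3) _ \<gamma>_def[unfolded \<beta>_def] C(2) N(1) large adm]
      show "ext_opnorm (ereal a) b
            (\<lambda>f x. spectral_proj bc v N \<omega> h f x - spectral_proj bc (\<lambda>_. 0) N \<omega> h f x)
          \<le> ennreal (32400 * K * C * decay_rate \<gamma> N)"
        by (rule ext_opnorm_spectral_difference[OF assms(3) b1(2) adm sd])
    qed
  qed
  have rate: "decay_rate \<gamma> N = (if r > 2 then 1 / real N
               else if r = 2 then ln (real N) / real N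
               else real N powr - ((1 - 1 / p) + (1 - (1 / a - real_of_ereal (1 / b)))))" for N
    unfolding decay_rate_def g1 g2 by (simp add: \<gamma>_def \<beta>_def)
  have "1 / r < 1" using r \<gamma>0 by simp
  then show ?thesis
    using main unfolding rate by blast
qed

end
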